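(* Let $H$ be a non-trivial right-uniform color-edge-transitive left-weakly Hölder colored bigraph without isolated vertices and let $G$ be a bigraph with $V_1(G)=V_1(H)$ and without isolated vertices. For every $U\subseteq V_1(G)$, let $$d_G(U)=|\{w\in V_2(G): N_G(w)=U\}|,\qquad d_H(U)=|\{w\in V_2(H): N_H(w)=U\}|.$$ Suppose further that for every $U\subseteq V_1(G)$ with $|U|\geq 2$ the following hold. (i) $\sum_{\sigma\in\mathrm{Aut}(H)}d_G(\sigma(U))=0$ if and only if $\sum_{\sigma\in\mathrm{Aut}(H)}d_H(\sigma(U))=0$. (ii) $\sum_{\sigma\in\mathrm{Aut}(H)}d_G(\sigma(U))\geq\sum_{\sigma\in\mathrm{Aut}(H)}d_H(\sigma(U))$. Then $G$ is a strong Sidorenko bigraph. In particular, the underlying bigraph of $H$ is a strong Sidorenko bigraph.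
   Context: A bigraph is a triple $G=(V_1,V_2,E)$ with $V_1,V_2$ disjoint finite sets and $E\subseteq V_1\times V_2$; write $V_i(G)=V_i$, $v_i(G)=|V_i|$, $E(G)=E$, $e(G)=|E|$, $V(G)=V_1\cup V_2$; $N_G(w)$ is the set of neighbors of $w$. Non-trivial means having at least one edge (for bigraphs without isolated vertices, this is the same as being non-empty). Given probability spaces $\Omega=(X,\mu)$ and $\Lambda=(Y,\nu)$, a bigraphon over $\Omega$ and $\Lambda$ is a bounded measurable function $W:X\times Y\to\mathbb{R}_+=[0,\infty)$. Colored bigraphs. A colored bigraph is a pair $H=(G',c)$ with $G'$ a bigraph (the underlying bigraph of $H$) and $c:E(G')\to C$ a function (coloring); bigraph notation ($V_i(H)$, $E(H)$, $N_H$, $v_1(H)$, ...) refers to $G'$. $H$ is right-uniform if $c(v,w)=f(w)$ for some function $f:V_2(H)\to C$. An automorphism of $H$ is an automorphism $\sigma$ of $G'$ (bijection of $V(H)$ preserving $V_1(H)$, $V_2(H)$, edges and non-edges) with $c(\sigma(v),\sigma(w))=c(v,w)$ for all $(v,w)\in E(H)$; $\mathrm{Aut}(H)$ is the group of these. $H$ is color-edge-transitive if for all $(v_1,w_1),(v_2,w_2)\in E(H)$ with $c(v_1,w_1)=c(v_2,w_2)$ there is $\sigma\in\mathrm{Aut}(H)$ with $\sigma(v_1)=v_2$ and $\sigma(w_1)=w_2$. For a sequence $W=(W_i)_{i\in C}$ of bigraphons all over the same spaces, $$t((G',c),W)=\int_{X^{V_1(G')}\times Y^{V_2(G')}}\prod_{(v,w)\in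 E(G')}W_{c(v,w)}(x_v,y_w)\,d(\mu\otimes\nu)(x,y).$$ A left-coloring of $G'$ is a function $\ell:V_1(G')\to C'$; the coloring $\ell\otimes c:E(G')\to C'\times C$ is $(\ell\otimes c)(v,w)=(\ell(v),c(v,w))$. $H=(G',c)$ is left-weakly Hölder if for every left-coloring $\ell:V_1(G')\to C'$ and every sequence of bigraphons $W=(W_i)_{i\in C'\times C}$ all over the same spaces, $$t((G',\ell\otimes c),W)\leq\prod_{v\in V_1(G')}t((G',\ell(v)\otimes c),W)^{1/v_1(G')},$$ where $\ell(v)$ on the right-hand side denotes the constant left-coloring equal to $\ell(v)$. Strong Sidorenko. A bigraph $G$ is a strong Sidorenko bigraph if for every bigraphon $W$ (over any probability spaces $\Omega=(X,\mu)$, $\Lambda=(Y,\nu)$) and all sequences $(f_v)_{v\in V_1(G)}$, $(g_w)_{w\in V_2(G)}$ of bounded measurable functions $f_v:X\to\mathbb{R}_+$, $g_w:Y\to\mathbb{R}_+$, we have $$\int_{X^{V_1(G)}\times Y^{V_2(G)}}\prod_{v\in V_1(G)}f_v(x_v)\prod_{w\in V_2(G)}g_w(y_w)\prod_{(v,w)\in E(G)}W(x_v,y_w)\,d(\mu\otimes\nu)(x,y)$$ $$\geq\left(\int_{X\times Y}\prod_{v\in V_1(G)}f_v(x)^{1/e(G)}\prod_{w\in V_2(G)}g_w(y)^{1/e(G)}\,W(x,y)\,d(\mu\otimes\nu)(x,y)\right)^{e(G)}.$$ *)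

theory Defs
  imports "HOL-Probability.Probability" "HOL-Combinatorics.Permutations"
begin

record 'v bigraph =
  lverts :: "'v set"
  rverts :: "'v set"
  edges :: "('v \<times> 'v) set"

definition wf_bigraph :: "'v bigraph \<Rightarrow> bool" where
  "wf_bigraph G \<longleftrightarrow>
     finite (lverts G) \<and> finite (rverts G) \<and> lverts G \<inter> rverts G = {} \<and>
     edges G \<subseteq> lverts G \<times> rverts G"

definition verts :: "'v bigraph \<Rightarrow> 'v set" where
  "verts G = lverts G \<union> rverts G"

definition nbrs :: "'v bigraph \<Rightarrow> 'v \<Rightarrow> 'v set" where
  "nbrs G u = {w. (u, w) \<in> edges G \<or> (w, u) \<in> edges G}"

definition non_trivial :: "'v bigraph \<Rightarrow> bool" where
  "non_trivial G \<longleftrightarrow> edges G \<noteq> {}"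

definition no_isolated_vertices :: "'v bigraph \<Rightarrow> bool" where
  "no_isolated_vertices G \<longleftrightarrow> (\<forall>u\<in>verts G. nbrs G u \<noteq> {})"

definition nbhd_count :: "'v bigraph \<Rightarrow> 'v set \<Rightarrow> nat" where
  "nbhd_count G U = card {w \<in> rverts G. nbrs G w = U}"


text \<open>The colors are the elements of a type, and only the values of the coloring on
  the edges matter.\<close>

type_synonym ('v, 'c) colored_bigraph = "'v bigraph \<times> ('v \<times> 'v \<Rightarrow> 'c)"

abbreviation underlying :: "('v, 'c) colored_bigraph \<Rightarrow> 'v bigraph" where
  "underlying H \<equiv> fst H"

abbreviation coloring :: "('v, 'c) colored_bigraph \<Rightarrow> 'v \<times> 'v \<Rightarrow> 'c" where
  "coloring H \<equiv> snd H"

definition right_uniform :: "('v, 'c) colored_bigraph \<Rightarrow> bool" where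
  "right_uniform H \<longleftrightarrow>
     (\<exists>f. \<forall>(v, w) \<in> edges (underlying H). coloring H (v, w) = f w)"

text \<open>A bijection of the vertex set is represented by its extension to the whole type
  by the identity, so that distinct elements of \<open>aut H\<close> are distinct automorphisms and
  \<open>aut H\<close> is finite.\<close>

definition bigraph_aut :: "'v bigraph \<Rightarrow> ('v \<Rightarrow> 'v) set" where
  "bigraph_aut G = {\<sigma>. \<sigma> permutes verts G \<and> \<sigma> ` lverts G = lverts G \<and> \<sigma> ` rverts G = rverts G \<and>
     (\<forall>v\<in>lverts G. \<forall>w\<in>rverts G. (\<sigma> v, \<sigma> w) \<in> edges G \<longleftrightarrow> (v, w) \<in> edges G)}"

definition aut :: "('v, 'c) colored_bigraph \<Rightarrow> ('v \<Rightarrow> 'v) set" where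
  "aut H = {\<sigma> \<in> bigraph_aut (underlying H).
     \<forall>(v, w) \<in> edges (underlying H). coloring H (\<sigma> v, \<sigma> w) = coloring H (v, w)}"

definition color_edge_transitive :: "('v, 'c) colored_bigraph \<Rightarrow> bool" where
  "color_edge_transitive H \<longleftrightarrow>
     (\<forall>(v\<^sub>1, w\<^sub>1) \<in> edges (underlying H). \<forall>(v\<^sub>2, w\<^sub>2) \<in> edges (underlying H).
        coloring H (v\<^sub>1, w\<^sub>1) = coloring H (v\<^sub>2, w\<^sub>2) \<longrightarrow>
        (\<exists>\<sigma>\<in>aut H. \<sigma> v\<^sub>1 = v\<^sub>2 \<and> \<sigma> w\<^sub>1 = w\<^sub>2))"


definition bounded_nonneg_measurable :: "'z measure \<Rightarrow> ('z \<Rightarrow> real) \<Rightarrow> bool" where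
  "bounded_nonneg_measurable M f \<longleftrightarrow>
     f \<in> borel_measurable M \<and> (\<forall>z\<in>space M. 0 \<le> f z) \<and> bounded (f ` space M)"

definition bigraphon :: "'x measure \<Rightarrow> 'y measure \<Rightarrow> ('x \<times> 'y \<Rightarrow> real) \<Rightarrow> bool" where
  "bigraphon M N W \<longleftrightarrow> prob_space M \<and> prob_space N \<and> bounded_nonneg_measurable (M \<Otimes>\<^sub>M N) W"

definition assignments :: "'v bigraph \<Rightarrow> 'x measure \<Rightarrow> 'y measure \<Rightarrow>
    (('v \<Rightarrow> 'x) \<times> ('v \<Rightarrow> 'y)) measure" where
  "assignments G M N = (\<Pi>\<^sub>M v\<in>lverts G. M) \<Otimes>\<^sub>M (\<Pi>\<^sub>M w\<in>rverts G. N)"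

definition density_t :: "('v, 'i) colored_bigraph \<Rightarrow> 'x measure \<Rightarrow> 'y measure \<Rightarrow>
    ('i \<Rightarrow> 'x \<times> 'y \<Rightarrow> real) \<Rightarrow> real" where
  "density_t H M N W =
     (\<integral>(x, y). (\<Prod>(v, w)\<in>edges (underlying H). W (coloring H (v, w)) (x v, y w))
        \<partial>(assignments (underlying H) M N))"

definition left_colored :: "('v \<Rightarrow> 'd) \<Rightarrow> ('v, 'c) colored_bigraph \<Rightarrow> ('v, 'd \<times> 'c) colored_bigraph" where
  "left_colored \<l> H = (underlying H, \<lambda>(v, w). (\<l> v, coloring H (v, w)))"

text \<open>HOL cannot quantify over types inside a formula, so the types carrying the
  probability spaces are parameters of the next two definitions; all \<open>\<sigma>\<close>-algebras and
  all probability measures on (subsets of) these types are allowed. As there are finitely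
  many left vertices, natural numbers suffice as left colors. Similarly, the instance
  \<open>left_weakly_holder TYPE(real) TYPE(real)\<close> covers all probability spaces: each
  of the finitely many relevant bigraphons is measurable with respect to countably many
  measurable rectangles, hence is the pullback of a bigraphon on probability spaces over
  the reals along measurable maps on the two sides.\<close>

definition left_weakly_holder ::
    "'x itself \<Rightarrow> 'y itself \<Rightarrow> ('v, 'c) colored_bigraph \<Rightarrow> bool" where
  "left_weakly_holder _ _ H \<longleftrightarrow>
     (\<forall>(\<l> :: 'v \<Rightarrow> nat) (M :: 'x measure) (N :: 'y measure) W.
        (\<forall>i. bigraphon M N (W i)) \<longrightarrow>
        density_t (left_colored \<l> H) M N W \<le>
          (\<Prod>v\<in>lverts (underlying H).
             density_t (left_colored (\<lambda>_. \<l> v) H) M N W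
               powr (1 / real (card (lverts (underlying H))))))"

definition strong_sidorenko :: "'x itself \<Rightarrow> 'y itself \<Rightarrow> 'v bigraph \<Rightarrow> bool" where
  "strong_sidorenko _ _ G \<longleftrightarrow>
     (\<forall>(M :: 'x measure) (N :: 'y measure) W f g.
        bigraphon M N W \<and>
        (\<forall>v\<in>lverts G. bounded_nonneg_measurable M (f v)) \<and>
        (\<forall>w\<in>rverts G. bounded_nonneg_measurable N (g w)) \<longrightarrow>
        (\<integral>(x, y). (\<Prod>v\<in>lverts G. f v (x v)) * (\<Prod>w\<in>rverts G. g w (y w)) *
             (\<Prod>(v, w)\<in>edges G. W (x v, y w)) \<partial>(assignments G M N))
        \<ge> (\<integral>(x, y). (\<Prod>v\<in>lverts G. f v x powr (1 / real (card (edges G)))) *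
               (\<Prod>w\<in>rverts G. g w y powr (1 / real (card (edges G)))) *
               W (x, y) \<partial>(M \<Otimes>\<^sub>M N)) ^ card (edges G))"

end

theory Submission
  imports Defs
begin

text \<open>Color-edge-transitivity and the weak Hoelder property make \<open>Aut(H)\<close> transitive on the left side.
  Averaging the left-hand side of the Sidorenko inequality geometrically over \<open>Aut(H)\<close> replaces the right
  vertices of \<open>G\<close> by a weight \<open>q(U)\<close> on left sets that depends only on the orbit of \<open>U\<close>; by assumption
  \<open>q(U) \<ge> d\<^sub>H(U)\<close> for \<open>|U| \<ge> 2\<close>, with the same support.
  For each orbit divide \<open>W\<close>, weighted by the functions of \<open>y\<close>, by its integral over \<open>y\<close> and collect these
  integrals in a single function \<open>A\<close> on \<open>X\<close>. For the normalized bigraphons, the weak Hoelder property shows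
  that deleting a color of \<open>H\<close> never increases the \<open>A\<close>-weighted density. The logarithm of this density is convex
  in the exponents of the colors, so the density does not decrease either when the exponents grow from
  \<open>d\<^sub>H(U)\<close> to \<open>q(U)\<close>, and it is at least its value without any edges, which is \<open>(\<integral>A)\<close> to the power \<open>v\<^sub>1(H)\<close>.
  Hoelder's inequality bounds the latter from below by the right-hand side.\<close>

section \<open>Bounded nonnegative measurable functions and Hoelder's inequality\<close>

text \<open>The multiplicities \<open>q U\<close> are fractional, so \<open>G\<close> cannot be
  assembled from copies of \<open>H\<close>; only real exponents \<open>q U / nbhd_count\<close> on
  the right vertices of \<open>H\<close> can be compared. Condition (ii) makes these exponents at
  least 1, and condition (i) guarantees that every set with at least two elements that carries
  positive \<open>q\<close> is a neighborhood in \<open>H\<close>. Sets of size one are left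
  unconstrained because their normalized factor integrates to 1. The normalization is what lets the
  weak Hoelder property speak about deletions: a right vertex that sees a single nontrivial factor
  contributes 1. Its price is a division by the integrals \<open>\<kappa> U\<close>, which may
  vanish or be arbitrarily small; hence the truncation to points where all of them are at least
  \<epsilon>, and a limit at the end. One weight function serves all left vertices since, by
  transitivity, the product of the powers of \<open>\<kappa> U\<close> over the sets
  \<open>U\<close> through a vertex does not depend on the vertex. The weak Hoelder property is
  assumed over the reals and is carried over to the given spaces by coding countably many sets in
  one real number.\<close>

abbreviation bnm :: "'z measure \<Rightarrow> ('z \<Rightarrow> real) \<Rightarrow> bool" where
  "bnm \<equiv> bounded_nonneg_measurable"

lemma bnm_iff:
  "bnm M f \<longleftrightarrow> f \<in> borel_measurable M \<and> (\<exists>B. \<forall>z\<in>space M. 0 \<le> f z \<and> f z \<le> B)"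
proof -
  have "bounded (f ` space M) \<longleftrightarrow> (\<exists>B. \<forall>z\<in>space M. f z \<le> B)" if "\<forall>z\<in>space M. 0 \<le> f z"
  proof
    assume "bounded (f ` space M)"
    then obtain B where "\<forall>z\<in>space M. norm (f z) \<le> B"
      by (auto simp: bounded_iff)
    then show "\<exists>B. \<forall>z\<in>space M. f z \<le> B"
      by (intro exI[of _ B]) fastforce
  next
    assume "\<exists>B. \<forall>z\<in>space M. f z \<le> B"
    then show "bounded (f ` space M)"
      using that by (force simp: bounded_iff)
  qed
  then show ?thesis
    unfolding bounded_nonneg_measurable_def by blast
qed

lemma bnmI:
  assumes "f \<in> borel_measurable M" "\<And>z. z \<in> space M \<Longrightarrow> 0 \<le> f z" "\<And>z. z \<in> space M \<Longrightarrow> f z \<le> B"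
  shows "bnm M f"
  using assms unfolding bnm_iff by blast

lemma bnmE:
  assumes "bnm M f"
  obtains B where "f \<in> borel_measurable M" "\<And>z. z \<in> space M \<Longrightarrow> 0 \<le> f z"
    "\<And>z. z \<in> space M \<Longrightarrow> f z \<le> B" "0 \<le> B"
proof -
  from assms obtain B where B: "f \<in> borel_measurable M" "\<forall>z\<in>space M. 0 \<le> f z \<and> f z \<le> B"
    unfolding bnm_iff by blast
  show ?thesis
    by (rule that[of "max B 0"]) (use B in \<open>force simp: le_max_iff_disj\<close>)+
qed

lemma bnm_measurable: "bnm M f \<Longrightarrow> f \<in> borel_measurable M"
  and bnm_nonneg: "bnm M f \<Longrightarrow> z \<in> space M \<Longrightarrow> 0 \<le> f z"
  by (auto simp: bounded_nonneg_measurable_def)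

lemma bnm_const: "0 \<le> c \<Longrightarrow> bnm M (\<lambda>_. c)"
  by (rule bnmI[where B = c]) auto

lemma bnm_mult:
  assumes "bnm M f" "bnm M g"
  shows "bnm M (\<lambda>z. f z * g z)"
proof -
  obtain B C where B: "f \<in> borel_measurable M" "\<And>z. z \<in> space M \<Longrightarrow> 0 \<le> f z"
    "\<And>z. z \<in> space M \<Longrightarrow> f z \<le> B" "0 \<le> B"
   and C: "g \<in> borel_measurable M" "\<And>z. z \<in> space M \<Longrightarrow> 0 \<le> g z"
    "\<And>z. z \<in> space M \<Longrightarrow> g z \<le> C" "0 \<le> C"
    using assms by (elim bnmE) blast
  show ?thesis
    by (rule bnmI[where B = "B * C"]) (use B C in \<open>auto intro!: mult_mono\<close>)
qed

lemma bnm_prod: "(\<And>i. i \<in> I \<Longrightarrow> bnm M (f i)) \<Longrightarrow> bnm M (\<lambda>z. \<Prod>i\<in>I. f i z)"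
  by (induction I rule: infinite_finite_induct) (auto intro: bnm_const bnm_mult)

lemma bnm_powr:
  assumes "bnm M f" "0 \<le> a"
  shows "bnm M (\<lambda>z. f z powr a)"
proof -
  obtain B where B: "f \<in> borel_measurable M" "\<And>z. z \<in> space M \<Longrightarrow> 0 \<le> f z"
    "\<And>z. z \<in> space M \<Longrightarrow> f z \<le> B" "0 \<le> B"
    using assms by (elim bnmE) blast
  show ?thesis
    by (rule bnmI[where B = "B powr a"]) (use B assms in \<open>auto intro!: powr_mono2\<close>)
qed

lemma bnm_if:
  assumes "{z \<in> space M. P z} \<in> sets M" "bnm M f" "bnm M g"
  shows "bnm M (\<lambda>z. if P z then f z else g z)"
proof -
  obtain B C where "f \<in> borel_measurable M" "\<And>z. z \<in> space M \<Longrightarrow> 0 \<le> f z"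
    "\<And>z. z \<in> space M \<Longrightarrow> f z \<le> B" "g \<in> borel_measurable M" "\<And>z. z \<in> space M \<Longrightarrow> 0 \<le> g z"
    "\<And>z. z \<in> space M \<Longrightarrow> g z \<le> C"
    using assms(2,3) by (elim bnmE) blast
  then show ?thesis
    using assms(1) by (intro bnmI[where B = "max B C"]) (auto simp: le_max_iff_disj)
qed

lemma bnm_inverse:
  assumes "bnm M f" "0 < \<epsilon>" "\<And>z. z \<in> space M \<Longrightarrow> \<epsilon> \<le> f z"
  shows "bnm M (\<lambda>z. 1 / f z)"
proof (rule bnmI[where B = "1 / \<epsilon>"])
  show "(\<lambda>z. 1 / f z) \<in> borel_measurable M"
    using bnm_measurable[OF assms(1)] by measurable
qed (use assms in \<open>force intro: divide_left_mono\<close>)+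

lemma bnm_compose:
  assumes "bnm N f" "g \<in> measurable M N"
  shows "bnm M (\<lambda>z. f (g z))"
  using assms measurable_space[OF assms(2)] unfolding bnm_iff
  using measurable_compose[OF assms(2), of f borel] by auto

lemma (in finite_measure) bnm_integrable: "bnm M f \<Longrightarrow> integrable M f"
proof (erule bnmE)
  fix B assume B: "f \<in> borel_measurable M" "\<And>z. z \<in> space M \<Longrightarrow> 0 \<le> f z" "\<And>z. z \<in> space M \<Longrightarrow> f z \<le> B"
  show "integrable M f"
    by (rule integrable_const_bound[where B = B]) (use B in auto)
qed

lemma bnm_integral:
  assumes "prob_space N" "bnm (M \<Otimes>\<^sub>M N) f"
  shows "bnm M (\<lambda>x. \<integral>y. f (x, y) \<partial>N)"
proof -
  interpret N: prob_space N by fact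
  obtain B where B: "f \<in> borel_measurable (M \<Otimes>\<^sub>M N)" "\<And>z. z \<in> space (M \<Otimes>\<^sub>M N) \<Longrightarrow> 0 \<le> f z"
    "\<And>z. z \<in> space (M \<Otimes>\<^sub>M N) \<Longrightarrow> f z \<le> B" "0 \<le> B"
    using assms by (elim bnmE) blast
  note [measurable] = B(1)
  show ?thesis
  proof (rule bnmI[where B = B])
    show "(\<lambda>x. \<integral>y. f (x, y) \<partial>N) \<in> borel_measurable M"
      by measurable
    fix x assume x: "x \<in> space M"
    then have *: "(x, y) \<in> space (M \<Otimes>\<^sub>M N)" if "y \<in> space N" for y
      using that by (simp add: space_pair_measure)
    show "0 \<le> (\<integral>y. f (x, y) \<partial>N)"
      by (rule integral_nonneg_AE) (use * B in auto)
    have "integrable N (\<lambda>y. f (x, y))"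
      by (rule N.bnm_integrable) (rule bnm_compose[OF assms(2)], use x in measurable)
    then have "(\<integral>y. f (x, y) \<partial>N) \<le> (\<integral>y. B \<partial>N)"
      by (rule integral_mono) (use * B in auto)
    then show "(\<integral>y. f (x, y) \<partial>N) \<le> B"
      by (simp add: N.prob_space)
  qed
qed

lemma (in prob_space) bnm_integral_nonneg: "bnm M f \<Longrightarrow> 0 \<le> (\<integral>x. f x \<partial>M)"
  by (rule integral_nonneg_AE) (auto simp: bnm_nonneg)

lemma (in prob_space) bnm_integral_mono:
  "bnm M f \<Longrightarrow> bnm M g \<Longrightarrow> (\<And>x. x \<in> space M \<Longrightarrow> f x \<le> g x) \<Longrightarrow> (\<integral>x. f x \<partial>M) \<le> (\<integral>x. g x \<partial>M)"
  by (intro integral_mono bnm_integrable)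

section \<open>Hoelder's and Jensen's inequalities for real exponents\<close>

lemma powr_le_powr_base:
  fixes x y a :: real
  assumes "x powr a \<le> y powr a" "0 \<le> y" "0 < a"
  shows "x \<le> y"
  using assms powr_less_mono2[of a y x] by (meson not_le)

lemma weighted_arith_geo_mean:
  fixes h a :: "'i \<Rightarrow> real"
  assumes "finite I" "\<And>i. i \<in> I \<Longrightarrow> 0 \<le> a i" "sum a I = 1" "\<And>i. i \<in> I \<Longrightarrow> 0 \<le> h i"
  shows "(\<Prod>i\<in>I. h i powr a i) \<le> (\<Sum>i\<in>I. a i * h i)"
proof (cases "\<exists>i\<in>I. h i = 0")
  case True
  \<comment> \<open>Since \<open>0 powr 0 = 0\<close>, a vanishing base kills the product even when
    its weight is 0.\<close>
  then have "(\<Prod>i\<in>I. h i powr a i) = 0"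
    using assms by (auto intro!: prod_zero)
  also have "0 \<le> (\<Sum>i\<in>I. a i * h i)"
    using assms by (intro sum_nonneg) (auto simp: less_imp_le)
  finally show ?thesis .
next
  case False
  then have pos: "0 < h i" if "i \<in> I" for i
    using assms that by (metis less_eq_real_def)
  have "I \<noteq> {}" using assms by auto
  have "(\<Prod>i\<in>I. h i powr a i) = exp (\<Sum>i\<in>I. a i *\<^sub>R ln (h i))"
    using assms pos by (auto simp: exp_sum powr_def intro!: prod.cong dest: pos)
  also have "\<dots> \<le> (\<Sum>i\<in>I. a i * exp (ln (h i)))"
    using assms by (intro convex_on_sum[OF _ _ exp_convex]) (auto simp: less_imp_le \<open>I \<noteq> {}\<close>)
  also have "\<dots> = (\<Sum>i\<in>I. a i * h i)"
    using pos by simp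
  finally show ?thesis .
qed

lemma (in prob_space) holder_prod:
  fixes h :: "'i \<Rightarrow> 'a \<Rightarrow> real"
  assumes "finite I" "\<And>i. i \<in> I \<Longrightarrow> 0 \<le> a i" "sum a I = 1" "\<And>i. i \<in> I \<Longrightarrow> bnm M (h i)"
  shows "(\<integral>x. (\<Prod>i\<in>I. h i x powr a i) \<partial>M) \<le> (\<Prod>i\<in>I. (\<integral>x. h i x \<partial>M) powr a i)"
proof (cases "\<exists>i\<in>I. (\<integral>x. h i x \<partial>M) = 0")
  case True
  then obtain i where i: "i \<in> I" "(\<integral>x. h i x \<partial>M) = 0" by auto
  have "AE x in M. h i x = 0"
    using i assms(4)[OF i(1)]
    by (subst integral_nonneg_eq_0_iff_AE[symmetric]) (auto simp: bnm_integrable bnm_nonneg)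
  then have "AE x in M. (\<Prod>i\<in>I. h i x powr a i) = 0"
    by eventually_elim (use i assms in \<open>auto intro!: prod_zero\<close>)
  then have "(\<integral>x. (\<Prod>i\<in>I. h i x powr a i) \<partial>M) = 0"
    by (rule integral_eq_zero_AE)
  then show ?thesis
    by (simp add: prod_nonneg)
next
  case False
  then have pos: "0 < (\<integral>x. h i x \<partial>M)" if "i \<in> I" for i
    using assms(4) that bnm_integral_nonneg by (metis less_eq_real_def)
  have *: "(\<Prod>i\<in>I. h i x powr a i)
       \<le> (\<Prod>i\<in>I. (\<integral>x. h i x \<partial>M) powr a i) * (\<Sum>i\<in>I. a i * (h i x / (\<integral>x. h i x \<partial>M)))"
    if x: "x \<in> space M" for x
  proof -
    have "(\<Prod>i\<in>I. h i x powr a i)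
        = (\<Prod>i\<in>I. (\<integral>x. h i x \<partial>M) powr a i) * (\<Prod>i\<in>I. (h i x / (\<integral>x. h i x \<partial>M)) powr a i)"
      using pos assms x by (subst prod.distrib[symmetric], intro prod.cong)
        (auto simp: powr_divide bnm_nonneg less_imp_le dest: pos)
    also have "\<dots> \<le> (\<Prod>i\<in>I. (\<integral>x. h i x \<partial>M) powr a i) * (\<Sum>i\<in>I. a i * (h i x / (\<integral>x. h i x \<partial>M)))"
      using pos assms x by (intro mult_left_mono weighted_arith_geo_mean prod_nonneg)
        (auto simp: less_imp_le intro!: divide_nonneg_nonneg intro: bnm_nonneg)
    finally show ?thesis .
  qed
  have int: "integrable M (h i)" if "i \<in> I" for i
    using assms that by (auto intro: bnm_integrable)
  have "(\<integral>x. (\<Prod>i\<in>I. h i x powr a i) \<partial>M) \<le>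
     (\<integral>x. (\<Prod>i\<in>I. (\<integral>x. h i x \<partial>M) powr a i) * (\<Sum>i\<in>I. a i * (h i x / (\<integral>x. h i x \<partial>M))) \<partial>M)"
  proof (rule integral_mono[OF _ _ *])
    show "integrable M (\<lambda>x. \<Prod>i\<in>I. h i x powr a i)"
      using assms by (intro bnm_integrable bnm_prod bnm_powr) (auto simp: less_imp_le)
  qed (use int in auto)
  also have "\<dots> = (\<Prod>i\<in>I. (\<integral>x. h i x \<partial>M) powr a i) * (\<Sum>i\<in>I. a i * ((\<integral>x. h i x \<partial>M) / (\<integral>x. h i x \<partial>M)))"
    using int by (auto simp: Bochner_Integration.integral_sum intro!: sum.cong)
  also have "(\<Sum>i\<in>I. a i * ((\<integral>x. h i x \<partial>M) / (\<integral>x. h i x \<partial>M))) = 1"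
    unfolding assms(3)[symmetric] by (rule sum.cong) (auto dest!: pos)
  finally show ?thesis by simp
qed

text \<open>Jensen's inequality, obtained from Hoelder's for \<open>h powr p\<close> and the
  constant 1 with weights \<open>1 / p\<close> and \<open>1 - 1 / p\<close>; the two functions are
  indexed by the Booleans.\<close>

lemma (in prob_space) integral_powr_ge:
  assumes "bnm M h" "1 \<le> p"
  shows "(\<integral>x. h x \<partial>M) powr p \<le> (\<integral>x. h x powr p \<partial>M)"
proof (cases "p = 1")
  case True
  have "(\<integral>x. h x powr 1 \<partial>M) = (\<integral>x. h x \<partial>M)"
    using assms by (intro Bochner_Integration.integral_cong) (auto simp: bnm_nonneg)
  then show ?thesis
    using True bnm_integral_nonneg[OF assms(1)] by simp
next
  case False
  then have p: "p > 1" using assms by simp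
  have b: "bnm M (\<lambda>x. if b then h x powr p else 1)" for b
    using p assms by (cases b) (auto intro: bnm_powr bnm_const)
  have "(\<integral>x. (\<Prod>b\<in>UNIV. (if b then h x powr p else 1) powr (if b then 1 / p else 1 - 1 / p)) \<partial>M)
      \<le> (\<Prod>b\<in>UNIV. (\<integral>x. (if b then h x powr p else 1) \<partial>M) powr (if b then 1 / p else 1 - 1 / p))"
    using p assms
    by (intro holder_prod) (auto simp: UNIV_bool b)
  also have "(\<integral>x. (\<Prod>b\<in>UNIV. (if b then h x powr p else 1) powr (if b then 1 / p else 1 - 1 / p)) \<partial>M)
     = (\<integral>x. h x \<partial>M)"
    using p assms by (intro Bochner_Integration.integral_cong) (auto simp: UNIV_bool powr_powr bnm_nonneg)
  also have "(\<Prod>b\<in>UNIV. (\<integral>x. (if b then h x powr p else 1) \<partial>M) powr (if b then 1 / p else 1 - 1 / p))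
     = (\<integral>x. h x powr p \<partial>M) powr (1 / p)"
    by (simp add: UNIV_bool prob_space)
  finally have "(\<integral>x. h x \<partial>M) powr p \<le> ((\<integral>x. h x powr p \<partial>M) powr (1 / p)) powr p"
    using p bnm_integral_nonneg[OF assms(1)] by (intro powr_mono2) auto
  also have "\<dots> = (\<integral>x. h x powr p \<partial>M)"
    using p bnm_integral_nonneg[OF bnm_powr[OF assms(1), of p]] by (simp add: powr_powr)
  finally show ?thesis .
qed

text \<open>For fixed left variables the right variables are independent, so the inner integral of
  the product splits. All later densities are handled in this form, as integrals over the left
  variables only.\<close>

lemma integral_bipartite:
  fixes M :: "'x measure" and N :: "'y measure"
  assumes "prob_space M" "prob_space N" "finite V1" "finite V2"
    and F: "bnm (\<Pi>\<^sub>M v\<in>V1. M) F"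
    and h: "\<And>w. w \<in> V2 \<Longrightarrow> bnm ((\<Pi>\<^sub>M v\<in>V1. M) \<Otimes>\<^sub>M N) (h w)"
  shows "(\<integral>(x, y). F x * (\<Prod>w\<in>V2. h w (x, y w)) \<partial>((\<Pi>\<^sub>M v\<in>V1. M) \<Otimes>\<^sub>M (\<Pi>\<^sub>M w\<in>V2. N)))
    = (\<integral>x. F x * (\<Prod>w\<in>V2. \<integral>y. h w (x, y) \<partial>N) \<partial>(\<Pi>\<^sub>M v\<in>V1. M))"
proof -
  interpret M: prob_space M by fact
  interpret N: prob_space N by fact
  interpret P1: prob_space "\<Pi>\<^sub>M v\<in>V1. M" by (intro prob_space_PiM assms)
  interpret P2: prob_space "\<Pi>\<^sub>M w\<in>V2. N" by (intro prob_space_PiM assms)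
  interpret P: pair_prob_space "\<Pi>\<^sub>M v\<in>V1. M" "\<Pi>\<^sub>M w\<in>V2. N" ..
  interpret PN: product_prob_space "\<lambda>_. N" by unfold_locales
  let ?f = "\<lambda>(x, y). F x * (\<Prod>w\<in>V2. h w (x, y w))"
  have "bnm ((\<Pi>\<^sub>M v\<in>V1. M) \<Otimes>\<^sub>M (\<Pi>\<^sub>M w\<in>V2. N)) (\<lambda>z. F (fst z) * (\<Prod>w\<in>V2. h w (fst z, snd z w)))"
    by (intro bnm_mult bnm_prod bnm_compose[OF F] bnm_compose[OF h]) measurable
  then have int: "integrable ((\<Pi>\<^sub>M v\<in>V1. M) \<Otimes>\<^sub>M (\<Pi>\<^sub>M w\<in>V2. N)) ?f"
    unfolding case_prod_beta by (rule P.bnm_integrable)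
  have "(\<integral>z. ?f z \<partial>((\<Pi>\<^sub>M v\<in>V1. M) \<Otimes>\<^sub>M (\<Pi>\<^sub>M w\<in>V2. N)))
     = (\<integral>x. (\<integral>y. ?f (x, y) \<partial>(\<Pi>\<^sub>M w\<in>V2. N)) \<partial>(\<Pi>\<^sub>M v\<in>V1. M))"
    by (rule P.integral_fst'[symmetric, OF int])
  also have "\<dots> = (\<integral>x. F x * (\<Prod>w\<in>V2. \<integral>y. h w (x, y) \<partial>N) \<partial>(\<Pi>\<^sub>M v\<in>V1. M))"
  proof (intro Bochner_Integration.integral_cong refl)
    fix x assume x: "x \<in> space (\<Pi>\<^sub>M v\<in>V1. M)"
    have "integrable N (\<lambda>y. h w (x, y))" if "w \<in> V2" for w
      by (rule N.bnm_integrable) (rule bnm_compose[OF h[OF that]], use x in measurable)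
    then show "(\<integral>y. ?f (x, y) \<partial>(\<Pi>\<^sub>M w\<in>V2. N)) = F x * (\<Prod>w\<in>V2. \<integral>y. h w (x, y) \<partial>N)"
      using PN.product_integral_prod[of V2 "\<lambda>w y. h w (x, y)"] assms by simp
  qed
  finally show ?thesis .
qed

section \<open>Reduction of the weak Hoelder property to the reals\<close>

text \<open>The sets generated by some countable family of measurable rectangles are closed under
  complements and countable unions, hence exhaust the product algebra.\<close>

lemma sets_pair_countable_rectangles:
  assumes "E \<in> sets (M \<Otimes>\<^sub>M N)"
  shows "\<exists>A B. (\<forall>i::nat. A i \<in> sets M) \<and> (\<forall>i. B i \<in> sets N) \<and>
    E \<in> sigma_sets (space M \<times> space N) (range (\<lambda>i. A i \<times> B i))"
  using assms unfolding sets_pair_measure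
proof (induction rule: sigma_sets.induct)
  case (Basic a)
  then obtain x y where "a = x \<times> y" "x \<in> sets M" "y \<in> sets N" by auto
  then show ?case
    by (intro exI[of _ "\<lambda>_. x"] exI[of _ "\<lambda>_. y"]) auto
next
  case Empty
  show ?case
    by (intro exI[of _ "\<lambda>_. {}"]) (auto intro: sigma_sets.Empty)
next
  case (Compl a)
  then show ?case by (blast intro: sigma_sets.Compl)
next
  case (Union a)
  then obtain A B where AB: "\<And>i j. A i j \<in> sets M" "\<And>i j. B i j \<in> sets N"
    "\<And>i. a i \<in> sigma_sets (space M \<times> space N) (range (\<lambda>j::nat. A i j \<times> B i j))"
  proof -
    define P where "P i A B \<longleftrightarrow> (\<forall>i. A i \<in> sets M) \<and> (\<forall>i. B i \<in> sets N) \<and>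
      a i \<in> sigma_sets (space M \<times> space N) (range (\<lambda>i::nat. A i \<times> B i))" for i A B
    have "\<forall>i. \<exists>A B. P i A B"
      using Union.IH by (simp add: P_def)
    then obtain A B where "\<And>i. P i (A i) (B i)"
      by metis
    then show ?thesis
      by (intro that[of A B]) (auto simp: P_def)
  qed
  \<comment> \<open>The countably many sequences of rectangles are merged into one along a bijection
    between numbers and pairs of numbers.\<close>
  let ?A = "\<lambda>k. case_prod A (prod_decode k)" and ?B = "\<lambda>k. case_prod B (prod_decode k)"
  have "A i j \<times> B i j \<in> range (\<lambda>k. ?A k \<times> ?B k)" for i j
    by (rule image_eqI[where x = "prod_encode (i, j)"]) auto
  then have "range (\<lambda>j. A i j \<times> B i j) \<subseteq> range (\<lambda>k. ?A k \<times> ?B k)" for i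
    by blast
  then have "a i \<in> sigma_sets (space M \<times> space N) (range (\<lambda>k. ?A k \<times> ?B k))" for i
    using AB(3)[of i] sigma_sets_mono' by blast
  then show ?case
    using AB(1,2) by (intro exI[of _ ?A] exI[of _ ?B]) (auto split: prod.split intro: sigma_sets.Union)
qed

text \<open>Digits 0 and 1 in base 3 leave a gap: after scaling by \<open>3 ^ n\<close> the tail is
  \<open>r / 3\<close> with \<open>r\<close> at most 3/2, hence less than 1, and the floor cuts
  exactly behind digit \<open>n\<close>. In base 2 the tail could reach 1. All earlier digits
  contribute multiples of 3.\<close>

lemma ternary_digit:
  fixes b :: "nat \<Rightarrow> nat"
  assumes b: "\<And>k. b k \<le> 1"
  shows "\<lfloor>3 ^ n * (\<Sum>k. real (b k) / 3 ^ k)\<rfloor> mod 3 = int (b n)"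
proof -
  have geo: "(\<lambda>k. 1 / 3 ^ k :: real) sums (3 / 2)"
    using geometric_sums[of "1 / 3 :: real"] by (simp add: power_one_over)
  have summ: "summable (\<lambda>k. real (b (k + m)) / 3 ^ k)" for m
    by (rule summable_comparison_test[OF _ sums_summable[OF geo]])
       (use b in \<open>auto intro!: exI[of _ 0] divide_right_mono simp: of_nat_le_1_iff\<close>)
  define r where "r = (\<Sum>k. real (b (k + Suc n)) / 3 ^ k)"
  have r0: "0 \<le> r"
    unfolding r_def by (intro suminf_nonneg summ) auto
  have "r \<le> (\<Sum>k. 1 / 3 ^ k)"
    unfolding r_def using b
    by (intro suminf_le summ sums_summable[OF geo]) (auto intro!: divide_right_mono)
  then have r1: "r \<le> 3 / 2"
    using sums_unique[OF geo] by simp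
  have "(\<Sum>k. real (b k) / 3 ^ k) = (\<Sum>k. real (b (k + Suc n)) / 3 ^ (k + Suc n)) + (\<Sum>k<Suc n. real (b k) / 3 ^ k)"
    using summ[of 0] by (intro suminf_split_initial_segment) simp
  also have "(\<Sum>k. real (b (k + Suc n)) / 3 ^ (k + Suc n)) = r / 3 ^ Suc n"
    unfolding r_def using suminf_divide[OF summ[of "Suc n"], of "3 ^ Suc n"]
    by (simp add: power_add mult_ac)
  finally have "3 ^ n * (\<Sum>k. real (b k) / 3 ^ k) = r / 3 + (\<Sum>k<Suc n. 3 ^ n * (real (b k) / 3 ^ k))"
    by (simp add: algebra_simps sum_distrib_left)
  also have "(\<Sum>k<Suc n. 3 ^ n * (real (b k) / 3 ^ k)) = (\<Sum>k<Suc n. real (b k) * 3 ^ (n - k))"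
    by (intro sum.cong) (auto simp: power_diff)
  also have "\<dots> = of_int (\<Sum>k<Suc n. int (b k) * 3 ^ (n - k))"
    by simp
  finally have "\<lfloor>3 ^ n * (\<Sum>k. real (b k) / 3 ^ k)\<rfloor> = (\<Sum>k<Suc n. int (b k) * 3 ^ (n - k))"
    using r0 r1 by (simp add: floor_eq_iff)
  also have "\<dots> = int (b n) + (\<Sum>k<n. int (b k) * 3 ^ (n - k))"
    by simp
  also have "3 dvd (\<Sum>k<n. int (b k) * 3 ^ (n - k))"
    by (intro dvd_sum) auto
  then have "(int (b n) + (\<Sum>k<n. int (b k) * 3 ^ (n - k))) mod 3 = int (b n) mod 3"
    by (metis add.right_neutral dvd_imp_mod_0 mod_add_right_eq)
  also have "\<dots> = int (b n)"
    using b[of n] by simp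
  finally show ?thesis .
qed

text \<open>\<open>\<phi> x\<close> records in its ternary digits to which of the sets
  \<open>x\<close> belongs, and \<open>D n\<close> is the set of reals whose digit \<open>n\<close>
  is 1.\<close>

lemma countable_sets_real_vimage:
  assumes A: "\<And>i::nat. A i \<in> sets M"
  shows "\<exists>\<phi>\<in>borel_measurable M. \<exists>D::nat \<Rightarrow> real set. \<forall>i. D i \<in> sets borel \<and> A i = \<phi> -` D i \<inter> space M"
proof -
  define b where "b x k = (of_bool (x \<in> A k) :: nat)" for x k
  define \<phi> where "\<phi> x = (\<Sum>k. real (b x k) / 3 ^ k)" for x
  define D where "D n = {t :: real. \<lfloor>3 ^ n * t\<rfloor> mod 3 = 1}" for n :: nat
  have "\<phi> \<in> borel_measurable M"
    unfolding \<phi>_def b_def using A by measurable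
  moreover have "D n \<in> sets borel" for n
  proof -
    have "Measurable.pred borel (\<lambda>t::real. \<lfloor>3 ^ n * t\<rfloor> mod 3 = 1)"
      by measurable
    then show ?thesis
      unfolding D_def pred_def by simp
  qed
  moreover have "A n = \<phi> -` D n \<inter> space M" for n
  proof -
    have "\<lfloor>3 ^ n * \<phi> x\<rfloor> mod 3 = int (b x n)" for x
      unfolding \<phi>_def by (rule ternary_digit) (simp add: b_def)
    then have "\<phi> x \<in> D n \<longleftrightarrow> x \<in> A n" for x
      by (simp add: D_def b_def)
    then show ?thesis
      using sets.sets_into_space[OF A[of n]] by auto
  qed
  ultimately show ?thesis by blast
qed

text \<open>With the left sides of all rectangles coded by \<phi> and the right sides by \<psi>,
  every rectangle used is a preimage under the pair of codes. Such preimages form a sigma-algebra,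
  which therefore contains every \<open>E n\<close>.\<close>

lemma sets_pair_real_vimage:
  assumes E: "\<And>n::nat. E n \<in> sets (M \<Otimes>\<^sub>M N)"
  shows "\<exists>\<phi>\<in>borel_measurable M. \<exists>\<psi>\<in>borel_measurable N. \<exists>B::nat \<Rightarrow> (real \<times> real) set.
    \<forall>n. B n \<in> sets (borel \<Otimes>\<^sub>M borel) \<and> E n = (\<lambda>(x, y). (\<phi> x, \<psi> y)) -` B n \<inter> space (M \<Otimes>\<^sub>M N)"
proof -
  obtain A B where AB: "\<And>i j. A i j \<in> sets M" "\<And>i j. B i j \<in> sets N"
    "\<And>i. E i \<in> sigma_sets (space M \<times> space N) (range (\<lambda>j::nat. A i j \<times> B i j))"
  proof -
    define P where "P i A B \<longleftrightarrow> (\<forall>i. A i \<in> sets M) \<and> (\<forall>i. B i \<in> sets N) \<and>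
      E i \<in> sigma_sets (space M \<times> space N) (range (\<lambda>i::nat. A i \<times> B i))" for i A B
    have "\<forall>i. \<exists>A B. P i A B"
      using sets_pair_countable_rectangles[OF E] by (simp add: P_def)
    then obtain A B where "\<And>i. P i (A i) (B i)"
      by metis
    then show ?thesis
      by (intro that[of A B]) (auto simp: P_def)
  qed
  have dec: "case_prod A (prod_decode k) \<in> sets M" "case_prod B (prod_decode k) \<in> sets N" for k
    using AB by (auto split: prod.split)
  obtain \<phi> D where \<phi>: "\<phi> \<in> borel_measurable M"
    "\<And>k::nat. (D k :: real set) \<in> sets borel \<and> case_prod A (prod_decode k) = \<phi> -` D k \<inter> space M"
    using countable_sets_real_vimage[of "\<lambda>k. case_prod A (prod_decode k)" M, OF dec(1)] by blast
  obtain \<psi> F where \<psi>: "\<psi> \<in> borel_measurable N"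
    "\<And>k::nat. (F k :: real set) \<in> sets borel \<and> case_prod B (prod_decode k) = \<psi> -` F k \<inter> space N"
    using countable_sets_real_vimage[of "\<lambda>k. case_prod B (prod_decode k)" N, OF dec(2)] by blast
  let ?h = "\<lambda>(x, y). (\<phi> x, \<psi> y)" and ?R = "borel \<Otimes>\<^sub>M borel :: (real \<times> real) measure"
  have "\<exists>B. B \<in> sets ?R \<and> E n = ?h -` B \<inter> space (M \<Otimes>\<^sub>M N)" for n
  proof -
    have "A n j \<times> B n j \<in> {?h -` A \<inter> (space M \<times> space N) | A. A \<in> sets ?R}" for j
    proof -
      have "A n j \<times> B n j = ?h -` (D (prod_encode (n, j)) \<times> F (prod_encode (n, j))) \<inter> (space M \<times> space N)"
        using \<phi>(2)[of "prod_encode (n, j)"] \<psi>(2)[of "prod_encode (n, j)"] by auto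
      then show ?thesis
        using \<phi>(2)[of "prod_encode (n, j)"] \<psi>(2)[of "prod_encode (n, j)"] by blast
    qed
    then have "range (\<lambda>j. A n j \<times> B n j) \<subseteq> {?h -` A \<inter> (space M \<times> space N) | A. A \<in> sets ?R}"
      by blast
    then have "E n \<in> sigma_sets (space M \<times> space N) {?h -` A \<inter> (space M \<times> space N) | A. A \<in> sets ?R}"
      by (rule subsetD[OF sigma_sets_mono' AB(3)])
    also have "\<dots> = sets (vimage_algebra (space M \<times> space N) ?h ?R)"
      by (rule sets_vimage_algebra[symmetric])
    also have "\<dots> = {?h -` A \<inter> (space M \<times> space N) | A. A \<in> sets ?R}"
      by (rule sets_vimage_algebra2) (auto simp: space_pair_measure)
    finally have "E n \<in> {?h -` A \<inter> (space M \<times> space N) | A. A \<in> sets ?R}" .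
    then show ?thesis
      unfolding space_pair_measure by blast
  qed
  then have "\<exists>B. \<forall>n. B n \<in> sets ?R \<and> E n = ?h -` B n \<inter> space (M \<Otimes>\<^sub>M N)"
    by (intro choice allI)
  then show ?thesis
    using \<phi>(1) \<psi>(1) by blast
qed

text \<open>Recovers a bounded function from its countably many rational sublevel sets: its value is
  the infimum of the rationals above it, with the bound \<open>C\<close> as default where the
  rational is not above.\<close>

lemma INF_indicator_rat:
  fixes w C :: real
  assumes "0 \<le> w" "w \<le> C"
  shows "(INF m. if w < of_rat (nat_to_rat_surj m) then max 0 (min (of_rat (nat_to_rat_surj m)) C) else C) = w"
    (is "Inf (range ?t) = w")
proof (rule antisym)
  have lb: "w \<le> ?t m" for m
    using assms by auto
  have bdd: "bdd_below (range ?t)"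
    by (rule bdd_belowI2[where m = w]) (rule lb)
  show "w \<le> Inf (range ?t)"
    by (rule cINF_greatest) (use lb in auto)
  show "Inf (range ?t) \<le> w"
  proof (rule field_le_epsilon)
    fix e :: real assume "0 < e"
    then obtain q where q: "w < of_rat q" "of_rat q < w + e"
      using of_rat_dense[of w "w + e"] by auto
    obtain m where m: "q = nat_to_rat_surj m"
      using surj_nat_to_rat_surj by blast
    have "Inf (range ?t) \<le> ?t m"
      by (rule cINF_lower[OF bdd]) simp
    also have "\<dots> \<le> w + e"
      using q m assms by auto
    finally show "Inf (range ?t) \<le> w + e" .
  qed
qed

text \<open>A countable family of bigraphons uses only countably many measurable rectangles, and ternary
  expansions code countably many sets on either side by one real-valued function.\<close>

lemma bnm_pair_factor_real:
  assumes W: "\<And>k::nat. bnm (M \<Otimes>\<^sub>M N) (W k)"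
  shows "\<exists>\<phi>\<in>borel_measurable M. \<exists>\<psi>\<in>borel_measurable N. \<exists>W'::nat \<Rightarrow> real \<times> real \<Rightarrow> real.
    \<forall>k. bnm (borel \<Otimes>\<^sub>M borel) (W' k) \<and> (\<forall>x\<in>space M. \<forall>y\<in>space N. W k (x, y) = W' k (\<phi> x, \<psi> y))"
proof -
  have "\<exists>C. \<forall>k. \<forall>z\<in>space (M \<Otimes>\<^sub>M N). 0 \<le> W k z \<and> W k z \<le> C k"
    using W unfolding bnm_iff by metis
  then obtain C where C: "\<And>k z. z \<in> space (M \<Otimes>\<^sub>M N) \<Longrightarrow> 0 \<le> W k z \<and> W k z \<le> C k"
    by blast
  define C' where "C' k = max 0 (C k)" for k
  have C': "0 \<le> C' k" "z \<in> space (M \<Otimes>\<^sub>M N) \<Longrightarrow> 0 \<le> W k z \<and> W k z \<le> C' k" for k z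
    using C by (auto simp: C'_def le_max_iff_disj)
  define r where "r m = (of_rat (nat_to_rat_surj m) :: real)" for m
  define E where "E n = (case prod_decode n of (k, m) \<Rightarrow> {z \<in> space (M \<Otimes>\<^sub>M N). W k z < r m})" for n
  note bnm_measurable[OF W, measurable]
  have "E n \<in> sets (M \<Otimes>\<^sub>M N)" for n
    unfolding E_def by (auto split: prod.split)
  then have "\<exists>\<phi>\<in>borel_measurable M. \<exists>\<psi>\<in>borel_measurable N. \<exists>B::nat \<Rightarrow> (real \<times> real) set.
      \<forall>n. B n \<in> sets (borel \<Otimes>\<^sub>M borel) \<and> E n = (\<lambda>(x, y). (\<phi> x, \<psi> y)) -` B n \<inter> space (M \<Otimes>\<^sub>M N)"
    by (rule sets_pair_real_vimage)
  then obtain \<phi> \<psi> and B :: "nat \<Rightarrow> (real \<times> real) set" where \<phi>: "\<phi> \<in> borel_measurable M" and \<psi>: "\<psi> \<in> borel_measurable N"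
    and "\<forall>n. B n \<in> sets (borel \<Otimes>\<^sub>M borel) \<and> E n = (\<lambda>(x, y). (\<phi> x, \<psi> y)) -` B n \<inter> space (M \<Otimes>\<^sub>M N)"
    by blast
  then have B: "\<And>n. B n \<in> sets (borel \<Otimes>\<^sub>M borel)"
    and EB: "\<And>n. E n = (\<lambda>(x, y). (\<phi> x, \<psi> y)) -` B n \<inter> space (M \<Otimes>\<^sub>M N)"
    by auto
  \<comment> \<open>Clamping to the interval from 0 to \<open>C' k\<close> keeps \<open>t\<close>
    bounded also outside the range of the codes, where nothing is known about membership in
    \<open>B\<close>.\<close>
  define t where "t k m p = (if p \<in> B (prod_encode (k, m)) then max 0 (min (r m) (C' k)) else C' k)"
    for k m p
  define W' where "W' k p = (INF m. t k m p)" for k p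
  have t: "0 \<le> t k m p" "t k m p \<le> C' k" for k m p
    using C'(1)[of k] by (auto simp: t_def)
  have bdd: "bdd_below (range (\<lambda>m. t k m p))" for k p
    by (rule bdd_belowI2[where m = 0]) (rule t)
  have "bnm (borel \<Otimes>\<^sub>M borel) (W' k)" for k
  proof (rule bnmI)
    have [measurable]: "t k m \<in> borel_measurable (borel \<Otimes>\<^sub>M borel)" for m
      unfolding t_def using B by measurable
    show "W' k \<in> borel_measurable (borel \<Otimes>\<^sub>M borel)"
      unfolding W'_def using bdd by (intro borel_measurable_cINF) auto
    show "0 \<le> W' k p" for p
      unfolding W'_def by (rule cINF_greatest) (use t in auto)
    show "W' k p \<le> C' k" for p
      unfolding W'_def by (rule order.trans[OF cINF_lower[OF bdd, of 0]]) (use t in auto)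
  qed
  moreover have "W k (x, y) = W' k (\<phi> x, \<psi> y)" if "x \<in> space M" "y \<in> space N" for k x y
  proof -
    have z: "(x, y) \<in> space (M \<Otimes>\<^sub>M N)"
      using that by (simp add: space_pair_measure)
    have "(\<phi> x, \<psi> y) \<in> B (prod_encode (k, m)) \<longleftrightarrow> (x, y) \<in> E (prod_encode (k, m))" for m
      using EB[of "prod_encode (k, m)"] z by simp
    then have "(\<phi> x, \<psi> y) \<in> B (prod_encode (k, m)) \<longleftrightarrow> W k (x, y) < r m" for m
      using z by (simp add: E_def)
    then show ?thesis
      using INF_indicator_rat[of "W k (x, y)" "C' k"] C'(2)[OF z] by (simp add: W'_def t_def r_def)
  qed
  ultimately show ?thesis
    using \<phi> \<psi> by blast
qed

section \<open>Densities under measurable maps\<close>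

lemma edges_lr:
  assumes "wf_bigraph G" "(v, w) \<in> edges G"
  shows "v \<in> lverts G" "w \<in> rverts G"
  using assms by (auto simp: wf_bigraph_def)

text \<open>Change of variables in every coordinate, as the pushforward of a product measure is the
  product of the pushforwards. \<open>W\<close> and \<open>W'\<close> are compared only at the
  colors of edges because the color type may be uncountable, while only a countable family of
  bigraphons can be coded.\<close>

lemma density_t_distr:
  assumes H: "wf_bigraph (underlying H)" and M: "prob_space M" and N: "prob_space N"
    and \<phi>[measurable]: "\<phi> \<in> measurable M M'" and \<psi>[measurable]: "\<psi> \<in> measurable N N'"
    and W': "\<And>e. e \<in> edges (underlying H) \<Longrightarrow> bnm (M' \<Otimes>\<^sub>M N') (W' (coloring H e))"
    and eq: "\<And>e x y. e \<in> edges (underlying H) \<Longrightarrow> x \<in> space M \<Longrightarrow> y \<in> space N \<Longrightarrow>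
       W (coloring H e) (x, y) = W' (coloring H e) (\<phi> x, \<psi> y)"
  shows "density_t H M N W = density_t H (distr M M' \<phi>) (distr N N' \<psi>) W'"
proof -
  interpret M: prob_space M by fact
  interpret N: prob_space N by fact
  define V1 where "V1 = lverts (underlying H)"
  define V2 where "V2 = rverts (underlying H)"
  have fin: "finite V1" "finite V2"
    using H by (auto simp: wf_bigraph_def V1_def V2_def)
  interpret DM: prob_space "distr M M' \<phi>" by (rule M.prob_space_distr) fact
  interpret DN: prob_space "distr N N' \<psi>" by (rule N.prob_space_distr) fact
  let ?P = "\<Pi>\<^sub>M v\<in>V1. M" and ?Q = "\<Pi>\<^sub>M w\<in>V2. N"
  let ?P' = "\<Pi>\<^sub>M v\<in>V1. distr M M' \<phi>" and ?Q' = "\<Pi>\<^sub>M w\<in>V2. distr N N' \<psi>"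
  have P: "distr ?P ?P' (compose V1 \<phi>) = ?P'"
    using distr_PiM_finite_prob_space'[OF fin(1), of "\<lambda>_. M" "\<lambda>_. distr M M' \<phi>" \<phi>]
      M DM.prob_space_axioms by (simp cong: distr_cong)
  have Q: "distr ?Q ?Q' (compose V2 \<psi>) = ?Q'"
    using distr_PiM_finite_prob_space'[OF fin(2), of "\<lambda>_. N" "\<lambda>_. distr N N' \<psi>" \<psi>]
      N DN.prob_space_axioms by (simp cong: distr_cong)
  have mP: "compose V1 \<phi> \<in> measurable ?P ?P'"
    unfolding compose_def by measurable
  have mQ: "compose V2 \<psi> \<in> measurable ?Q ?Q'"
    unfolding compose_def by measurable
  have "prob_space ?Q'"
    by (intro prob_space_PiM DN.prob_space_axioms)
  then have sf: "sigma_finite_measure (distr ?Q ?Q' (compose V2 \<psi>))"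
    unfolding Q by (simp add: prob_space_def finite_measure_def)
  have PQ: "?P' \<Otimes>\<^sub>M ?Q' = distr (?P \<Otimes>\<^sub>M ?Q) (?P' \<Otimes>\<^sub>M ?Q') (\<lambda>(x, y). (compose V1 \<phi> x, compose V2 \<psi> y))"
    using pair_measure_distr[OF mP mQ sf] unfolding P Q .
  let ?F' = "\<lambda>(x, y). \<Prod>(v, w)\<in>edges (underlying H). W' (coloring H (v, w)) (x v, y w)"
  let ?F = "\<lambda>(x, y). \<Prod>(v, w)\<in>edges (underlying H). W (coloring H (v, w)) (x v, y w)"
  have mF': "?F' \<in> borel_measurable (?P' \<Otimes>\<^sub>M ?Q')"
    unfolding case_prod_beta
  proof (rule borel_measurable_prod)
    fix e assume e: "e \<in> edges (underlying H)"
    then have "fst e \<in> V1" "snd e \<in> V2"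
      using edges_lr[OF H, of "fst e" "snd e"] by (auto simp: V1_def V2_def)
    note this[measurable] bnm_measurable[OF W'[OF e], measurable]
    show "(\<lambda>x. W' (coloring H (fst e, snd e)) (fst x (fst e), snd x (snd e))) \<in> borel_measurable (?P' \<Otimes>\<^sub>M ?Q')"
      by measurable simp
  qed
  have "density_t H (distr M M' \<phi>) (distr N N' \<psi>) W' = (\<integral>z. ?F' z \<partial>(?P' \<Otimes>\<^sub>M ?Q'))"
    by (simp add: density_t_def assignments_def V1_def V2_def)
  also have "\<dots> = (\<integral>z. ?F' ((\<lambda>(x, y). (compose V1 \<phi> x, compose V2 \<psi> y)) z) \<partial>(?P \<Otimes>\<^sub>M ?Q))"
    by (subst PQ, rule integral_distr[OF _ mF']) (use mP mQ in measurable)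
  also have "\<dots> = (\<integral>z. ?F z \<partial>(?P \<Otimes>\<^sub>M ?Q))"
  proof (intro Bochner_Integration.integral_cong refl)
    fix z assume z: "z \<in> space (?P \<Otimes>\<^sub>M ?Q)"
    obtain x y where xy: "z = (x, y)" by (cases z)
    have "W' (coloring H (v, w)) (compose V1 \<phi> x v, compose V2 \<psi> y w) = W (coloring H (v, w)) (x v, y w)"
      if e: "(v, w) \<in> edges (underlying H)" for v w
      using edges_lr[OF H e] z eq[OF e, of "x v" "y w"]
      by (auto simp: xy space_pair_measure space_PiM V1_def V2_def compose_def PiE_iff)
    then show "?F' ((\<lambda>(x, y). (compose V1 \<phi> x, compose V2 \<psi> y)) z) = ?F z"
      by (auto simp: xy intro!: prod.cong)
  qed
  also have "\<dots> = density_t H M N W"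
    by (simp add: density_t_def assignments_def V1_def V2_def)
  finally show ?thesis ..
qed

lemma left_weakly_holder_transfer:
  fixes H :: "('v, 'c) colored_bigraph"
  assumes H: "wf_bigraph (underlying H)" and lwh: "left_weakly_holder TYPE(real) TYPE(real) H"
  shows "left_weakly_holder TYPE('x) TYPE('y) H"
  unfolding left_weakly_holder_def
proof (intro allI impI)
  fix \<l> :: "'v \<Rightarrow> nat" and M :: "'x measure" and N :: "'y measure" and W :: "nat \<times> 'c \<Rightarrow> 'x \<times> 'y \<Rightarrow> real"
  assume W: "\<forall>i. bigraphon M N (W i)"
  then have MN: "prob_space M" "prob_space N" and Wb: "\<And>i. bnm (M \<Otimes>\<^sub>M N) (W i)"
    by (auto simp: bigraphon_def)
  \<comment> \<open>\<open>K\<close> holds every color that can occur on an edge under \<l>, and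
    also under the constant left-colorings with values of \<l> on the right-hand side, so one coding
    serves both sides.\<close>
  define K where "K = \<l> ` lverts (underlying H) \<times> coloring H ` edges (underlying H)"
  have "finite (edges (underlying H))"
    using H by (auto simp: wf_bigraph_def intro: finite_subset)
  then have K: "countable K"
    using H by (auto simp: K_def wf_bigraph_def intro!: countable_finite)
  obtain \<phi> \<psi> W' where \<phi>: "\<phi> \<in> borel_measurable M" and \<psi>: "\<psi> \<in> borel_measurable N"
    and W': "\<And>k::nat. bnm (borel \<Otimes>\<^sub>M borel) (W' k :: real \<times> real \<Rightarrow> real)"
    and eq: "\<And>k x y. x \<in> space M \<Longrightarrow> y \<in> space N \<Longrightarrow> W (from_nat_into K k) (x, y) = W' k (\<phi> x, \<psi> y)"
    using bnm_pair_factor_real[of M N "\<lambda>k. W (from_nat_into K k)"] Wb by blast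
  define W'' where "W'' i = W' (to_nat_on K i)" for i
  have eqK: "W i (x, y) = W'' i (\<phi> x, \<psi> y)" if "i \<in> K" "x \<in> space M" "y \<in> space N" for i x y
    using eq[of x y "to_nat_on K i"] that K by (simp add: W''_def)
  let ?D = "distr M borel \<phi>" and ?E = "distr N borel \<psi>"
  have "sets (?D \<Otimes>\<^sub>M ?E) = sets (borel \<Otimes>\<^sub>M borel)"
    by (intro sets_pair_measure_cong) auto
  then have bnm_cong_sets: "bnm (?D \<Otimes>\<^sub>M ?E) f \<longleftrightarrow> bnm (borel \<Otimes>\<^sub>M borel) f" for f
    using sets_eq_imp_space_eq[of "?D \<Otimes>\<^sub>M ?E" "borel \<Otimes>\<^sub>M borel"]
    unfolding bounded_nonneg_measurable_def by (simp cong: measurable_cong_sets)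
  have W'': "bigraphon ?D ?E (W'' i)" for i
    using W' MN \<phi> \<psi> unfolding bigraphon_def
    by (auto simp: W''_def bnm_cong_sets intro: prob_space.prob_space_distr)
  have tr: "density_t (left_colored \<l>' H) M N W = density_t (left_colored \<l>' H) ?D ?E W''"
    if "\<l>' ` lverts (underlying H) \<subseteq> \<l> ` lverts (underlying H)" for \<l>'
  proof (rule density_t_distr)
    show "wf_bigraph (underlying (left_colored \<l>' H))"
      using H by (simp add: left_colored_def)
    fix e assume "e \<in> edges (underlying (left_colored \<l>' H))"
    then have e: "e \<in> edges (underlying H)"
      by (simp add: left_colored_def)
    then have "coloring (left_colored \<l>' H) e \<in> K"
      using that edges_lr[OF H, of "fst e" "snd e"]
      by (auto simp: K_def left_colored_def split: prod.split)
    then show "W (coloring (left_colored \<l>' H) e) (x, y) = W'' (coloring (left_colored \<l>' H) e) (\<phi> x, \<psi> y)"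
      if "x \<in> space M" "y \<in> space N" for x y
      using that eqK by blast
  qed (use MN \<phi> \<psi> W' in \<open>auto simp: W''_def\<close>)
  have "density_t (left_colored \<l> H) ?D ?E W'' \<le>
          (\<Prod>v\<in>lverts (underlying H).
             density_t (left_colored (\<lambda>_. \<l> v) H) ?D ?E W'' powr (1 / real (card (lverts (underlying H)))))"
    using lwh W'' unfolding left_weakly_holder_def by blast
  then show "density_t (left_colored \<l> H) M N W \<le>
          (\<Prod>v\<in>lverts (underlying H).
             density_t (left_colored (\<lambda>_. \<l> v) H) M N W powr (1 / real (card (lverts (underlying H)))))"
    using tr by (auto cong: prod.cong simp: image_subset_iff)
qed

section \<open>Normalized weights on a weakly Hoelder bigraph\<close>

lemma wf_bigraph_finite:
  assumes "wf_bigraph G"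
  shows "finite (lverts G)" "finite (rverts G)" "finite (edges G)"
  using assms by (auto simp: wf_bigraph_def intro: finite_subset)

lemma nbrs_right:
  assumes "wf_bigraph G" "w \<in> rverts G"
  shows "nbrs G w = {v. (v, w) \<in> edges G}" "nbrs G w \<subseteq> lverts G"
  using assms by (auto simp: nbrs_def wf_bigraph_def)

lemma nbrs_left:
  assumes "wf_bigraph G" "v \<in> lverts G"
  shows "nbrs G v = {w. (v, w) \<in> edges G}" "nbrs G v \<subseteq> rverts G"
  using assms by (auto simp: nbrs_def wf_bigraph_def)

lemma prod_edges_right:
  assumes "wf_bigraph G"
  shows "(\<Prod>(v, w)\<in>edges G. F v w) = (\<Prod>w\<in>rverts G. \<Prod>v\<in>nbrs G w. F v w)"
proof -
  have "(\<Prod>w\<in>rverts G. \<Prod>v\<in>nbrs G w. F v w) = (\<Prod>(w, v)\<in>Sigma (rverts G) (nbrs G). F v w)"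
    using assms by (intro prod.Sigma ballI)
      (auto simp: wf_bigraph_finite intro: finite_subset[OF nbrs_right(2)])
  also have "\<dots> = (\<Prod>(v, w)\<in>edges G. F v w)"
    by (rule prod.reindex_bij_witness[where i = prod.swap and j = prod.swap])
      (use assms edges_lr[OF assms] in \<open>auto simp: nbrs_right\<close>)
  finally show ?thesis ..
qed

lemma prod_edges_left:
  assumes "wf_bigraph G"
  shows "(\<Prod>(v, w)\<in>edges G. F v w) = (\<Prod>v\<in>lverts G. \<Prod>w\<in>nbrs G v. F v w)"
proof -
  have "(\<Prod>v\<in>lverts G. \<Prod>w\<in>nbrs G v. F v w) = (\<Prod>(v, w)\<in>Sigma (lverts G) (nbrs G). F v w)"
    using assms by (intro prod.Sigma ballI)
      (auto simp: wf_bigraph_finite intro: finite_subset[OF nbrs_left(2)])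
  also have "Sigma (lverts G) (nbrs G) = edges G"
    using assms edges_lr[OF assms] by (auto simp: nbrs_left)
  finally show ?thesis ..
qed

lemma bnm_prod_component:
  assumes "U \<subseteq> V" "\<And>v. v \<in> U \<Longrightarrow> bnm (M \<Otimes>\<^sub>M N) (S v)"
  shows "bnm ((\<Pi>\<^sub>M v\<in>V. M) \<Otimes>\<^sub>M N) (\<lambda>z. \<Prod>v\<in>U. S v (fst z v, snd z))"
proof (rule bnm_prod)
  fix v assume v: "v \<in> U"
  with assms(1) have [measurable]: "v \<in> V" by auto
  show "bnm ((\<Pi>\<^sub>M v\<in>V. M) \<Otimes>\<^sub>M N) (\<lambda>z. S v (fst z v, snd z))"
    by (rule bnm_compose[OF assms(2)[OF v]]) measurable
qed

lemma bnm_PiM_component: "v \<in> V \<Longrightarrow> bnm M A \<Longrightarrow> bnm (\<Pi>\<^sub>M v\<in>V. M) (\<lambda>x. A (x v))"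
  by (rule bnm_compose) measurable

lemma space_PiM_component: "x \<in> space (\<Pi>\<^sub>M v\<in>V. M) \<Longrightarrow> v \<in> V \<Longrightarrow> x v \<in> space M"
  by (auto simp: space_PiM)

lemma bnm_PiM_right_integral:
  assumes "prob_space N" "U \<subseteq> V" "\<And>v. v \<in> U \<Longrightarrow> bnm (M \<Otimes>\<^sub>M N) (S v)"
  shows "bnm (\<Pi>\<^sub>M v\<in>V. M) (\<lambda>x. \<integral>y. (\<Prod>v\<in>U. S v (x v, y)) \<partial>N)"
  using bnm_integral[OF assms(1) bnm_prod_component[OF assms(2,3)]] by simp

lemma density_t_right_integral:
  assumes H: "wf_bigraph (underlying H)" and M: "prob_space M" and N: "prob_space N"
    and W: "\<And>i. bnm (M \<Otimes>\<^sub>M N) (W i)"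
  shows "density_t H M N W = (\<integral>x. (\<Prod>w\<in>rverts (underlying H). \<integral>y.
      (\<Prod>v\<in>nbrs (underlying H) w. W (coloring H (v, w)) (x v, y)) \<partial>N) \<partial>(\<Pi>\<^sub>M v\<in>lverts (underlying H). M))"
proof -
  have "density_t H M N W = (\<integral>(x, y). 1 * (\<Prod>w\<in>rverts (underlying H).
      (\<lambda>w z. \<Prod>v\<in>nbrs (underlying H) w. W (coloring H (v, w)) (fst z v, snd z)) w (x, y w))
      \<partial>((\<Pi>\<^sub>M v\<in>lverts (underlying H). M) \<Otimes>\<^sub>M (\<Pi>\<^sub>M w\<in>rverts (underlying H). N)))"
    unfolding density_t_def assignments_def
    by (subst prod_edges_right[OF H]) simp
  also have "\<dots> = (\<integral>x. 1 * (\<Prod>w\<in>rverts (underlying H). \<integral>y.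
      (\<lambda>w z. \<Prod>v\<in>nbrs (underlying H) w. W (coloring H (v, w)) (fst z v, snd z)) w (x, y) \<partial>N)
        \<partial>(\<Pi>\<^sub>M v\<in>lverts (underlying H). M))"
    by (rule integral_bipartite[OF M N])
      (use H W in \<open>auto simp: wf_bigraph_finite intro!: bnm_const bnm_prod_component
         dest: nbrs_right(2)[OF H]\<close>)
  finally show ?thesis by simp
qed

lemma autD:
  assumes "\<sigma> \<in> aut H"
  shows "\<sigma> permutes verts (underlying H)" "\<sigma> ` lverts (underlying H) = lverts (underlying H)"
    "\<sigma> ` rverts (underlying H) = rverts (underlying H)"
    "v \<in> lverts (underlying H) \<Longrightarrow> w \<in> rverts (underlying H) \<Longrightarrow>
      (\<sigma> v, \<sigma> w) \<in> edges (underlying H) \<longleftrightarrow> (v, w) \<in> edges (underlying H)"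
    "(v, w) \<in> edges (underlying H) \<Longrightarrow> coloring H (\<sigma> v, \<sigma> w) = coloring H (v, w)"
  using assms by (auto simp: aut_def bigraph_aut_def)

lemma aut_nbrs_left:
  assumes H: "wf_bigraph (underlying H)" and \<sigma>: "\<sigma> \<in> aut H" and v: "v \<in> lverts (underlying H)"
  shows "nbrs (underlying H) (\<sigma> v) = \<sigma> ` nbrs (underlying H) v"
proof -
  have "\<sigma> v \<in> lverts (underlying H)"
    using autD(2)[OF \<sigma>] v by auto
  then have "nbrs (underlying H) (\<sigma> v) = {w \<in> \<sigma> ` rverts (underlying H). (\<sigma> v, w) \<in> edges (underlying H)}"
    using edges_lr[OF H] by (auto simp: nbrs_left[OF H] autD(3)[OF \<sigma>])
  also have "\<dots> = \<sigma> ` {w \<in> rverts (underlying H). (v, w) \<in> edges (underlying H)}"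
    using autD(4)[OF \<sigma> v] by auto
  also have "{w \<in> rverts (underlying H). (v, w) \<in> edges (underlying H)} = nbrs (underlying H) v"
    using edges_lr[OF H] v by (auto simp: nbrs_left[OF H])
  finally show ?thesis .
qed

lemma aut_nbrs_right:
  assumes H: "wf_bigraph (underlying H)" and \<sigma>: "\<sigma> \<in> aut H" and w: "w \<in> rverts (underlying H)"
  shows "nbrs (underlying H) (\<sigma> w) = \<sigma> ` nbrs (underlying H) w"
proof -
  have "\<sigma> w \<in> rverts (underlying H)"
    using autD(3)[OF \<sigma>] w by auto
  then have "nbrs (underlying H) (\<sigma> w) = {v \<in> \<sigma> ` lverts (underlying H). (v, \<sigma> w) \<in> edges (underlying H)}"
    using edges_lr[OF H] by (auto simp: nbrs_right[OF H] autD(2)[OF \<sigma>])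
  also have "\<dots> = \<sigma> ` {v \<in> lverts (underlying H). (v, w) \<in> edges (underlying H)}"
    using autD(4)[OF \<sigma> _ w] by auto
  also have "{v \<in> lverts (underlying H). (v, w) \<in> edges (underlying H)} = nbrs (underlying H) w"
    using edges_lr[OF H] w by (auto simp: nbrs_right[OF H])
  finally show ?thesis .
qed

section \<open>Transitivity and regularity on the left vertices\<close>

locale holder_bigraph =
  fixes H :: "('v, 'c) colored_bigraph" and f :: "'v \<Rightarrow> 'c"
  assumes wf: "wf_bigraph (underlying H)"
    and nontriv: "non_trivial (underlying H)"
    and no_isol: "no_isolated_vertices (underlying H)"
    and f: "(v, w) \<in> edges (underlying H) \<Longrightarrow> coloring H (v, w) = f w"
    and cet: "color_edge_transitive H"
    and lwh: "left_weakly_holder TYPE(real) TYPE(real) H"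
begin

abbreviation "V \<equiv> lverts (underlying H)"
abbreviation "R \<equiv> rverts (underlying H)"
abbreviation "E \<equiv> edges (underlying H)"
abbreviation "nb \<equiv> nbrs (underlying H)"

definition n :: nat where "n = card V"

lemma fin: "finite V" "finite R" "finite E"
  using wf by (rule wf_bigraph_finite)+

lemma finite_nb: "w \<in> R \<Longrightarrow> finite (nb w)"
  using nbrs_right(2)[OF wf] fin finite_subset by blast

lemma V_nonempty: "V \<noteq> {}"
  using nontriv edges_lr[OF wf] by (auto simp: non_trivial_def)

lemma n_pos: "0 < n"
  using V_nonempty fin by (simp add: n_def card_gt_0_iff)

text \<open>Testing the weak Hoelder inequality on constant bigraphons shows that every left vertex lies
  on an edge of every color; together with edge-transitivity this makes \<open>aut H\<close> transitive on \<open>V\<close>.\<close>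

lemma left_vertex_has_color:
  assumes ab: "(a, b) \<in> E" and u: "u \<in> V"
  shows "\<exists>w. (u, w) \<in> E \<and> f w = f b"
proof (rule ccontr)
  assume no: "\<not> ?thesis"
  define M :: "real measure" where "M = return borel 0"
  interpret M: prob_space M
    unfolding M_def by (rule prob_space_return) simp
  define k :: "nat \<times> 'c \<Rightarrow> real" where "k = (\<lambda>(i, c). if i = 1 \<and> c = f b then 1 / 2 else 1)"
  have k: "0 \<le> k i" "k i \<le> 1" "k (1, f b) = 1 / 2" for i
    by (simp_all add: k_def split: prod.split)
  define W :: "nat \<times> 'c \<Rightarrow> real \<times> real \<Rightarrow> real" where "W = (\<lambda>i _. k i)"
  have W: "bigraphon M M (W i)" for i
    unfolding bigraphon_def using M.prob_space_axioms
    by (auto simp: W_def k_def split: prod.split intro!: bnm_const)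
  have prob: "prob_space (assignments (underlying H) M M)"
  proof -
    interpret P1: prob_space "\<Pi>\<^sub>M v\<in>V. M" by (intro prob_space_PiM M.prob_space_axioms)
    interpret P2: prob_space "\<Pi>\<^sub>M v\<in>R. M" by (intro prob_space_PiM M.prob_space_axioms)
    interpret P: pair_prob_space "\<Pi>\<^sub>M v\<in>V. M" "\<Pi>\<^sub>M v\<in>R. M" ..
    show ?thesis unfolding assignments_def by (rule P.prob_space_axioms)
  qed
  have dens: "density_t (left_colored \<l> H) M M W = (\<Prod>(v, w)\<in>E. k (\<l> v, f w))" for \<l>
  proof -
    have "(\<Prod>(v, w)\<in>E. k (\<l> v, coloring H (v, w))) = (\<Prod>(v, w)\<in>E. k (\<l> v, f w))"
      by (intro prod.cong) (auto simp: f)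
    then show ?thesis
      unfolding density_t_def left_colored_def W_def
      by (simp add: prob_space.prob_space[OF prob] case_prod_unfold)
  qed
  \<comment> \<open>Only \<open>u\<close> sees the value 1/2, and only in the color of
    \<open>b\<close>. If \<open>u\<close> has no such edge, the left density is 1, whereas the
    factor of \<open>u\<close> on the right is at most \<open>(1 / 2) powr (1 / n)\<close>, as the
    edge \<open>(a, b)\<close> has that color.\<close>
  define \<l> where "\<l> v = (if v = u then 1 else 0 :: nat)" for v
  have "density_t (left_colored \<l> H) M M W \<le>
     (\<Prod>v\<in>V. density_t (left_colored (\<lambda>_. \<l> v) H) M M W powr (1 / real (card V)))"
    using lwh W unfolding left_weakly_holder_def by blast
  also have "density_t (left_colored \<l> H) M M W = 1"
    unfolding dens using no by (intro prod.neutral) (auto simp: \<l>_def k_def)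
  also have "(\<Prod>v\<in>V. density_t (left_colored (\<lambda>_. \<l> v) H) M M W powr (1 / real (card V)))
     = (\<Prod>v\<in>V. if v = u then (\<Prod>(v, w)\<in>E. k (1, f w)) powr (1 / real (card V)) else 1)"
    unfolding dens by (intro prod.cong) (auto simp: \<l>_def k_def)
  also have "\<dots> = (\<Prod>(v, w)\<in>E. k (1, f w)) powr (1 / real (card V))"
    using u fin by simp
  also have "\<dots> \<le> (1 / 2) powr (1 / real (card V))"
  proof (intro powr_mono2)
    have "(\<Prod>(v, w)\<in>E. k (1, f w)) = k (1, f b) * (\<Prod>(v, w)\<in>E - {(a, b)}. k (1, f w))"
      using ab fin by (subst prod.remove[of _ "(a, b)"]) auto
    also have "\<dots> \<le> 1 / 2 * 1"
      unfolding k(3) by (intro mult_mono prod_le_1 prod_nonneg) (auto simp: k)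
    finally show "(\<Prod>(v, w)\<in>E. k (1, f w)) \<le> 1 / 2" by simp
  qed (auto simp: k intro!: prod_nonneg)
  finally have "1 \<le> (1 / 2 :: real) powr (1 / real (card V))" .
  moreover have "(1 / 2 :: real) powr (1 / real (card V)) < 1"
    using n_pos powr_less_mono2[of "1 / real (card V)" "1 / 2" 1] by (simp add: n_def)
  ultimately show False by simp
qed

lemma left_transitive:
  assumes "u \<in> V" "v \<in> V"
  shows "\<exists>\<sigma>\<in>aut H. \<sigma> u = v"
proof -
  obtain a b where ab: "(a, b) \<in> E"
    using nontriv by (auto simp: non_trivial_def)
  obtain w w' where "(u, w) \<in> E" "f w = f b" "(v, w') \<in> E" "f w' = f b"
    using left_vertex_has_color[OF ab] assms by metis
  then show ?thesis
    using cet f unfolding color_edge_transitive_def by fastforce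
qed

text \<open>Automorphisms carry neighborhoods to neighborhoods, so transitivity forces a common left
  degree. The degree serves to distribute a weight on a left vertex evenly over its edges.\<close>

lemma left_regular: "\<exists>d>0. \<forall>v\<in>V. card (nb v) = d"
proof -
  obtain u where u: "u \<in> V"
    using V_nonempty by auto
  have "finite (nb u)"
    using nbrs_left(2)[OF wf u] fin finite_subset by blast
  moreover have "nb u \<noteq> {}"
    using no_isol u by (auto simp: no_isolated_vertices_def verts_def)
  moreover have "card (nb v) = card (nb u)" if v: "v \<in> V" for v
  proof -
    obtain \<sigma> where \<sigma>: "\<sigma> \<in> aut H" "\<sigma> u = v"
      using left_transitive[OF u v] by auto
    then have "nb v = \<sigma> ` nb u"
      using aut_nbrs_left[OF wf \<sigma>(1) u] by simp
    then show ?thesis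
      using permutes_inj[OF autD(1)[OF \<sigma>(1)]] by (metis card_image inj_on_subset subset_UNIV)
  qed
  ultimately show ?thesis
    by (intro exI[of _ "card (nb u)"]) (auto simp: card_gt_0_iff)
qed

text \<open>The weak Hoelder property survives a weight \<open>A\<close> on the left variables: put
  the factor \<open>A powr (1 / d)\<close> on every edge, \<open>d\<close> being the left degree.
  The \<open>d\<close> edges at a vertex then contribute \<open>A\<close> exactly once, under every
  left-coloring.\<close>

lemma weighted_left_holder:
  fixes \<l> :: "'v \<Rightarrow> nat" and M :: "'x measure" and N :: "'y measure"
    and S :: "nat \<times> 'c \<Rightarrow> 'x \<times> 'y \<Rightarrow> real"
  assumes M: "prob_space M" and N: "prob_space N" and A: "bnm M A" and S: "\<And>i. bnm (M \<Otimes>\<^sub>M N) (S i)"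
  defines "Z \<equiv> \<lambda>\<l>. \<integral>x. (\<Prod>v\<in>V. A (x v)) *
     (\<Prod>w\<in>R. \<integral>y. (\<Prod>v\<in>nb w. S (\<l> v, f w) (x v, y)) \<partial>N) \<partial>(\<Pi>\<^sub>M v\<in>V. M)"
  shows "Z \<l> \<le> (\<Prod>v\<in>V. Z (\<lambda>_. \<l> v) powr (1 / n))"
proof -
  obtain d where d: "0 < d" "\<And>v. v \<in> V \<Longrightarrow> card (nb v) = d"
    using left_regular by auto
  define W where "W i = (\<lambda>z. A (fst z) powr (1 / d) * S i z)" for i
  have W: "bnm (M \<Otimes>\<^sub>M N) (W i)" for i
    unfolding W_def using A S by (intro bnm_mult bnm_powr bnm_compose[OF A]) auto
  have Z: "density_t (left_colored \<l>' H) M N W = Z \<l>'" for \<l>'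
  proof -
    have "(\<Prod>w\<in>R. \<integral>y. (\<Prod>v\<in>nb w. W (coloring (left_colored \<l>' H) (v, w)) (x v, y)) \<partial>N)
        = (\<Prod>v\<in>V. A (x v)) * (\<Prod>w\<in>R. \<integral>y. (\<Prod>v\<in>nb w. S (\<l>' v, f w) (x v, y)) \<partial>N)"
      if x: "x \<in> space (\<Pi>\<^sub>M v\<in>V. M)" for x
    proof -
      have "(\<Prod>w\<in>R. \<integral>y. (\<Prod>v\<in>nb w. W (coloring (left_colored \<l>' H) (v, w)) (x v, y)) \<partial>N)
        = (\<Prod>w\<in>R. (\<Prod>v\<in>nb w. A (x v) powr (1 / d)) * (\<integral>y. (\<Prod>v\<in>nb w. S (\<l>' v, f w) (x v, y)) \<partial>N))"
      proof (rule prod.cong[OF refl])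
        fix w assume w: "w \<in> R"
        have "(\<Prod>v\<in>nb w. W (coloring (left_colored \<l>' H) (v, w)) (x v, y))
           = (\<Prod>v\<in>nb w. A (x v) powr (1 / d)) * (\<Prod>v\<in>nb w. S (\<l>' v, f w) (x v, y))" for y
          unfolding prod.distrib[symmetric]
          by (intro prod.cong) (use w nbrs_right[OF wf w] in \<open>auto simp: W_def left_colored_def f\<close>)
        then show "(\<integral>y. (\<Prod>v\<in>nb w. W (coloring (left_colored \<l>' H) (v, w)) (x v, y)) \<partial>N)
          = (\<Prod>v\<in>nb w. A (x v) powr (1 / d)) * (\<integral>y. (\<Prod>v\<in>nb w. S (\<l>' v, f w) (x v, y)) \<partial>N)"
          by simp
      qed
      also have "\<dots> = (\<Prod>w\<in>R. \<Prod>v\<in>nb w. A (x v) powr (1 / d)) *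
          (\<Prod>w\<in>R. \<integral>y. (\<Prod>v\<in>nb w. S (\<l>' v, f w) (x v, y)) \<partial>N)"
        by (rule prod.distrib)
      also have "(\<Prod>w\<in>R. \<Prod>v\<in>nb w. A (x v) powr (1 / d)) = (\<Prod>v\<in>V. \<Prod>w\<in>nb v. A (x v) powr (1 / d))"
        using prod_edges_left[OF wf, of "\<lambda>v _. A (x v) powr (1 / d)"]
          prod_edges_right[OF wf, of "\<lambda>v _. A (x v) powr (1 / d)"] by simp
      also have "\<dots> = (\<Prod>v\<in>V. A (x v))"
      proof (rule prod.cong[OF refl])
        fix v assume v: "v \<in> V"
        have "0 \<le> A (x v)"
          using bnm_nonneg[OF A space_PiM_component[OF x v]] .
        then show "(\<Prod>w\<in>nb v. A (x v) powr (1 / d)) = A (x v)"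
          using d v powr_power[of "A (x v)" "1 / d" d] by (cases "A (x v) = 0") auto
      qed
      finally show ?thesis .
    qed
    then show ?thesis
      unfolding Z_def using W
      by (subst density_t_right_integral[OF _ M N])
         (auto simp: left_colored_def wf intro!: Bochner_Integration.integral_cong)
  qed
  have "left_weakly_holder TYPE('x) TYPE('y) H"
    by (rule left_weakly_holder_transfer[OF wf lwh])
  moreover have "\<forall>i. bigraphon M N (W i)"
    using M N W by (simp add: bigraphon_def)
  ultimately have "density_t (left_colored \<l> H) M N W \<le>
      (\<Prod>v\<in>V. density_t (left_colored (\<lambda>_. \<l> v) H) M N W powr (1 / real (card V)))"
    unfolding left_weakly_holder_def by blast
  then show ?thesis
    unfolding Z n_def .
qed

end

section \<open>Deleting colors and raising exponents for normalized bigraphons\<close>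

text \<open>The normalization is required only where \<open>A\<close> does not vanish; elsewhere the
  factor \<open>A (x v)\<close> makes the whole weighted integrand 0.\<close>

locale normalized_weights = holder_bigraph H f
  for H :: "('v, 'c) colored_bigraph" and f +
  fixes M :: "'x measure" and N :: "'y measure" and A :: "'x \<Rightarrow> real" and S :: "'c \<Rightarrow> 'x \<times> 'y \<Rightarrow> real"
  assumes M: "prob_space M" and N: "prob_space N"
    and A: "bnm M A" and S: "\<And>c. bnm (M \<Otimes>\<^sub>M N) (S c)"
    and norm: "\<And>c x. x \<in> space M \<Longrightarrow> A x \<noteq> 0 \<Longrightarrow> (\<integral>y. S c (x, y) \<partial>N) = 1"
begin

abbreviation "PV \<equiv> \<Pi>\<^sub>M v\<in>V. M"

definition s :: "'v \<Rightarrow> ('v \<Rightarrow> 'x) \<Rightarrow> real" where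
  "s w x = (\<integral>y. (\<Prod>v\<in>nb w. S (f w) (x v, y)) \<partial>N)"

definition Z :: "'c set \<Rightarrow> real" where
  "Z I = (\<integral>x. (\<Prod>v\<in>V. A (x v)) * (\<Prod>w\<in>{w \<in> R. f w \<notin> I}. s w x) \<partial>PV)"

lemma prob_PV: "prob_space PV"
  by (intro prob_space_PiM M)

lemma bnm_s: "w \<in> R \<Longrightarrow> bnm PV (s w)"
  using bnm_PiM_right_integral[OF N nbrs_right(2)[OF wf], of w M "\<lambda>_. S (f w)"] S
  by (simp add: s_def[abs_def])

lemma bnm_prodA: "bnm PV (\<lambda>x. \<Prod>v\<in>V. A (x v))"
  by (intro bnm_prod bnm_PiM_component A)

lemma bnm_Z: "bnm PV (\<lambda>x. (\<Prod>v\<in>V. A (x v)) * (\<Prod>w\<in>{w \<in> R. f w \<notin> I}. s w x))"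
  by (intro bnm_mult bnm_prodA bnm_prod bnm_s) auto

lemma Z_nonneg: "0 \<le> Z I"
  unfolding Z_def by (rule prob_space.bnm_integral_nonneg[OF prob_PV bnm_Z])

text \<open>Give \<open>S\<close> to a single left vertex \<open>u\<close> on the edges whose color is in \<open>I\<close>. Every right vertex of
  such a color then sees at most one nontrivial factor, which integrates to 1.\<close>

lemma Z_le_Z_empty: "Z I \<le> Z {}"
proof (cases "Z I = 0")
  case True
  then show ?thesis using Z_nonneg by simp
next
  case False
  then have pos: "0 < Z I"
    using Z_nonneg[of I] by simp
  interpret N: prob_space N by (rule N)
  obtain u where u: "u \<in> V"
    using V_nonempty by auto
  \<comment> \<open>Left color 1 keeps all bigraphons, left color 0 replaces those with color in
    \<open>I\<close> by 1. The constant colorings thus give \<open>Z {}\<close> and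
    \<open>Z I\<close>, while the mixed coloring below also gives \<open>Z I\<close>.\<close>
  define T :: "nat \<times> 'c \<Rightarrow> 'x \<times> 'y \<Rightarrow> real" where
    "T = (\<lambda>(k, c) z. if k = 0 \<and> c \<in> I then 1 else S c z)"
  have T: "bnm (M \<Otimes>\<^sub>M N) (T i)" for i
    using S by (cases "fst i = 0 \<and> snd i \<in> I") (auto simp: T_def case_prod_unfold bnm_const)
  define \<l> where "\<l> v = (if v = u then 1 else 0 :: nat)" for v
  define Y where "Y = (\<lambda>\<l>. \<integral>x. (\<Prod>v\<in>V. A (x v)) *
     (\<Prod>w\<in>R. \<integral>y. (\<Prod>v\<in>nb w. T (\<l> v, f w) (x v, y)) \<partial>N) \<partial>PV)"
  have "Y (\<lambda>_. 1) = Z {}"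
    by (simp add: Y_def Z_def T_def s_def)
  moreover have "Y (\<lambda>_. 0) = Z I"
  proof -
    have "(\<Prod>w\<in>R. \<integral>y. (\<Prod>v\<in>nb w. T (0, f w) (x v, y)) \<partial>N) = (\<Prod>w\<in>{w \<in> R. f w \<notin> I}. s w x)" for x
      using fin by (subst prod.inter_filter) (auto simp: T_def s_def N.prob_space intro!: prod.cong)
    then show ?thesis
      by (simp add: Y_def Z_def)
  qed
  moreover have "Y \<l> = Z I"
    unfolding Y_def Z_def
  proof (rule Bochner_Integration.integral_cong[OF refl])
    fix x assume x: "x \<in> space PV"
    show "(\<Prod>v\<in>V. A (x v)) * (\<Prod>w\<in>R. \<integral>y. (\<Prod>v\<in>nb w. T (\<l> v, f w) (x v, y)) \<partial>N)
        = (\<Prod>v\<in>V. A (x v)) * (\<Prod>w\<in>{w \<in> R. f w \<notin> I}. s w x)"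
    proof (cases "A (x u) = 0")
      case True
      then have "(\<Prod>v\<in>V. A (x v)) = 0"
        using u fin by (auto intro!: prod_zero)
      then show ?thesis by simp
    next
      case False
      have "(\<integral>y. (\<Prod>v\<in>nb w. T (\<l> v, f w) (x v, y)) \<partial>N) = (if f w \<notin> I then s w x else 1)"
        if w: "w \<in> R" for w
      proof (cases "f w \<in> I")
        case True
        have "(\<Prod>v\<in>nb w. T (\<l> v, f w) (x v, y)) = (\<Prod>v\<in>nb w. if v = u then S (f w) (x u, y) else 1)" for y
          using True by (intro prod.cong) (auto simp: T_def \<l>_def)
        also have "\<dots> y = (if u \<in> nb w then S (f w) (x u, y) else 1)" for y
          using finite_nb[OF w] by simp
        finally show ?thesis
          using True norm[OF space_PiM_component[OF x u] False]
          by (cases "u \<in> nb w") (simp_all add: N.prob_space)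
      qed (auto simp: T_def s_def)
      then show ?thesis
        using fin by (subst prod.inter_filter) auto
    qed
  qed
  moreover have "Y \<l> \<le> (\<Prod>v\<in>V. Y (\<lambda>_. \<l> v) powr (1 / n))"
    unfolding Y_def by (rule weighted_left_holder[OF M N A T])
  \<comment> \<open>The factor of \<open>u\<close> is a power of \<open>Z {}\<close> and the other
    \<open>n - 1\<close> factors are powers of \<open>Z I\<close>. As \<open>Z I\<close> is
    positive, they can be cancelled.\<close>
  ultimately have "Z I \<le> (\<Prod>v\<in>V. if v = u then Z {} powr (1 / n) else Z I powr (1 / n))"
    by (simp add: \<l>_def if_distrib[of "\<lambda>k. Y (\<lambda>_. k) powr (1 / n)"] cong: if_cong)
  also have "\<dots> = Z {} powr (1 / n) * (\<Prod>v\<in>V - {u}. Z I powr (1 / n))"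
    using u fin by (subst prod.remove[of _ u]) (auto intro!: prod.cong)
  also have "(\<Prod>v\<in>V - {u}. Z I powr (1 / n)) = Z I powr (1 - 1 / n)"
    using u fin n_pos pos V_nonempty
    by (simp add: n_def powr_power diff_divide_distrib of_nat_diff)
  finally have "Z I \<le> Z {} powr (1 / n) * Z I powr (1 - 1 / n)" .
  then have "Z I powr (1 / n) \<le> Z {} powr (1 / n)"
    using pos by (simp add: powr_diff field_simps)
  then show ?thesis
    by (rule powr_le_powr_base) (use n_pos Z_nonneg in auto)
qed

lemma integral_prodA: "(\<integral>x. (\<Prod>v\<in>V. A (x v)) \<partial>PV) = (\<integral>x. A x \<partial>M) ^ n"
proof -
  interpret M: prob_space M by (rule M)
  interpret P: product_prob_space "\<lambda>_::'v. M" by unfold_locales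
  show ?thesis
    using P.product_integral_prod[of V "\<lambda>_. A"] fin M.bnm_integrable[OF A] by (simp add: n_def)
qed

lemma Z_all: "Z (f ` R) = (\<integral>x. A x \<partial>M) ^ n"
proof -
  have "{w \<in> R. f w \<notin> f ` R} = {}" by auto
  then show ?thesis
    by (simp only: Z_def prod.empty mult_1_right integral_prodA)
qed

text \<open>The logarithm of the weighted density is convex in the exponents \<open>\<theta>\<close>, and by \<open>Z_le_Z_empty\<close>
  it does not increase when the exponent of a color drops from 1 to 0. Hence it does not decrease when
  exponents grow beyond 1: the all-ones vector is a convex combination of \<open>\<theta>\<close> and of the vectors
  in which one color is removed.\<close>

lemma Z_empty_le_powr:
  assumes \<theta>: "\<And>c. c \<in> f ` R \<Longrightarrow> 1 \<le> \<theta> c"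
  shows "Z {} \<le> (\<integral>x. (\<Prod>v\<in>V. A (x v)) * (\<Prod>w\<in>R. s w x powr \<theta> (f w)) \<partial>PV)" (is "_ \<le> ?Q")
proof -
  interpret P: prob_space PV by (rule prob_PV)
  define C where "C = f ` R"
  have C: "finite C"
    using fin by (simp add: C_def)
  \<comment> \<open>Weight \<alpha> goes to the exponent vector \<theta>, and weight
    \<open>\<alpha> * (\<theta> c - 1)\<close> to the all-ones vector without color
    \<open>c\<close>. With \<open>S\<close> the sum of all \<open>\<theta> c - 1\<close>, the total
    weight is \<open>\<alpha> * (1 + S)\<close>. The combined exponent of color \<open>c\<close> is
    \<open>\<alpha> * (\<theta> c + S - (\<theta> c - 1))\<close>, the same number, so this \<alpha>
    makes all of them 1.\<close>
  define \<alpha> where "\<alpha> = 1 / (1 + (\<Sum>c\<in>C. \<theta> c - 1))"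
  have "0 \<le> (\<Sum>c\<in>C. \<theta> c - 1)"
    using \<theta> by (intro sum_nonneg) (auto simp: C_def)
  then have \<alpha>: "0 < \<alpha>" "\<alpha> \<le> 1" "\<alpha> * (1 + (\<Sum>c\<in>C. \<theta> c - 1)) = 1"
    by (auto simp: \<alpha>_def)
  define a where "a i = (case i of None \<Rightarrow> \<alpha> | Some c \<Rightarrow> \<alpha> * (\<theta> c - 1))" for i
  define h where "h i x = (case i of None \<Rightarrow> (\<Prod>v\<in>V. A (x v)) * (\<Prod>w\<in>R. s w x powr \<theta> (f w))
     | Some c \<Rightarrow> (\<Prod>v\<in>V. A (x v)) * (\<Prod>w\<in>{w \<in> R. f w \<notin> {c}}. s w x))" for i x
  let ?I = "insert None (Some ` C)"
  have sum_I: "sum g ?I = g None + (\<Sum>c\<in>C. g (Some c))" for g :: "'c option \<Rightarrow> real"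
    using C by (subst sum.insert) (auto simp: sum.reindex)
  have prod_I: "prod g ?I = g None * (\<Prod>c\<in>C. g (Some c))" for g :: "'c option \<Rightarrow> real"
    using C by (subst prod.insert) (auto simp: prod.reindex)
  have sum_a: "sum a ?I = 1"
    using \<alpha>(3) by (simp add: sum_I a_def sum_distrib_left algebra_simps)
  have a_nonneg: "0 \<le> a i" if "i \<in> ?I" for i
    using that \<alpha> \<theta> by (auto simp: a_def C_def)
  have h: "bnm PV (h i)" if "i \<in> ?I" for i
    using that
  proof (elim insertE imageE)
    assume "i = None"
    then have "h i = (\<lambda>x. (\<Prod>v\<in>V. A (x v)) * (\<Prod>w\<in>R. s w x powr \<theta> (f w)))"
      by (simp add: h_def fun_eq_iff)
    moreover have "bnm PV \<dots>"
      using \<theta> by (intro bnm_mult bnm_prodA bnm_prod bnm_powr bnm_s) (auto intro: order.trans[OF zero_le_one])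
    ultimately show ?thesis by simp
  next
    fix c assume "i = Some c"
    then have "h i = (\<lambda>x. (\<Prod>v\<in>V. A (x v)) * (\<Prod>w\<in>{w \<in> R. f w \<notin> {c}}. s w x))"
      by (simp add: h_def fun_eq_iff)
    then show ?thesis
      using bnm_Z[of "{c}"] by simp
  qed
  have ptw: "(\<Prod>v\<in>V. A (x v)) * (\<Prod>w\<in>R. s w x) \<le> (\<Prod>i\<in>?I. h i x powr a i)"
    if x: "x \<in> space PV" for x
  \<comment> \<open>Zeros are separated because \<open>0 powr 0 = 0\<close>: a removed color is
    encoded below by the exponent 0, which gives 1 only for a positive base.\<close>
  proof (cases "(\<Prod>v\<in>V. A (x v)) = 0 \<or> (\<exists>w\<in>R. s w x = 0)")
    case True
    then have "(\<Prod>v\<in>V. A (x v)) * (\<Prod>w\<in>R. s w x) = 0"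
      using fin by auto
    also have "0 \<le> (\<Prod>i\<in>?I. h i x powr a i)"
      by (rule prod_nonneg) simp
    finally show ?thesis .
  next
    case False
    define p where "p = (\<Prod>v\<in>V. A (x v))"
    have p: "0 < p"
      using False bnm_nonneg[OF bnm_prodA x] by (simp add: p_def)
    have s: "0 < s w x" if "w \<in> R" for w
      using False bnm_nonneg[OF bnm_s[OF that] x] that by (metis less_eq_real_def)
    have powr_prod: "(\<Prod>w\<in>X. t w) powr e = (\<Prod>w\<in>X. t w powr e)"
      if "\<And>w. w \<in> X \<Longrightarrow> 0 < t w" for X e and t :: "'v \<Rightarrow> real"
      using that by (simp add: prod_powr_distrib less_imp_le)
    have hN: "h None x powr a None = p powr \<alpha> * (\<Prod>w\<in>R. s w x powr (\<theta> (f w) * \<alpha>))"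
    proof -
      have "(\<Prod>w\<in>R. s w x powr \<theta> (f w)) powr \<alpha> = (\<Prod>w\<in>R. s w x powr (\<theta> (f w) * \<alpha>))"
        by (subst powr_prod) (auto simp: powr_powr dest: s)
      then show ?thesis
        using p by (simp add: h_def a_def powr_mult prod_nonneg flip: p_def)
    qed
    have hS: "h (Some c) x powr a (Some c) = p powr (\<alpha> * (\<theta> c - 1)) *
        (\<Prod>w\<in>R. s w x powr (if f w = c then 0 else \<alpha> * (\<theta> c - 1)))" for c
    proof -
      have "(\<Prod>w\<in>{w \<in> R. f w \<noteq> c}. s w x) powr (\<alpha> * (\<theta> c - 1)) =
          (\<Prod>w\<in>{w \<in> R. f w \<noteq> c}. s w x powr (\<alpha> * (\<theta> c - 1)))"
        using s by (subst powr_prod) auto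
      also have "\<dots> = (\<Prod>w\<in>R. if f w \<noteq> c then s w x powr (\<alpha> * (\<theta> c - 1)) else 1)"
        using fin by (subst prod.inter_filter) auto
      also have "\<dots> = (\<Prod>w\<in>R. s w x powr (if f w = c then 0 else \<alpha> * (\<theta> c - 1)))"
        using s by (intro prod.cong) (auto dest: s)
      finally show ?thesis
        using s p by (simp add: h_def a_def flip: p_def)
          (subst powr_mult, auto simp: prod_nonneg less_imp_le)
    qed
    have "(\<Prod>i\<in>?I. h i x powr a i) = (p powr \<alpha> * (\<Prod>c\<in>C. p powr (\<alpha> * (\<theta> c - 1)))) *
       (\<Prod>w\<in>R. s w x powr (\<theta> (f w) * \<alpha>) * (\<Prod>c\<in>C. s w x powr (if f w = c then 0 else \<alpha> * (\<theta> c - 1))))"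
      unfolding prod_I hN hS prod.distrib by (subst prod.swap) (simp add: mult_ac)
    also have "p powr \<alpha> * (\<Prod>c\<in>C. p powr (\<alpha> * (\<theta> c - 1))) = p powr (\<alpha> + (\<Sum>c\<in>C. \<alpha> * (\<theta> c - 1)))"
      using p by (simp add: powr_add powr_sum)
    also have "\<alpha> + (\<Sum>c\<in>C. \<alpha> * (\<theta> c - 1)) = 1"
      using sum_a by (simp add: sum_I a_def)
    also have "(\<Prod>w\<in>R. s w x powr (\<theta> (f w) * \<alpha>) * (\<Prod>c\<in>C. s w x powr (if f w = c then 0 else \<alpha> * (\<theta> c - 1))))
        = (\<Prod>w\<in>R. s w x)"
    proof (rule prod.cong[OF refl])
      fix w assume w: "w \<in> R"
      have "(\<Sum>c\<in>C. if f w = c then 0 else \<alpha> * (\<theta> c - 1)) =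
         (\<Sum>c\<in>C. \<alpha> * (\<theta> c - 1)) - \<alpha> * (\<theta> (f w) - 1)"
        using C w by (subst sum.remove[of C "f w"], simp, simp add: C_def)
          (subst sum.remove[of C "f w"], auto simp: C_def intro!: sum.cong split: if_splits)
      then have "\<theta> (f w) * \<alpha> + (\<Sum>c\<in>C. if f w = c then 0 else \<alpha> * (\<theta> c - 1)) = 1"
        using sum_a by (simp add: sum_I a_def algebra_simps)
      then show "s w x powr (\<theta> (f w) * \<alpha>) * (\<Prod>c\<in>C. s w x powr (if f w = c then 0 else \<alpha> * (\<theta> c - 1))) = s w x"
        using s[OF w] by (simp flip: powr_add powr_sum)
    qed
    finally show ?thesis
      using p by (simp add: p_def)
  qed
  have Q0: "0 \<le> ?Q"
    using P.bnm_integral_nonneg[OF h[of None]] by (simp add: h_def)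
  have "Z {} \<le> (\<integral>x. (\<Prod>i\<in>?I. h i x powr a i) \<partial>PV)"
    unfolding Z_def using ptw
    by (intro P.bnm_integral_mono bnm_prod bnm_powr h a_nonneg) (use bnm_Z[of "{}"] in auto)
  also have "\<dots> \<le> (\<Prod>i\<in>?I. (\<integral>x. h i x \<partial>PV) powr a i)"
    using C sum_a a_nonneg h by (intro P.holder_prod) auto
  also have "\<dots> = ?Q powr \<alpha> * (\<Prod>c\<in>C. Z {c} powr (\<alpha> * (\<theta> c - 1)))"
    by (simp add: prod_I h_def a_def Z_def)
  also have "\<dots> \<le> ?Q powr \<alpha> * (\<Prod>c\<in>C. Z {} powr (\<alpha> * (\<theta> c - 1)))"
    using \<theta> \<alpha> by (intro mult_left_mono prod_mono conjI powr_mono2 Z_le_Z_empty Z_nonneg) (auto simp: C_def)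
  finally have *: "Z {} \<le> ?Q powr \<alpha> * (\<Prod>c\<in>C. Z {} powr (\<alpha> * (\<theta> c - 1)))" .
  show ?thesis
  proof (cases "Z {} = 0")
    case True
    then show ?thesis using Q0 by simp
  next
    case False
    then have Z: "0 < Z {}"
      using Z_nonneg[of "{}"] by simp
    have "(\<Prod>c\<in>C. Z {} powr (\<alpha> * (\<theta> c - 1))) = Z {} powr (1 - \<alpha>)"
    proof -
      have "(\<Sum>c\<in>C. \<alpha> * (\<theta> c - 1)) = 1 - \<alpha>"
        using sum_a by (simp add: sum_I a_def)
      then show ?thesis
        using Z by (simp flip: powr_sum)
    qed
    then have "Z {} \<le> ?Q powr \<alpha> * Z {} powr (1 - \<alpha>)"
      using * by (simp only:)
    then have "Z {} powr \<alpha> \<le> ?Q powr \<alpha>"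
      using Z by (simp add: powr_diff field_simps)
    then show ?thesis
      by (rule powr_le_powr_base) (use Q0 \<alpha> in auto)
  qed
qed

text \<open>The density with all colors deleted is
  \<open>(\<integral>x. A x \<partial>M) ^ n\<close>; it grows when the colors are restored with
  exponent 1, and again when the exponents are raised to \<theta>.\<close>

lemma weighted_density_ge:
  assumes "\<And>c. c \<in> f ` R \<Longrightarrow> 1 \<le> \<theta> c"
  shows "(\<integral>x. A x \<partial>M) ^ n \<le> (\<integral>x. (\<Prod>v\<in>V. A (x v)) * (\<Prod>w\<in>R. s w x powr \<theta> (f w)) \<partial>PV)"
  using Z_empty_le_powr[of \<theta>, OF assms] Z_le_Z_empty[of "f ` R"] by (simp add: Z_all)

end

section \<open>Orbits of left sets\<close>

lemma id_in_aut: "id \<in> aut H"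
  by (auto simp: aut_def bigraph_aut_def permutes_id)

lemma comp_in_aut:
  assumes H: "wf_bigraph (underlying H)" and \<sigma>: "\<sigma> \<in> aut H" and \<tau>: "\<tau> \<in> aut H"
  shows "\<sigma> \<circ> \<tau> \<in> aut H"
proof -
  have lr: "\<tau> v \<in> lverts (underlying H)" if "v \<in> lverts (underlying H)" for v
    using autD(2)[OF \<tau>] that by auto
  have rr: "\<tau> w \<in> rverts (underlying H)" if "w \<in> rverts (underlying H)" for w
    using autD(3)[OF \<tau>] that by auto
  have "coloring H (\<sigma> (\<tau> v), \<sigma> (\<tau> w)) = coloring H (v, w)" if e: "(v, w) \<in> edges (underlying H)" for v w
    using autD(4)[OF \<tau> edges_lr[OF H e]] e autD(5)[OF \<tau> e] autD(5)[OF \<sigma>, of "\<tau> v" "\<tau> w"] by simp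
  moreover have "(\<sigma> \<circ> \<tau>) ` lverts (underlying H) = lverts (underlying H)"
    "(\<sigma> \<circ> \<tau>) ` rverts (underlying H) = rverts (underlying H)"
    using autD(2,3)[OF \<sigma>] autD(2,3)[OF \<tau>] by (simp_all only: image_comp[symmetric])
  moreover have "\<sigma> \<circ> \<tau> permutes verts (underlying H)"
    using autD(1)[OF \<sigma>] autD(1)[OF \<tau>] by (rule permutes_compose[rotated])
  ultimately show ?thesis
    using autD(4)[OF \<sigma>] autD(4)[OF \<tau>] lr rr
    unfolding aut_def bigraph_aut_def by auto
qed

lemma inv_in_aut:
  assumes H: "wf_bigraph (underlying H)" and \<sigma>: "\<sigma> \<in> aut H"
  shows "inv \<sigma> \<in> aut H"
proof -
  have p: "\<sigma> permutes verts (underlying H)"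
    using autD(1)[OF \<sigma>] .
  have inv_img: "inv \<sigma> ` X = X" if "\<sigma> ` X = X" for X
    using that permutes_inj[OF p] by (metis image_inv_f_f)
  have L: "inv \<sigma> ` lverts (underlying H) = lverts (underlying H)"
    and Rr: "inv \<sigma> ` rverts (underlying H) = rverts (underlying H)"
    using inv_img autD(2,3)[OF \<sigma>] by auto
  have e: "(inv \<sigma> v, inv \<sigma> w) \<in> edges (underlying H) \<longleftrightarrow> (v, w) \<in> edges (underlying H)"
    if "v \<in> lverts (underlying H)" "w \<in> rverts (underlying H)" for v w
    using autD(4)[OF \<sigma>, of "inv \<sigma> v" "inv \<sigma> w"] that L Rr permutes_inverses[OF p] by auto
  have "coloring H (inv \<sigma> v, inv \<sigma> w) = coloring H (v, w)" if vw: "(v, w) \<in> edges (underlying H)" for v w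
    using autD(5)[OF \<sigma>, of "inv \<sigma> v" "inv \<sigma> w"] e[OF edges_lr[OF H vw]] vw permutes_inverses[OF p] by simp
  then show ?thesis
    using e L Rr permutes_inv[OF p] by (auto simp: aut_def bigraph_aut_def)
qed

lemma finite_aut:
  assumes "wf_bigraph (underlying H)"
  shows "finite (aut H)"
proof (rule finite_subset)
  show "aut H \<subseteq> {\<sigma>. \<sigma> permutes verts (underlying H)}"
    by (auto dest: autD(1))
  show "finite {\<sigma>. \<sigma> permutes verts (underlying H)}"
    using assms by (intro finite_permutations) (auto simp: verts_def wf_bigraph_finite)
qed

context holder_bigraph
begin

abbreviation "\<Gamma> \<equiv> aut H"

lemma finite_\<Gamma>: "finite \<Gamma>"
  by (rule finite_aut[OF wf])

lemma card_\<Gamma>_pos: "0 < card \<Gamma>"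
  using finite_\<Gamma> id_in_aut[of H] by (auto simp: card_gt_0_iff)

lemma \<Gamma>_inj: "\<sigma> \<in> \<Gamma> \<Longrightarrow> inj_on \<sigma> U"
  using permutes_inj[OF autD(1)] inj_on_subset by blast

lemma \<Gamma>_inverses: "\<sigma> \<in> \<Gamma> \<Longrightarrow> \<sigma> (inv \<sigma> v) = v" "\<sigma> \<in> \<Gamma> \<Longrightarrow> inv \<sigma> (\<sigma> v) = v"
  using permutes_inverses[OF autD(1)] by metis+

lemma \<Gamma>_inverse_image: "\<sigma> \<in> \<Gamma> \<Longrightarrow> \<sigma> ` inv \<sigma> ` U = U" "\<sigma> \<in> \<Gamma> \<Longrightarrow> inv \<sigma> ` \<sigma> ` U = U"
  by (auto simp: image_image \<Gamma>_inverses)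

lemma \<Gamma>_inverse_comp: "\<sigma> \<in> \<Gamma> \<Longrightarrow> \<sigma> \<circ> (inv \<sigma> \<circ> \<tau>) = \<tau>" "\<sigma> \<in> \<Gamma> \<Longrightarrow> inv \<sigma> \<circ> (\<sigma> \<circ> \<tau>) = \<tau>"
  by (auto simp: fun_eq_iff \<Gamma>_inverses)

lemma \<Gamma>_left: "\<sigma> \<in> \<Gamma> \<Longrightarrow> v \<in> V \<Longrightarrow> \<sigma> v \<in> V"
  using autD(2) by blast

lemma card_\<Gamma>_image: "\<sigma> \<in> \<Gamma> \<Longrightarrow> card (\<sigma> ` U) = card U"
  by (intro card_image \<Gamma>_inj)

section \<open>Counting by transitivity\<close>

text \<open>Orbit-stabilizer counting: the image of \<open>u\<close> splits the group into
  \<open>n\<close> classes, and composition with an automorphism taking \<open>v'\<close> to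
  \<open>v\<close> matches any two of them.\<close>

lemma card_stabilizer_coset:
  assumes u: "u \<in> V" and v: "v \<in> V"
  shows "n * card {\<tau> \<in> \<Gamma>. \<tau> u = v} = card \<Gamma>"
proof -
  have eq: "card {\<tau> \<in> \<Gamma>. \<tau> u = v'} = card {\<tau> \<in> \<Gamma>. \<tau> u = v}" if v': "v' \<in> V" for v'
  proof -
    obtain \<rho> where \<rho>: "\<rho> \<in> \<Gamma>" "\<rho> v' = v"
      using left_transitive[OF v' v] by auto
    have \<rho>': "inv \<rho> v = v'"
      using \<Gamma>_inverses(2)[OF \<rho>(1), of v'] \<rho>(2) by simp
    have "bij_betw (\<lambda>\<tau>. \<rho> \<circ> \<tau>) {\<tau> \<in> \<Gamma>. \<tau> u = v'} {\<tau> \<in> \<Gamma>. \<tau> u = v}"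
    proof (rule bij_betw_byWitness[where f' = "\<lambda>\<tau>. inv \<rho> \<circ> \<tau>"])
      show "(\<lambda>\<tau>. \<rho> \<circ> \<tau>) ` {\<tau> \<in> \<Gamma>. \<tau> u = v'} \<subseteq> {\<tau> \<in> \<Gamma>. \<tau> u = v}"
        using \<rho>(2) comp_in_aut[OF wf \<rho>(1)] by auto
      show "(\<lambda>\<tau>. inv \<rho> \<circ> \<tau>) ` {\<tau> \<in> \<Gamma>. \<tau> u = v} \<subseteq> {\<tau> \<in> \<Gamma>. \<tau> u = v'}"
        using \<rho>' comp_in_aut[OF wf inv_in_aut[OF wf \<rho>(1)]] by auto
    qed (simp_all only: \<Gamma>_inverse_comp[OF \<rho>(1)], simp_all)
    then show ?thesis
      by (rule bij_betw_same_card)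
  qed
  have "card \<Gamma> = (\<Sum>v'\<in>V. card {\<tau> \<in> \<Gamma>. \<tau> u = v'})"
    using sum.group[OF finite_\<Gamma> fin(1), of "\<lambda>\<tau>. \<tau> u" "\<lambda>_. 1::nat"] \<Gamma>_left u by (auto simp: image_subset_iff)
  also have "\<dots> = n * card {\<tau> \<in> \<Gamma>. \<tau> u = v}"
    using eq by (simp add: n_def)
  finally show ?thesis ..
qed

text \<open>Each automorphism is injective, so it sends at most one element of \<open>U\<close> to
  \<open>v\<close>; every element of \<open>U\<close> is sent there by one \<open>n\<close>-th of
  the group.\<close>

lemma card_covering:
  assumes U: "U \<subseteq> V" and v: "v \<in> V"
  shows "n * card {\<tau> \<in> \<Gamma>. v \<in> \<tau> ` U} = card U * card \<Gamma>"
proof -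
  have finU: "finite U"
    using U fin finite_subset by blast
  have "{\<tau> \<in> \<Gamma>. v \<in> \<tau> ` U} = (\<Union>u\<in>U. {\<tau> \<in> \<Gamma>. \<tau> u = v})"
    by auto
  also have "card \<dots> = (\<Sum>u\<in>U. card {\<tau> \<in> \<Gamma>. \<tau> u = v})"
    using finU finite_\<Gamma> by (intro card_UN_disjoint) (auto dest: injD[OF permutes_inj[OF autD(1)]])
  also have "n * \<dots> = (\<Sum>u\<in>U. card \<Gamma>)"
    unfolding sum_distrib_left using U v by (intro sum.cong) (auto intro: card_stabilizer_coset)
  finally show ?thesis by simp
qed

text \<open>Under a uniformly chosen automorphism the image of \<open>v\<close> is uniform on
  \<open>V\<close>, so the two geometric means agree.\<close>

lemma prod_aut_powr:
  fixes h :: "'v \<Rightarrow> real"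
  assumes v: "v \<in> V"
  shows "(\<Prod>\<tau>\<in>\<Gamma>. h (\<tau> v) powr (1 / card \<Gamma>)) = (\<Prod>u\<in>V. h u powr (1 / n))"
proof -
  have "(\<Prod>\<tau>\<in>\<Gamma>. h (\<tau> v) powr (1 / card \<Gamma>)) = (\<Prod>u\<in>V. \<Prod>\<tau>\<in>{\<tau> \<in> \<Gamma>. \<tau> v = u}. h (\<tau> v) powr (1 / card \<Gamma>))"
    using \<Gamma>_left v by (intro prod.group[symmetric] finite_\<Gamma> fin) auto
  also have "\<dots> = (\<Prod>u\<in>V. h u powr (1 / n))"
  proof (rule prod.cong[OF refl])
    fix u assume u: "u \<in> V"
    define k where "k = card {\<tau> \<in> \<Gamma>. \<tau> v = u}"
    have k: "n * k = card \<Gamma>"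
      unfolding k_def by (rule card_stabilizer_coset[OF v u])
    then have "0 < k"
      using card_\<Gamma>_pos by (cases k) auto
    have "(\<Prod>\<tau>\<in>{\<tau> \<in> \<Gamma>. \<tau> v = u}. h (\<tau> v) powr (1 / card \<Gamma>)) = (h u powr (1 / card \<Gamma>)) ^ k"
      unfolding k_def by simp
    also have "\<dots> = h u powr (1 / n)"
      using \<open>0 < k\<close> powr_power[of "h u" "1 / card \<Gamma>" k] by (cases "h u = 0") (auto simp flip: k)
    finally show "(\<Prod>\<tau>\<in>{\<tau> \<in> \<Gamma>. \<tau> v = u}. h (\<tau> v) powr (1 / card \<Gamma>)) = h u powr (1 / n)" .
  qed
  finally show ?thesis .
qed

text \<open>Consequently the orbit sum for \<open>H\<close> in the hypotheses is
  \<open>card \<Gamma>\<close> times a single count.\<close>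

lemma nbhd_count_\<Gamma>: "\<sigma> \<in> \<Gamma> \<Longrightarrow> nbhd_count (underlying H) (\<sigma> ` U) = nbhd_count (underlying H) U"
proof -
  assume \<sigma>: "\<sigma> \<in> \<Gamma>"
  have "bij_betw \<sigma> {w \<in> R. nb w = U} {w \<in> R. nb w = \<sigma> ` U}"
  proof (rule bij_betw_byWitness[where f' = "inv \<sigma>"])
    show "\<sigma> ` {w \<in> R. nb w = U} \<subseteq> {w \<in> R. nb w = \<sigma> ` U}"
      using aut_nbrs_right[OF wf \<sigma>] autD(3)[OF \<sigma>] by auto
    show "inv \<sigma> ` {w \<in> R. nb w = \<sigma> ` U} \<subseteq> {w \<in> R. nb w = U}"
    proof
      fix w assume "w \<in> inv \<sigma> ` {w \<in> R. nb w = \<sigma> ` U}"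
      then obtain w' where w': "w = inv \<sigma> w'" "w' \<in> R" "nb w' = \<sigma> ` U"
        by auto
      then have "nb w = U"
        using aut_nbrs_right[OF wf inv_in_aut[OF wf \<sigma>] w'(2)] \<Gamma>_inverse_image(2)[OF \<sigma>] by simp
      then show "w \<in> {w \<in> R. nb w = U}"
        using autD(3)[OF inv_in_aut[OF wf \<sigma>]] w' by auto
    qed
  qed (auto simp: \<Gamma>_inverses[OF \<sigma>])
  from bij_betw_same_card[OF this] show ?thesis
    by (simp add: nbhd_count_def)
qed

text \<open>Edges into \<open>w\<close> and \<open>w'\<close> have equal colors by right-uniformity
  and are hence related by an automorphism. A color therefore determines an orbit of left sets, and
  any bigraphon attached to orbits can be attached to colors.\<close>

lemma same_color_nbrs:
  assumes "w \<in> R" "w' \<in> R" "f w = f w'"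
  shows "\<exists>\<sigma>\<in>\<Gamma>. nb w' = \<sigma> ` nb w"
proof -
  have "nb w \<noteq> {}" "nb w' \<noteq> {}"
    using no_isol assms by (auto simp: no_isolated_vertices_def verts_def)
  then obtain v v' where "(v, w) \<in> E" "(v', w') \<in> E"
    using assms by (auto simp: nbrs_right[OF wf])
  then obtain \<sigma> where \<sigma>: "\<sigma> \<in> \<Gamma>" "\<sigma> w = w'"
    using cet f assms(3) unfolding color_edge_transitive_def by fastforce
  then show ?thesis
    using aut_nbrs_right[OF wf \<sigma>(1) assms(1)] by auto
qed

end

section \<open>Symmetrized multiplicities of left sets in G\<close>

locale dominating_bigraph = holder_bigraph H f
  for H :: "('v, 'c) colored_bigraph" and f +
  fixes G :: "'v bigraph"
  assumes wfG: "wf_bigraph G" and lvG: "lverts G = V" and no_isolG: "no_isolated_vertices G"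
    and count_zero: "\<And>U. U \<subseteq> V \<Longrightarrow> card U \<ge> 2 \<Longrightarrow>
           (\<Sum>\<sigma>\<in>\<Gamma>. nbhd_count G (\<sigma> ` U)) = 0 \<longleftrightarrow> (\<Sum>\<sigma>\<in>\<Gamma>. nbhd_count (underlying H) (\<sigma> ` U)) = 0"
    and count_ge: "\<And>U. U \<subseteq> V \<Longrightarrow> card U \<ge> 2 \<Longrightarrow>
           (\<Sum>\<sigma>\<in>\<Gamma>. nbhd_count G (\<sigma> ` U)) \<ge> (\<Sum>\<sigma>\<in>\<Gamma>. nbhd_count (underlying H) (\<sigma> ` U))"
begin

abbreviation "RG \<equiv> rverts G"
abbreviation "NG \<equiv> nbrs G"

definition e :: nat where "e = card (edges G)"

text \<open>The pairs themselves are kept, not just their number, since the functions on the right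
  vertices of \<open>G\<close> have to be multiplied along them.\<close>

definition pairs :: "'v set \<Rightarrow> ('v \<times> ('v \<Rightarrow> 'v)) set" where
  "pairs U = {p \<in> RG \<times> \<Gamma>. snd p ` NG (fst p) = U}"

definition D :: "'v set \<Rightarrow> nat" where "D U = card (pairs U)"

text \<open>The average of \<open>nbhd_count G\<close> over the images of \<open>U\<close>: the
  fractional multiplicity of \<open>U\<close> as a neighborhood after symmetrizing \<open>G\<close>.
  Its support is \<open>\<U>\<close>.\<close>

definition q :: "'v set \<Rightarrow> real" where "q U = D U / card \<Gamma>"

definition \<U> :: "'v set set" where "\<U> = (\<lambda>(w, \<tau>). \<tau> ` NG w) ` (RG \<times> \<Gamma>)"

lemma finG: "finite RG" "finite (edges G)"
  using wf_bigraph_finite[OF wfG] by auto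

lemma finite_pairs: "finite (pairs U)"
  unfolding pairs_def using finG finite_\<Gamma> by (auto intro: finite_subset[of _ "RG \<times> \<Gamma>"])

lemma NG_V: "w \<in> RG \<Longrightarrow> NG w \<subseteq> V"
  using nbrs_right(2)[OF wfG] lvG by simp

lemma NG_nonempty: "w \<in> RG \<Longrightarrow> NG w \<noteq> {}"
  using no_isolG by (auto simp: no_isolated_vertices_def verts_def)

lemma finite_NG: "w \<in> RG \<Longrightarrow> finite (NG w)"
  using NG_V fin finite_subset by blast

lemma finite_\<U>: "finite \<U>"
  unfolding \<U>_def using finG finite_\<Gamma> by auto

lemma \<U>_D:
  assumes "U \<in> \<U>"
  shows "U \<subseteq> V" "U \<noteq> {}" "finite U" "0 < card U" "0 < D U" "0 < q U"
proof -
  obtain w \<tau> where w: "w \<in> RG" "\<tau> \<in> \<Gamma>" "U = \<tau> ` NG w"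
    using assms by (auto simp: \<U>_def)
  show U: "U \<subseteq> V" "U \<noteq> {}"
    using w NG_V[OF w(1)] NG_nonempty[OF w(1)] \<Gamma>_left by auto
  then show "finite U"
    using fin finite_subset by blast
  then show "0 < card U"
    using U by (simp add: card_gt_0_iff)
  have "(w, \<tau>) \<in> pairs U"
    using w by (simp add: pairs_def)
  then show "0 < D U"
    using finite_pairs by (auto simp: D_def card_gt_0_iff)
  then show "0 < q U"
    using card_\<Gamma>_pos by (simp add: q_def)
qed

lemma D_pos_imp: "0 < D U \<Longrightarrow> U \<in> \<U>"
  by (fastforce simp: D_def \<U>_def pairs_def card_gt_0_iff)

text \<open>For a fixed automorphism \<tau>, the vertices paired with it are those whose
  neighborhood is the preimage of \<open>U\<close>. Since inversion permutes the group, this gives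
  the orbit sums of the hypotheses.\<close>

lemma D_eq_sum: "D U = (\<Sum>\<sigma>\<in>\<Gamma>. nbhd_count G (\<sigma> ` U))"
proof -
  have "pairs U = prod.swap ` Sigma \<Gamma> (\<lambda>\<tau>. {w \<in> RG. NG w = inv \<tau> ` U})"
  proof -
    have "\<tau> ` NG w = U \<longleftrightarrow> NG w = inv \<tau> ` U" if "\<tau> \<in> \<Gamma>" for \<tau> w
      using \<Gamma>_inverse_image[OF that] by metis
    then show ?thesis
      by (auto simp: pairs_def \<Gamma>_inverses \<Gamma>_inverse_image)
  qed
  then have "D U = card (Sigma \<Gamma> (\<lambda>\<tau>. {w \<in> RG. NG w = inv \<tau> ` U}))"
    unfolding D_def by (simp add: card_image inj_on_def)
  also have "\<dots> = (\<Sum>\<tau>\<in>\<Gamma>. nbhd_count G (inv \<tau> ` U))"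
    using finG finite_\<Gamma> by (subst card_SigmaI) (auto simp: nbhd_count_def)
  also have "\<dots> = (\<Sum>\<sigma>\<in>\<Gamma>. nbhd_count G (\<sigma> ` U))"
    by (rule sum.reindex_bij_witness[where i = inv and j = inv])
       (auto simp: inv_in_aut[OF wf] inv_inv_eq permutes_bij[OF autD(1)])
  finally show ?thesis .
qed

text \<open>Composing the second components with \<sigma> matches the pairs for \<open>U\<close>
  with those for its image and leaves the vertex of \<open>G\<close> unchanged. Everything built
  from \<open>pairs\<close> in this way depends only on the orbit.\<close>

lemma prod_pairs_\<Gamma>:
  fixes h :: "'v \<Rightarrow> real"
  assumes \<sigma>: "\<sigma> \<in> \<Gamma>"
  shows "(\<Prod>p\<in>pairs (\<sigma> ` U). h (fst p)) = (\<Prod>p\<in>pairs U. h (fst p))" "D (\<sigma> ` U) = D U"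
proof -
  have "bij_betw (\<lambda>p. (fst p, \<sigma> \<circ> snd p)) (pairs U) (pairs (\<sigma> ` U))"
  proof (rule bij_betw_byWitness[where f' = "\<lambda>p. (fst p, inv \<sigma> \<circ> snd p)"])
    show "(\<lambda>p. (fst p, \<sigma> \<circ> snd p)) ` pairs U \<subseteq> pairs (\<sigma> ` U)"
      using comp_in_aut[OF wf \<sigma>] by (auto simp: pairs_def image_comp[symmetric])
    have *: "(inv \<sigma> \<circ> \<tau>) ` X = U" if "\<tau> ` X = \<sigma> ` U" for \<tau> X
      by (simp only: image_comp[symmetric] that \<Gamma>_inverse_image[OF \<sigma>])
    have "(fst p, inv \<sigma> \<circ> snd p) \<in> pairs U" if "p \<in> pairs (\<sigma> ` U)" for p
      using that *[of "snd p" "NG (fst p)"] comp_in_aut[OF wf inv_in_aut[OF wf \<sigma>]] by (simp add: pairs_def mem_Times_iff del: image_comp)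
    then show "(\<lambda>p. (fst p, inv \<sigma> \<circ> snd p)) ` pairs (\<sigma> ` U) \<subseteq> pairs U"
      by blast
  qed (auto simp: \<Gamma>_inverse_comp[OF \<sigma>])
  then show "(\<Prod>p\<in>pairs (\<sigma> ` U). h (fst p)) = (\<Prod>p\<in>pairs U. h (fst p))" "D (\<sigma> ` U) = D U"
    using prod.reindex_bij_betw[of "\<lambda>p. (fst p, \<sigma> \<circ> snd p)" "pairs U" "pairs (\<sigma> ` U)" "\<lambda>p. h (fst p)"]
    by (simp_all add: D_def bij_betw_same_card)
qed

lemma q_\<Gamma>: "\<sigma> \<in> \<Gamma> \<Longrightarrow> q (\<sigma> ` U) = q U"
  by (simp add: q_def prod_pairs_\<Gamma>(2))

lemma \<U>_\<Gamma>: "\<sigma> \<in> \<Gamma> \<Longrightarrow> \<sigma> ` U \<in> \<U> \<longleftrightarrow> U \<in> \<U>"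
  using prod_pairs_\<Gamma>(2) D_pos_imp \<U>_D(5) by metis

text \<open>An automorphism taking \<open>u\<close> to \<open>v\<close> maps the sets through
  \<open>u\<close> onto the sets through \<open>v\<close>, and \<open>h\<close> is
  invariant.\<close>

lemma prod_containing_vertex:
  fixes h :: "'v set \<Rightarrow> real"
  assumes h: "\<And>\<sigma> U. \<sigma> \<in> \<Gamma> \<Longrightarrow> h (\<sigma> ` U) = h U" and u: "u \<in> V" and v: "v \<in> V"
  shows "(\<Prod>U\<in>{U \<in> \<U>. u \<in> U}. h U) = (\<Prod>U\<in>{U \<in> \<U>. v \<in> U}. h U)"
proof -
  obtain \<sigma> where \<sigma>: "\<sigma> \<in> \<Gamma>" "\<sigma> u = v"
    using left_transitive[OF u v] by auto
  have v': "inv \<sigma> v = u"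
    using \<sigma> \<Gamma>_inverses by auto
  show ?thesis
  proof (rule prod.reindex_bij_witness[where i = "(`) (inv \<sigma>)" and j = "(`) \<sigma>"])
    fix U assume "U \<in> {U \<in> \<U>. u \<in> U}"
    then show "inv \<sigma> ` \<sigma> ` U = U" "\<sigma> ` U \<in> {U \<in> \<U>. v \<in> U}" "h (\<sigma> ` U) = h U"
      using \<sigma> by (auto simp: \<Gamma>_inverse_image \<U>_\<Gamma> h)
  next
    fix U assume "U \<in> {U \<in> \<U>. v \<in> U}"
    moreover from this have "u \<in> inv \<sigma> ` U"
      using v' by force
    ultimately show "\<sigma> ` inv \<sigma> ` U = U" "inv \<sigma> ` U \<in> {U \<in> \<U>. u \<in> U}"
      using \<sigma> v' \<U>_\<Gamma>[OF inv_in_aut[OF wf \<sigma>(1)]] by (auto simp: \<Gamma>_inverse_image)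
  qed
qed

lemma prod_\<U>_pairs:
  "(\<Prod>U\<in>\<U>. \<Prod>p\<in>pairs U. h p) = (\<Prod>p\<in>RG \<times> \<Gamma>. h p)"
proof -
  have "(\<Prod>U\<in>\<U>. \<Prod>p\<in>{p \<in> RG \<times> \<Gamma>. snd p ` NG (fst p) = U}. h p) = (\<Prod>p\<in>RG \<times> \<Gamma>. h p)"
    using finG finite_\<Gamma> finite_\<U> by (intro prod.group) (auto simp: \<U>_def)
  then show ?thesis
    by (simp add: pairs_def)
qed

text \<open>Symmetrization preserves the number of edges: a pair contributes the degree of its
  vertex, whatever the automorphism, and the degrees sum to \<open>e\<close>.\<close>

lemma sum_card_q: "(\<Sum>U\<in>\<U>. card U * q U) = e"
proof -
  have "(\<Sum>U\<in>\<U>. real (card U * D U)) = (\<Sum>U\<in>\<U>. \<Sum>p\<in>pairs U. real (card (NG (fst p))))"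
  proof (rule sum.cong[OF refl])
    fix U
    have "card (NG (fst p)) = card U" if "p \<in> pairs U" for p
      using that card_\<Gamma>_image by (auto simp: pairs_def)
    then show "real (card U * D U) = (\<Sum>p\<in>pairs U. real (card (NG (fst p))))"
      by (simp add: D_def)
  qed
  also have "\<dots> = (\<Sum>p\<in>RG \<times> \<Gamma>. real (card (NG (fst p))))"
    unfolding pairs_def using finG finite_\<Gamma> finite_\<U> by (intro sum.group) (auto simp: \<U>_def)
  also have "\<dots> = (\<Sum>w\<in>RG. \<Sum>\<tau>\<in>\<Gamma>. real (card (NG w)))"
    by (subst sum.cartesian_product) (simp only: case_prod_unfold)
  also have "\<dots> = card \<Gamma> * (\<Sum>w\<in>RG. card (NG w))"
    by (simp add: sum_distrib_left)
  also have "(\<Sum>w\<in>RG. card (NG w)) = e"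
  proof -
    have "edges G = (\<lambda>(w, v). (v, w)) ` Sigma RG NG"
      using edges_lr[OF wfG] by (force simp: nbrs_right[OF wfG])
    then have "e = card (Sigma RG NG)"
      unfolding e_def by (simp add: card_image inj_on_def)
    then show ?thesis
      using finG finite_NG by (subst (asm) card_SigmaI) auto
  qed
  finally show ?thesis
    using card_\<Gamma>_pos by (simp add: q_def sum_divide_distrib[symmetric] field_simps)
qed

text \<open>The fractional degree of \<open>v\<close> is the same for all left vertices, so it is
  the average degree. It makes \<open>q U * n / e\<close>, over the sets through \<open>v\<close>, a
  system of Hoelder weights.\<close>

lemma sum_q_containing:
  assumes v: "v \<in> V"
  shows "(\<Sum>U\<in>{U \<in> \<U>. v \<in> U}. q U) = e / n"
proof -
  have eq: "(\<Sum>U\<in>{U \<in> \<U>. u \<in> U}. q U) = (\<Sum>U\<in>{U \<in> \<U>. v \<in> U}. q U)" if u: "u \<in> V" for u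
  proof -
    \<comment> \<open>Exponentials turn the sum into a product, so that the invariance lemma for
      products applies.\<close>
    have "exp (\<Sum>U\<in>{U \<in> \<U>. u \<in> U}. q U) = exp (\<Sum>U\<in>{U \<in> \<U>. v \<in> U}. q U)"
      using prod_containing_vertex[of "\<lambda>U. exp (q U)" u v] u v finite_\<U> by (simp add: q_\<Gamma> exp_sum)
    then show ?thesis by simp
  qed
  have "n * (\<Sum>U\<in>{U \<in> \<U>. v \<in> U}. q U) = (\<Sum>u\<in>V. \<Sum>U\<in>{U \<in> \<U>. u \<in> U}. q U)"
    using eq by (simp add: n_def)
  also have "\<dots> = (\<Sum>u\<in>V. \<Sum>U\<in>\<U>. if u \<in> U then q U else 0)"
    using finite_\<U> by (simp add: sum.inter_filter)
  also have "\<dots> = (\<Sum>U\<in>\<U>. \<Sum>u\<in>V. if u \<in> U then q U else 0)"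
    by (rule sum.swap)
  also have "\<dots> = (\<Sum>U\<in>\<U>. card U * q U)"
  proof (rule sum.cong[OF refl])
    fix U assume "U \<in> \<U>"
    then have "{u \<in> V. u \<in> U} = U"
      using \<U>_D(1) by auto
    then show "(\<Sum>u\<in>V. if u \<in> U then q U else 0) = card U * q U"
      using fin by (simp flip: sum.inter_filter)
  qed
  finally show ?thesis
    using n_pos by (simp add: sum_card_q field_simps)
qed

lemma n_le_e: "n \<le> e"
proof -
  have "V \<subseteq> fst ` edges G"
  proof
    fix v assume v: "v \<in> V"
    then have "NG v \<noteq> {}"
      using no_isolG lvG by (auto simp: no_isolated_vertices_def verts_def)
    then show "v \<in> fst ` edges G"
      using nbrs_left(1)[OF wfG] v lvG by force
  qed
  then show ?thesis
    unfolding n_def e_def using finG by (meson card_image_le card_mono finite_imageI order.trans)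
qed

text \<open>Condition (ii) enters here; it makes the exponents \<open>q U / nbhd_count\<close> at
  least 1.\<close>

lemma nbhd_count_le_q:
  assumes "w \<in> R" "2 \<le> card (nb w)"
  shows "nb w \<in> \<U>" "real (nbhd_count (underlying H) (nb w)) \<le> q (nb w)" "0 < nbhd_count (underlying H) (nb w)"
proof -
  have sub: "nb w \<subseteq> V"
    using nbrs_right(2)[OF wf assms(1)] .
  show pos: "0 < nbhd_count (underlying H) (nb w)"
    using fin assms by (auto simp: nbhd_count_def card_gt_0_iff)
  have "card \<Gamma> * nbhd_count (underlying H) (nb w) \<le> D (nb w)"
    using count_ge[OF sub assms(2)] by (simp add: D_eq_sum nbhd_count_\<Gamma>)
  moreover from this have "0 < D (nb w)"
    using pos card_\<Gamma>_pos by (metis less_le_trans nat_0_less_mult_iff)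
  ultimately show "nb w \<in> \<U>" "real (nbhd_count (underlying H) (nb w)) \<le> q (nb w)"
    using D_pos_imp card_\<Gamma>_pos by (auto simp: q_def field_simps simp flip: of_nat_mult)
qed

text \<open>Condition (i) enters here; it ensures that each such \<open>U\<close> is a neighborhood
  in \<open>H\<close>, so its factor can be realized on right vertices of \<open>H\<close>.\<close>

lemma nbhd_count_pos:
  assumes "U \<in> \<U>" "2 \<le> card U"
  shows "0 < nbhd_count (underlying H) U"
  using count_zero[OF \<U>_D(1)[OF assms(1)] assms(2)] \<U>_D(5)[OF assms(1)] finite_\<Gamma>
  by (auto simp: D_eq_sum nbhd_count_\<Gamma>)

end

section \<open>The Sidorenko inequality\<close>

locale dominating_weights = dominating_bigraph H f G
  for H :: "('v, 'c) colored_bigraph" and f and G +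
  fixes M :: "'x measure" and N :: "'y measure" and W :: "'x \<times> 'y \<Rightarrow> real"
    and F :: "'v \<Rightarrow> 'x \<Rightarrow> real" and g :: "'v \<Rightarrow> 'y \<Rightarrow> real"
  assumes M: "prob_space M" and N: "prob_space N" and W: "bnm (M \<Otimes>\<^sub>M N) W"
    and F: "\<And>v. v \<in> V \<Longrightarrow> bnm M (F v)" and g: "\<And>w. w \<in> RG \<Longrightarrow> bnm N (g w)"
begin

abbreviation "PV \<equiv> \<Pi>\<^sub>M v\<in>V. M"

text \<open>The geometric mean of the functions of all right vertices of \<open>G\<close> that are
  carried to \<open>U\<close>, with multiplicity.\<close>

definition gU :: "'v set \<Rightarrow> 'y \<Rightarrow> real" where
  "gU U y = (\<Prod>p\<in>pairs U. g (fst p) y powr (1 / D U))"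

text \<open>The weight \<open>gU U\<close> is split evenly over the \<open>card U\<close> edges at a
  right vertex with neighborhood \<open>U\<close>; \<open>\<kappa> U\<close> integrates the factor
  of a single edge and will be the normalizing constant.\<close>

definition \<kappa> :: "'v set \<Rightarrow> 'x \<Rightarrow> real" where
  "\<kappa> U x = (\<integral>y. W (x, y) * gU U y powr (1 / card U) \<partial>N)"

definition T :: "'v set \<Rightarrow> ('v \<Rightarrow> 'x) \<Rightarrow> real" where
  "T U x = (\<integral>y. gU U y * (\<Prod>v\<in>U. W (x v, y)) \<partial>N)"

definition F0 :: "'x \<Rightarrow> real" where
  "F0 a = (\<Prod>v\<in>V. F v a powr (1 / n))"

definition \<Phi> :: real where
  "\<Phi> = (\<integral>x. (\<Prod>v\<in>V. F v (x v)) * (\<Prod>w\<in>RG. \<integral>y. g w y * (\<Prod>v\<in>NG w. W (x v, y)) \<partial>N) \<partial>PV)"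

definition \<Psi> :: real where
  "\<Psi> = (\<integral>x. (\<Prod>v\<in>V. F0 (x v)) * (\<Prod>U\<in>\<U>. T U x powr q U) \<partial>PV)"

lemma prob_PV: "prob_space PV"
  by (intro prob_space_PiM M)

lemma bnm_W_right: "x \<in> space M \<Longrightarrow> bnm N (\<lambda>y. W (x, y))"
  by (rule bnm_compose[OF W]) measurable

lemma bnm_gU: "bnm N (gU U)"
  unfolding gU_def[abs_def] by (intro bnm_prod bnm_powr g) (auto simp: pairs_def)

lemma bnm_\<kappa>: "bnm M (\<kappa> U)"
proof -
  have "bnm (M \<Otimes>\<^sub>M N) (\<lambda>z. W z * gU U (snd z) powr (1 / card U))"
    by (intro bnm_mult W bnm_powr bnm_compose[OF bnm_gU]) auto
  from bnm_integral[OF N this] show ?thesis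
    by (simp add: \<kappa>_def[abs_def])
qed

lemma bnm_weighted_right:
  assumes "bnm N b" "U \<subseteq> V"
  shows "bnm PV (\<lambda>x. \<integral>y. b y * (\<Prod>v\<in>U. W (x v, y)) \<partial>N)"
proof -
  have "bnm (PV \<Otimes>\<^sub>M N) (\<lambda>z. b (snd z) * (\<Prod>v\<in>U. W (fst z v, snd z)))"
    by (intro bnm_mult bnm_prod_component[OF assms(2)] W bnm_compose[OF assms(1)]) auto
  from bnm_integral[OF N this] show ?thesis by simp
qed

lemma bnm_T: "U \<subseteq> V \<Longrightarrow> bnm PV (T U)"
  unfolding T_def[abs_def] by (rule bnm_weighted_right[OF bnm_gU])

lemma bnm_F0: "bnm M F0"
  unfolding F0_def[abs_def] by (intro bnm_prod bnm_powr F) auto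

lemma gU_\<Gamma>: "\<sigma> \<in> \<Gamma> \<Longrightarrow> gU (\<sigma> ` U) = gU U"
  using prod_pairs_\<Gamma>(1)[of \<sigma> "\<lambda>w. g w _ powr (1 / D U)" U] by (simp add: gU_def fun_eq_iff prod_pairs_\<Gamma>(2))

lemma \<kappa>_\<Gamma>: "\<sigma> \<in> \<Gamma> \<Longrightarrow> \<kappa> (\<sigma> ` U) = \<kappa> U"
  by (simp add: \<kappa>_def fun_eq_iff gU_\<Gamma> card_\<Gamma>_image)

text \<open>The integrand of \<open>T U\<close> is the geometric mean of \<open>D U\<close>
  functions, one for each pair. Hoelder's inequality gives exponents \<open>1 / D U\<close>, which
  the power \<open>q U\<close> turns into \<open>1 / card \<Gamma>\<close>.\<close>

lemma T_le_prod:
  assumes U: "U \<in> \<U>" and x: "x \<in> space PV"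
  shows "T U x powr q U \<le> (\<Prod>p\<in>pairs U. (\<integral>y. g (fst p) y * (\<Prod>u\<in>U. W (x u, y)) \<partial>N) powr (1 / card \<Gamma>))"
proof -
  interpret N: prob_space N by (rule N)
  let ?h = "\<lambda>p y. g (fst p) y * (\<Prod>u\<in>U. W (x u, y))"
  have RG: "fst p \<in> RG" if "p \<in> pairs U" for p
    using that by (auto simp: pairs_def)
  have xu: "x u \<in> space M" if "u \<in> U" for u
    using space_PiM_component[OF x] \<U>_D(1)[OF U] that by auto
  have PW: "bnm N (\<lambda>y. \<Prod>u\<in>U. W (x u, y))"
    by (intro bnm_prod bnm_W_right xu)
  have h: "bnm N (?h p)" if "p \<in> pairs U" for p
    by (intro bnm_mult g RG that PW)
  have D: "0 < D U"
    by (rule \<U>_D(5)[OF U])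
  have "T U x = (\<integral>y. (\<Prod>p\<in>pairs U. ?h p y powr (1 / D U)) \<partial>N)"
    unfolding T_def
  proof (rule Bochner_Integration.integral_cong[OF refl])
    fix y assume y: "y \<in> space N"
    have P0: "0 \<le> (\<Prod>u\<in>U. W (x u, y))"
      using bnm_nonneg[OF PW y] .
    have "(\<Prod>p\<in>pairs U. ?h p y powr (1 / D U))
        = (\<Prod>p\<in>pairs U. g (fst p) y powr (1 / D U) * (\<Prod>u\<in>U. W (x u, y)) powr (1 / D U))"
      by (intro prod.cong refl powr_mult)
    also have "\<dots> = gU U y * ((\<Prod>u\<in>U. W (x u, y)) powr (1 / D U)) ^ D U"
      by (simp add: prod.distrib gU_def flip: D_def)
    also have "((\<Prod>u\<in>U. W (x u, y)) powr (1 / D U)) ^ D U = (\<Prod>u\<in>U. W (x u, y))"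
      using D P0 powr_power[of "\<Prod>u\<in>U. W (x u, y)" "1 / D U" "D U"]
      by (cases "(\<Prod>u\<in>U. W (x u, y)) = 0") auto
    finally show "gU U y * (\<Prod>v\<in>U. W (x v, y)) = (\<Prod>p\<in>pairs U. ?h p y powr (1 / D U))" ..
  qed
  also have "\<dots> \<le> (\<Prod>p\<in>pairs U. (\<integral>y. ?h p y \<partial>N) powr (1 / D U))"
    using finite_pairs D h by (intro N.holder_prod) (auto simp flip: D_def)
  finally have "T U x powr q U \<le> (\<Prod>p\<in>pairs U. (\<integral>y. ?h p y \<partial>N) powr (1 / D U)) powr q U"
    using \<U>_D(1,6)[OF U] bnm_nonneg[OF bnm_T x] by (intro powr_mono2) auto
  also have "\<dots> = (\<Prod>p\<in>pairs U. (\<integral>y. ?h p y \<partial>N) powr (1 / D U * q U))"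
    by (simp add: prod_powr_distrib powr_powr)
  also have "1 / D U * q U = 1 / card \<Gamma>"
    using D by (simp add: q_def)
  finally show ?thesis .
qed

text \<open>Symmetrization: by Hoelder's inequality \<open>\<Phi>\<close> is at least the integral of the geometric mean of
  its integrand over all relabelings of the left variables by \<open>aut H\<close>.\<close>

lemma \<Psi>_le_\<Phi>: "\<Psi> \<le> \<Phi>"
proof -
  interpret PV: prob_space PV by (rule prob_PV)
  interpret N: prob_space N by (rule N)
  \<comment> \<open>Relabeling the left coordinates by an automorphism preserves the product
    measure, so each of the \<open>card \<Gamma>\<close> integrals in the Hoelder step equals
    \<Phi>.\<close>
  define r where "r \<tau> x = (\<lambda>v\<in>V. x (\<tau> v))" for \<tau> and x :: "'v \<Rightarrow> 'x"
  define I where "I x = (\<Prod>v\<in>V. F v (x v)) * (\<Prod>w\<in>RG. \<integral>y. g w y * (\<Prod>v\<in>NG w. W (x v, y)) \<partial>N)" for x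
  define L where "L p x = (\<integral>y. g (fst p) y * (\<Prod>u\<in>snd p ` NG (fst p). W (x u, y)) \<partial>N)"
    for p and x :: "'v \<Rightarrow> 'x"
  have bI: "bnm PV I"
    unfolding I_def[abs_def]
    by (intro bnm_mult bnm_prod bnm_PiM_component bnm_weighted_right F g NG_V)
  have mr: "r \<tau> \<in> measurable PV PV" if "\<tau> \<in> \<Gamma>" for \<tau>
    unfolding r_def[abs_def] using \<Gamma>_left[OF that] by measurable
  have bIr: "bnm PV (\<lambda>x. I (r \<tau> x))" if "\<tau> \<in> \<Gamma>" for \<tau>
    by (rule bnm_compose[OF bI mr[OF that]])
  have \<Phi>r: "(\<integral>x. I (r \<tau> x) \<partial>PV) = \<Phi>" if \<tau>: "\<tau> \<in> \<Gamma>" for \<tau>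
  proof -
    have "distr PV PV (r \<tau>) = PV"
      unfolding r_def[abs_def] using distr_PiM_reindex[of V "\<lambda>_. M" \<tau> V] M \<Gamma>_inj[OF \<tau>] \<Gamma>_left[OF \<tau>] by auto
    then have "\<Phi> = (\<integral>x. I x \<partial>distr PV PV (r \<tau>))"
      by (simp add: \<Phi>_def I_def)
    also have "\<dots> = (\<integral>x. I (r \<tau> x) \<partial>PV)"
      by (rule integral_distr[OF mr[OF \<tau>] bnm_measurable[OF bI]])
    finally show ?thesis ..
  qed
  have L: "0 \<le> L p x" if "x \<in> space PV" "p \<in> RG \<times> \<Gamma>" for p x
  proof -
    have p: "fst p \<in> RG" "snd p \<in> \<Gamma>"
      using that by auto
    have "snd p ` NG (fst p) \<subseteq> V"
      using NG_V[OF p(1)] \<Gamma>_left[OF p(2)] by blast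
    then have "bnm PV (L p)"
      unfolding L_def[abs_def] using that by (intro bnm_weighted_right g) auto
    from bnm_nonneg[OF this that(1)] show ?thesis .
  qed
  have Ir: "I (r \<tau> x) = (\<Prod>v\<in>V. F v (x (\<tau> v))) * (\<Prod>w\<in>RG. L (w, \<tau>) x)" if \<tau>: "\<tau> \<in> \<Gamma>" for \<tau> x
  proof -
    have "(\<Prod>v\<in>NG w. W (r \<tau> x v, y)) = (\<Prod>u\<in>\<tau> ` NG w. W (x u, y))" if w: "w \<in> RG" for w y
      using NG_V[OF w] by (subst prod.reindex[OF \<Gamma>_inj[OF \<tau>]]) (auto simp: r_def intro!: prod.cong)
    then show ?thesis
      by (simp add: I_def L_def) (simp add: r_def)
  qed
  have ptw: "(\<Prod>v\<in>V. F0 (x v)) * (\<Prod>U\<in>\<U>. T U x powr q U) \<le> (\<Prod>\<tau>\<in>\<Gamma>. I (r \<tau> x) powr (1 / card \<Gamma>))"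
    if x: "x \<in> space PV" for x
  proof -
    have Fnn: "0 \<le> F v (x u)" if "v \<in> V" "u \<in> V" for u v
      using bnm_nonneg[OF F[OF that(1)] space_PiM_component[OF x that(2)]] .
    have "(\<Prod>\<tau>\<in>\<Gamma>. I (r \<tau> x) powr (1 / card \<Gamma>)) =
        (\<Prod>\<tau>\<in>\<Gamma>. (\<Prod>v\<in>V. F v (x (\<tau> v)) powr (1 / card \<Gamma>)) * (\<Prod>w\<in>RG. L (w, \<tau>) x powr (1 / card \<Gamma>)))"
      using L[OF x] \<Gamma>_left Fnn
      by (intro prod.cong refl) (simp add: Ir powr_mult prod_powr_distrib prod_nonneg)
    also have "\<dots> = (\<Prod>\<tau>\<in>\<Gamma>. \<Prod>v\<in>V. F v (x (\<tau> v)) powr (1 / card \<Gamma>)) *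
        (\<Prod>\<tau>\<in>\<Gamma>. \<Prod>w\<in>RG. L (w, \<tau>) x powr (1 / card \<Gamma>))"
      by (rule prod.distrib)
    also have "(\<Prod>\<tau>\<in>\<Gamma>. \<Prod>v\<in>V. F v (x (\<tau> v)) powr (1 / card \<Gamma>)) = (\<Prod>v\<in>V. \<Prod>u\<in>V. F v (x u) powr (1 / n))"
      by (subst prod.swap) (intro prod.cong refl prod_aut_powr)
    also have "\<dots> = (\<Prod>u\<in>V. F0 (x u))"
      unfolding F0_def by (rule prod.swap)
    also have "(\<Prod>\<tau>\<in>\<Gamma>. \<Prod>w\<in>RG. L (w, \<tau>) x powr (1 / card \<Gamma>)) = (\<Prod>p\<in>RG \<times> \<Gamma>. L p x powr (1 / card \<Gamma>))"
      by (subst prod.swap) (simp add: prod.cartesian_product case_prod_unfold)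
    also have "\<dots> = (\<Prod>U\<in>\<U>. \<Prod>p\<in>pairs U. L p x powr (1 / card \<Gamma>))"
      by (rule prod_\<U>_pairs[symmetric])
    also have "(\<Prod>u\<in>V. F0 (x u)) * \<dots> \<ge> (\<Prod>v\<in>V. F0 (x v)) * (\<Prod>U\<in>\<U>. T U x powr q U)"
    proof (intro mult_left_mono prod_mono conjI prod_nonneg)
      fix U assume U: "U \<in> \<U>"
      have "(\<Prod>p\<in>pairs U. L p x powr (1 / card \<Gamma>)) =
          (\<Prod>p\<in>pairs U. (\<integral>y. g (fst p) y * (\<Prod>u\<in>U. W (x u, y)) \<partial>N) powr (1 / card \<Gamma>))"
        by (intro prod.cong refl) (simp add: L_def pairs_def)
      then show "T U x powr q U \<le> (\<Prod>p\<in>pairs U. L p x powr (1 / card \<Gamma>))"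
        using T_le_prod[OF U x] by simp
    qed (auto intro: bnm_nonneg[OF bnm_F0 space_PiM_component[OF x]])
    finally show ?thesis .
  qed
  have "\<Psi> \<le> (\<integral>x. (\<Prod>\<tau>\<in>\<Gamma>. I (r \<tau> x) powr (1 / card \<Gamma>)) \<partial>PV)"
    unfolding \<Psi>_def using ptw
    by (intro PV.bnm_integral_mono bnm_mult bnm_prod bnm_powr bnm_PiM_component bnm_F0 bnm_T bIr)
       (auto simp: \<U>_D(1) less_imp_le[OF \<U>_D(6)])
  also have "\<dots> \<le> (\<Prod>\<tau>\<in>\<Gamma>. (\<integral>x. I (r \<tau> x) \<partial>PV) powr (1 / card \<Gamma>))"
    using card_\<Gamma>_pos by (intro PV.holder_prod finite_\<Gamma> bIr) auto
  also have "\<dots> = (\<Phi> powr (1 / card \<Gamma>)) ^ card \<Gamma>"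
    by (simp add: \<Phi>r)
  also have "\<dots> = \<Phi>"
  proof -
    have "0 \<le> \<Phi>"
      using PV.bnm_integral_nonneg[OF bI] by (simp add: \<Phi>_def I_def)
    then show ?thesis
      using card_\<Gamma>_pos powr_power[of \<Phi> "1 / card \<Gamma>" "card \<Gamma>"] by (cases "\<Phi> = 0") auto
  qed
  finally show ?thesis .
qed

section \<open>Normalization, and truncation where the normalizing integrals are small\<close>

text \<open>The normalizing factors that belong to the left vertex \<open>v\<close>, with their
  multiplicities, times the averaged left weight. By transitivity the result does not depend on
  \<open>v\<close>.\<close>

definition A :: "'v \<Rightarrow> 'x \<Rightarrow> real" where
  "A v a = F0 a * (\<Prod>U\<in>{U \<in> \<U>. v \<in> U}. \<kappa> U a powr q U)"

lemma bnm_A: "bnm M (A v)"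
  unfolding A_def[abs_def]
  by (intro bnm_mult bnm_F0 bnm_prod bnm_powr bnm_\<kappa>) (auto intro: less_imp_le[OF \<U>_D(6)])

lemma A_eq: "u \<in> V \<Longrightarrow> v \<in> V \<Longrightarrow> A u = A v"
  using prod_containing_vertex[of "\<lambda>U. \<kappa> U _ powr q U" u v] by (simp add: A_def fun_eq_iff \<kappa>_\<Gamma> q_\<Gamma>)

text \<open>At such points division by \<open>\<kappa> U\<close> keeps the functions bounded, as a
  bigraphon requires.\<close>

definition good :: "real \<Rightarrow> 'x \<Rightarrow> bool" where
  "good \<epsilon> a \<longleftrightarrow> (\<forall>U\<in>\<U>. \<epsilon> \<le> \<kappa> U a)"

lemma good_sets: "{a \<in> space M. good \<epsilon> a} \<in> sets M"
proof -
  note bnm_measurable[OF bnm_\<kappa>, measurable]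
  note finite_\<U>[simp]
  show ?thesis
    unfolding good_def by (intro sets.sets_Collect_finite_All) auto
qed

text \<open>The normalized factor of one edge. The default 1 is bounded and integrates to 1; it is
  used at truncated points and for sets of size one, for which the integral of the normalized factor
  would be 1 anyway.\<close>

definition SU :: "real \<Rightarrow> 'v set \<Rightarrow> 'x \<times> 'y \<Rightarrow> real" where
  "SU \<epsilon> U z = (if good \<epsilon> (fst z) \<and> U \<in> \<U> \<and> 2 \<le> card U
     then W z * gU U (snd z) powr (1 / card U) / \<kappa> U (fst z) else 1)"

lemma SU_\<Gamma>: "\<sigma> \<in> \<Gamma> \<Longrightarrow> SU \<epsilon> (\<sigma> ` U) = SU \<epsilon> U"
  by (intro ext) (simp only: SU_def gU_\<Gamma> \<kappa>_\<Gamma> card_\<Gamma>_image \<U>_\<Gamma>)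

lemma bnm_SU:
  assumes \<epsilon>: "0 < \<epsilon>"
  shows "bnm (M \<Otimes>\<^sub>M N) (SU \<epsilon> U)"
proof (cases "U \<in> \<U> \<and> 2 \<le> card U")
  case True
  define k where "k a = (if good \<epsilon> a then \<kappa> U a else 1)" for a
  have bk: "bnm M (\<lambda>a. 1 / k a)"
  proof (rule bnm_inverse)
    show "bnm M k"
      unfolding k_def[abs_def] by (intro bnm_if good_sets bnm_\<kappa> bnm_const) simp
    show "0 < min \<epsilon> 1" "\<And>a. min \<epsilon> 1 \<le> k a"
      using \<epsilon> True by (auto simp: k_def good_def min_le_iff_disj)
  qed
  have "{z \<in> space (M \<Otimes>\<^sub>M N). good \<epsilon> (fst z)} = fst -` {a \<in> space M. good \<epsilon> a} \<inter> space (M \<Otimes>\<^sub>M N)"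
    by (auto simp: space_pair_measure)
  then have sets: "{z \<in> space (M \<Otimes>\<^sub>M N). good \<epsilon> (fst z)} \<in> sets (M \<Otimes>\<^sub>M N)"
    using measurable_sets[OF measurable_fst good_sets] by metis
  have "SU \<epsilon> U = (\<lambda>z. if good \<epsilon> (fst z) then W z * gU U (snd z) powr (1 / card U) * (1 / k (fst z)) else 1)"
    using True by (auto simp: SU_def k_def)
  moreover have "bnm (M \<Otimes>\<^sub>M N) \<dots>"
    by (intro bnm_if sets bnm_mult W bnm_powr bnm_compose[OF bnm_gU] bnm_compose[OF bk] bnm_const) auto
  ultimately show ?thesis by simp
next
  case False
  then have "SU \<epsilon> U = (\<lambda>_. 1)"
    by (auto simp: SU_def)
  then show ?thesis
    by (simp add: bnm_const)
qed

lemma SU_normalized: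
  assumes "good \<epsilon> a" "0 < \<epsilon>"
  shows "(\<integral>y. SU \<epsilon> U (a, y) \<partial>N) = 1"
proof (cases "U \<in> \<U> \<and> 2 \<le> card U")
  case True
  then have "0 < \<kappa> U a"
    using assms by (auto simp: good_def intro: less_le_trans)
  moreover have "(\<integral>y. SU \<epsilon> U (a, y) \<partial>N) = (\<integral>y. W (a, y) * gU U y powr (1 / card U) \<partial>N) / \<kappa> U a"
    using True assms by (simp add: SU_def)
  ultimately show ?thesis
    by (simp add: \<kappa>_def)
next
  case False
  interpret N: prob_space N by (rule N)
  show ?thesis
    using False by (auto simp: SU_def N.prob_space)
qed

definition rU :: "'v set \<Rightarrow> ('v \<Rightarrow> 'x) \<Rightarrow> real" where
  "rU U x = T U x / (\<Prod>v\<in>U. \<kappa> U (x v))"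

lemma gU_nonneg: "0 \<le> gU U y"
  by (simp add: gU_def prod_nonneg)

lemma gU_split:
  assumes "U \<in> \<U>"
  shows "(\<Prod>v\<in>U. gU U y powr (1 / card U)) = gU U y"
  using \<U>_D(4)[OF assms] gU_nonneg[of U y] powr_power[of "gU U y" "1 / card U" "card U"]
  by (cases "gU U y = 0") auto

lemma SU_integral:
  assumes U: "U \<in> \<U>" "2 \<le> card U" and good: "\<And>v. v \<in> U \<Longrightarrow> good \<epsilon> (x v)"
  shows "(\<integral>y. (\<Prod>v\<in>U. SU \<epsilon> U (x v, y)) \<partial>N) = rU U x"
proof -
  have "(\<Prod>v\<in>U. SU \<epsilon> U (x v, y)) = gU U y * (\<Prod>v\<in>U. W (x v, y)) / (\<Prod>v\<in>U. \<kappa> U (x v))" for y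
  proof -
    have "(\<Prod>v\<in>U. SU \<epsilon> U (x v, y)) = (\<Prod>v\<in>U. W (x v, y) * gU U y powr (1 / card U) / \<kappa> U (x v))"
      using U good by (intro prod.cong) (auto simp: SU_def)
    also have "\<dots> = (\<Prod>v\<in>U. W (x v, y)) * (\<Prod>v\<in>U. gU U y powr (1 / card U)) / (\<Prod>v\<in>U. \<kappa> U (x v))"
      by (simp only: prod.distrib prod_dividef)
    finally show ?thesis
      using gU_split[OF U(1)] by (simp add: mult.commute)
  qed
  then show ?thesis
    by (simp add: rU_def T_def)
qed

text \<open>For \<open>U = {v}\<close> the integrals \<open>T U\<close> and
  \<open>\<kappa> U\<close> coincide, so sets of size one drop out after normalization.\<close>

lemma rU_singleton:
  assumes U: "U \<in> \<U>" "card U < 2" and pos: "\<And>v. v \<in> U \<Longrightarrow> 0 < \<kappa> U (x v)"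
  shows "rU U x = 1"
proof -
  have "card U = 1"
    using \<U>_D(4)[OF U(1)] U(2) by simp
  then obtain v where v: "U = {v}"
    by (auto simp: card_1_singleton_iff)
  have "T U x = \<kappa> U (x v)"
    using gU_nonneg by (simp add: T_def \<kappa>_def v mult.commute)
  then show ?thesis
    using pos[of v] by (simp add: rU_def v)
qed

text \<open>Group the right vertices of \<open>H\<close> by neighborhood: \<open>U\<close> occurs
  \<open>nbhd_count\<close> times, each time with the same share of the exponent
  \<open>q U\<close>.\<close>

lemma prod_nbhd_classes:
  fixes h :: "'v set \<Rightarrow> real"
  assumes "\<And>U. U \<in> \<U> \<Longrightarrow> 0 \<le> h U"
  shows "(\<Prod>w\<in>{w \<in> R. 2 \<le> card (nb w)}. h (nb w) powr (q (nb w) / nbhd_count (underlying H) (nb w)))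
    = (\<Prod>U\<in>{U \<in> \<U>. 2 \<le> card U}. h U powr q U)"
proof -
  let ?R = "{w \<in> R. 2 \<le> card (nb w)}" and ?m = "nbhd_count (underlying H)"
  have "(\<Prod>w\<in>?R. h (nb w) powr (q (nb w) / ?m (nb w)))
      = (\<Prod>U\<in>{U \<in> \<U>. 2 \<le> card U}. \<Prod>w\<in>{w \<in> ?R. nb w = U}. h (nb w) powr (q (nb w) / ?m (nb w)))"
    using fin finite_\<U> nbhd_count_le_q(1) by (intro prod.group[symmetric]) auto
  also have "\<dots> = (\<Prod>U\<in>{U \<in> \<U>. 2 \<le> card U}. h U powr q U)"
  proof (rule prod.cong[OF refl])
    fix U assume U: "U \<in> {U \<in> \<U>. 2 \<le> card U}"
    then have m: "0 < ?m U"
      using nbhd_count_pos by auto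
    have "{w \<in> ?R. nb w = U} = {w \<in> R. nb w = U}"
      using U by auto
    then have "(\<Prod>w\<in>{w \<in> ?R. nb w = U}. h (nb w) powr (q (nb w) / ?m (nb w))) = (h U powr (q U / ?m U)) ^ ?m U"
      by (simp add: nbhd_count_def)
    also have "\<dots> = h U powr q U"
      using m powr_power[of "h U" "q U / ?m U" "?m U"] by (cases "h U = 0") auto
    finally show "(\<Prod>w\<in>{w \<in> ?R. nb w = U}. h (nb w) powr (q (nb w) / ?m (nb w))) = h U powr q U" .
  qed
  finally show ?thesis .
qed

text \<open>The normalization is undone: dividing \<open>T U\<close> by the
  \<open>\<kappa> U (x v)\<close> for \<open>v \<in> U\<close> removes exactly the powers collected
  in \<open>A v (x v)\<close>, and \<open>A u\<close> may be read as \<open>A v\<close> at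
  coordinate \<open>v\<close>.\<close>

lemma prod_A_rU:
  assumes x: "x \<in> space PV" and u: "u \<in> V" and pos: "\<And>U v. U \<in> \<U> \<Longrightarrow> v \<in> V \<Longrightarrow> 0 < \<kappa> U (x v)"
  shows "(\<Prod>v\<in>V. A u (x v)) * (\<Prod>U\<in>\<U>. rU U x powr q U) = (\<Prod>v\<in>V. F0 (x v)) * (\<Prod>U\<in>\<U>. T U x powr q U)"
proof -
  have "(\<Prod>v\<in>V. A u (x v)) = (\<Prod>v\<in>V. F0 (x v) * (\<Prod>U\<in>{U \<in> \<U>. v \<in> U}. \<kappa> U (x v) powr q U))"
    using A_eq[OF u] by (intro prod.cong refl) (metis A_def)
  also have "\<dots> = (\<Prod>v\<in>V. F0 (x v)) * (\<Prod>v\<in>V. \<Prod>U\<in>\<U>. if v \<in> U then \<kappa> U (x v) powr q U else 1)"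
    using finite_\<U> by (simp add: prod.distrib prod.inter_filter)
  also have "(\<Prod>v\<in>V. \<Prod>U\<in>\<U>. if v \<in> U then \<kappa> U (x v) powr q U else 1) =
      (\<Prod>U\<in>\<U>. (\<Prod>v\<in>U. \<kappa> U (x v)) powr q U)"
  proof (subst prod.swap, rule prod.cong[OF refl])
    fix U assume U: "U \<in> \<U>"
    then have "{v \<in> V. v \<in> U} = U"
      using \<U>_D(1) by auto
    then have "(\<Prod>v\<in>V. if v \<in> U then \<kappa> U (x v) powr q U else 1) = (\<Prod>v\<in>U. \<kappa> U (x v) powr q U)"
      using fin by (simp flip: prod.inter_filter)
    also have "\<dots> = (\<Prod>v\<in>U. \<kappa> U (x v)) powr q U"
      by (rule prod_powr_distrib[symmetric])
    finally show "(\<Prod>v\<in>V. if v \<in> U then \<kappa> U (x v) powr q U else 1) = (\<Prod>v\<in>U. \<kappa> U (x v)) powr q U" .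
  qed
  finally have "(\<Prod>v\<in>V. A u (x v)) * (\<Prod>U\<in>\<U>. rU U x powr q U) =
      (\<Prod>v\<in>V. F0 (x v)) * (\<Prod>U\<in>\<U>. (\<Prod>v\<in>U. \<kappa> U (x v)) powr q U * rU U x powr q U)"
    by (simp add: prod.distrib)
  also have "(\<Prod>U\<in>\<U>. (\<Prod>v\<in>U. \<kappa> U (x v)) powr q U * rU U x powr q U) = (\<Prod>U\<in>\<U>. T U x powr q U)"
  proof (rule prod.cong[OF refl])
    fix U assume U: "U \<in> \<U>"
    have "0 < (\<Prod>v\<in>U. \<kappa> U (x v))"
      using pos[OF U] \<U>_D(1)[OF U] by (intro prod_pos) auto
    moreover have "0 \<le> T U x"
      using bnm_nonneg[OF bnm_T[OF \<U>_D(1)[OF U]] x] .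
    ultimately show "(\<Prod>v\<in>U. \<kappa> U (x v)) powr q U * rU U x powr q U = T U x powr q U"
      by (simp add: rU_def flip: powr_mult)
  qed
  finally show ?thesis .
qed

text \<open>The theory of normalized weights is applied to the edge factors of the orbit of each
  color, with exponents that turn multiplicities in \<open>H\<close> into \<open>q\<close>. The
  integrand is that of \<Psi> where all coordinates are good, and 0 elsewhere.\<close>

lemma truncated_A_le_\<Psi>:
  assumes \<epsilon>: "0 < \<epsilon>" and u: "u \<in> V"
  shows "(\<integral>a. (if good \<epsilon> a then A u a else 0) \<partial>M) ^ n \<le> \<Psi>"
proof -
  let ?m = "nbhd_count (underlying H)"
  define A' where "A' a = (if good \<epsilon> a then A u a else 0)" for a
  \<comment> \<open>A color fixes the neighborhood only up to automorphisms; an arbitrary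
    representative will do, as \<open>SU\<close>, \<open>q\<close> and \<open>nbhd_count\<close> are
    invariant.\<close>
  define rep where "rep c = nb (SOME w. w \<in> R \<and> f w = c)" for c
  define S where "S c = SU \<epsilon> (rep c)" for c
  define \<theta> where "\<theta> c = (if 2 \<le> card (rep c) then q (rep c) / ?m (rep c) else 1)" for c
  have rep: "\<exists>w'\<in>R. f w' = f w \<and> rep (f w) = nb w' \<and> (\<exists>\<sigma>\<in>\<Gamma>. nb w = \<sigma> ` rep (f w))" if w: "w \<in> R" for w
  proof -
    let ?w = "SOME w'. w' \<in> R \<and> f w' = f w"
    have "?w \<in> R \<and> f ?w = f w"
      by (rule someI[of _ w]) (use w in simp)
    then show ?thesis
      using same_color_nbrs[of ?w w] w unfolding rep_def by blast
  qed
  have S_nb: "S (f w) = SU \<epsilon> (nb w)" if w: "w \<in> R" for w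
    using rep[OF w] SU_\<Gamma> by (auto simp: S_def)
  have \<theta>_nb: "\<theta> (f w) = (if 2 \<le> card (nb w) then q (nb w) / ?m (nb w) else 1)" if w: "w \<in> R" for w
    using rep[OF w] by (auto simp: \<theta>_def card_\<Gamma>_image q_\<Gamma> nbhd_count_\<Gamma>)
  interpret nw: normalized_weights H f M N A' S
  proof (intro normalized_weights.intro normalized_weights_axioms.intro)
    show "holder_bigraph H f"
      by unfold_locales
    show "bnm M A'"
      unfolding A'_def[abs_def] by (intro bnm_if good_sets bnm_A bnm_const) simp
    show "bnm (M \<Otimes>\<^sub>M N) (S c)" for c
      unfolding S_def by (rule bnm_SU[OF \<epsilon>])
    show "(\<integral>y. S c (a, y) \<partial>N) = 1" if "A' a \<noteq> 0" for c a
      using that SU_normalized[OF _ \<epsilon>] by (auto simp: A'_def S_def split: if_splits)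
  qed (rule M N)+
  interpret PV: prob_space PV by (rule prob_PV)
  have \<theta>: "1 \<le> \<theta> c" if c: "c \<in> f ` R" for c
  proof -
    obtain w where w: "w \<in> R" "c = f w"
      using c by auto
    show ?thesis
      using nbhd_count_le_q[OF w(1)] by (auto simp: w(2) \<theta>_nb[OF w(1)])
  qed
  have "(\<integral>a. A' a \<partial>M) ^ n \<le> (\<integral>x. (\<Prod>v\<in>V. A' (x v)) * (\<Prod>w\<in>R. nw.s w x powr \<theta> (f w)) \<partial>PV)"
    by (rule nw.weighted_density_ge[OF \<theta>])
  also have "\<dots> \<le> \<Psi>"
    unfolding \<Psi>_def
  proof (rule PV.bnm_integral_mono)
    show "bnm PV (\<lambda>x. (\<Prod>v\<in>V. A' (x v)) * (\<Prod>w\<in>R. nw.s w x powr \<theta> (f w)))"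
      using \<theta> by (intro bnm_mult nw.bnm_prodA bnm_prod bnm_powr nw.bnm_s) (auto intro: order.trans[OF zero_le_one])
    show b\<Psi>: "bnm PV (\<lambda>x. (\<Prod>v\<in>V. F0 (x v)) * (\<Prod>U\<in>\<U>. T U x powr q U))"
      by (intro bnm_mult bnm_prod bnm_powr bnm_PiM_component bnm_F0 bnm_T)
         (auto simp: \<U>_D(1) less_imp_le[OF \<U>_D(6)])
    fix x assume x: "x \<in> space PV"
    show "(\<Prod>v\<in>V. A' (x v)) * (\<Prod>w\<in>R. nw.s w x powr \<theta> (f w)) \<le> (\<Prod>v\<in>V. F0 (x v)) * (\<Prod>U\<in>\<U>. T U x powr q U)"
    proof (cases "\<forall>v\<in>V. good \<epsilon> (x v)")
      case False
      then have "(\<Prod>v\<in>V. A' (x v)) = 0"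
        using fin by (auto simp: A'_def intro!: prod_zero)
      then show ?thesis
        using bnm_nonneg[OF b\<Psi> x] by simp
    next
      case True
      then have pos: "0 < \<kappa> U (x v)" if "U \<in> \<U>" "v \<in> V" for U v
        using that \<epsilon> by (auto simp: good_def intro: less_le_trans)
      have rU_nonneg: "0 \<le> rU U x" if U: "U \<in> \<U>" for U
        unfolding rU_def using pos[OF U] \<U>_D(1)[OF U] bnm_nonneg[OF bnm_T[OF \<U>_D(1)[OF U]] x]
        by (intro divide_nonneg_nonneg prod_nonneg) (auto intro: less_imp_le)
      interpret N: prob_space N by (rule N)
      have s: "nw.s w x powr \<theta> (f w) = (if 2 \<le> card (nb w) then rU (nb w) x powr (q (nb w) / ?m (nb w)) else 1)"
        if w: "w \<in> R" for w
      proof (cases "2 \<le> card (nb w)")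
        case two: True
        then have "nw.s w x = rU (nb w) x"
          unfolding nw.s_def S_nb[OF w]
          using True nbrs_right(2)[OF wf w] nbhd_count_le_q(1)[OF w] by (intro SU_integral) auto
        then show ?thesis
          using two by (simp add: \<theta>_nb[OF w])
      next
        case one: False
        then have "nw.s w x = 1"
          unfolding nw.s_def S_nb[OF w] by (simp add: SU_def N.prob_space)
        then show ?thesis
          using one by simp
      qed
      have "(\<Prod>w\<in>R. nw.s w x powr \<theta> (f w)) =
          (\<Prod>w\<in>R. if 2 \<le> card (nb w) then rU (nb w) x powr (q (nb w) / ?m (nb w)) else 1)"
        by (rule prod.cong[OF refl s])
      also have "\<dots> = (\<Prod>w\<in>{w \<in> R. 2 \<le> card (nb w)}. rU (nb w) x powr (q (nb w) / ?m (nb w)))"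
        using fin by (simp add: prod.inter_filter)
      also have "\<dots> = (\<Prod>U\<in>{U \<in> \<U>. 2 \<le> card U}. rU U x powr q U)"
        by (rule prod_nbhd_classes[OF rU_nonneg])
      also have "\<dots> = (\<Prod>U\<in>\<U>. if 2 \<le> card U then rU U x powr q U else 1)"
        using finite_\<U> by (simp add: prod.inter_filter)
      also have "\<dots> = (\<Prod>U\<in>\<U>. rU U x powr q U)"
      proof (rule prod.cong[OF refl])
        fix U assume U: "U \<in> \<U>"
        have "0 < \<kappa> U (x v)" if "v \<in> U" for v
          using pos[OF U] \<U>_D(1)[OF U] that by auto
        then show "(if 2 \<le> card U then rU U x powr q U else 1) = rU U x powr q U"
          using rU_singleton[OF U, of x] by (simp add: not_le)
      qed
      finally have "(\<Prod>w\<in>R. nw.s w x powr \<theta> (f w)) = (\<Prod>U\<in>\<U>. rU U x powr q U)" .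
      moreover have "(\<Prod>v\<in>V. A' (x v)) = (\<Prod>v\<in>V. A u (x v))"
        using True by (simp add: A'_def)
      ultimately show ?thesis
        using prod_A_rU[OF x u pos] by simp
    qed
  qed
  finally show ?thesis
    by (simp add: A'_def)
qed

text \<open>Dominated convergence as the truncation is lifted. Where all \<open>\<kappa> U a\<close>
  are positive, \<open>a\<close> is eventually good because \<open>\<U>\<close> is finite; where one
  vanishes, \<open>A v a = 0\<close> for \<open>v \<in> U\<close>, hence \<open>A u a = 0\<close>,
  and the truncation changes nothing.\<close>

lemma integral_A_le_\<Psi>:
  assumes u: "u \<in> V"
  shows "(\<integral>a. A u a \<partial>M) ^ n \<le> \<Psi>"
proof -
  interpret M: prob_space M by (rule M)
  let ?A = "\<lambda>m a. if good (1 / real (Suc m)) a then A u a else 0"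
  have bA: "bnm M (?A m)" for m
    by (intro bnm_if good_sets bnm_A bnm_const) simp
  have "(\<lambda>m. \<integral>a. ?A m a \<partial>M) \<longlonglongrightarrow> (\<integral>a. A u a \<partial>M)"
  proof (rule integral_dominated_convergence[where w = "A u"])
    show "A u \<in> borel_measurable M" "\<And>m. ?A m \<in> borel_measurable M"
      using bnm_measurable bA bnm_A by blast+
    show "integrable M (A u)"
      by (rule M.bnm_integrable[OF bnm_A])
    show "AE a in M. norm (?A m a) \<le> A u a" for m
      by (rule AE_I2) (use bnm_nonneg[OF bnm_A] in auto)
    show "AE a in M. (\<lambda>m. ?A m a) \<longlonglongrightarrow> A u a"
    proof (rule AE_I2)
      fix a assume a: "a \<in> space M"
      show "(\<lambda>m. ?A m a) \<longlonglongrightarrow> A u a"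
      proof (cases "\<forall>U\<in>\<U>. 0 < \<kappa> U a")
        case True
        have "\<forall>\<^sub>F m in sequentially. 1 / real (Suc m) \<le> \<kappa> U a" if "U \<in> \<U>" for U
          using order_tendstoD(2)[OF LIMSEQ_Suc[OF lim_1_over_n], of "\<kappa> U a"] True that
          by (auto elim: eventually_mono)
        then have "\<forall>\<^sub>F m in sequentially. good (1 / real (Suc m)) a"
          unfolding good_def using finite_\<U> by (intro eventually_ball_finite) auto
        then have "\<forall>\<^sub>F m in sequentially. ?A m a = A u a"
          by eventually_elim simp
        then show ?thesis
          by (rule tendsto_eventually)
      next
        case False
        then obtain U where U: "U \<in> \<U>" "\<kappa> U a = 0"
          using bnm_nonneg[OF bnm_\<kappa> a] by (metis less_eq_real_def)
        obtain v where v: "v \<in> U"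
          using \<U>_D(2)[OF U(1)] by auto
        then have vV: "v \<in> V"
          using \<U>_D(1)[OF U(1)] by auto
        have "A v a = 0"
          using U v finite_\<U> by (auto simp: A_def intro!: prod_zero)
        then have "(\<lambda>m. ?A m a) = (\<lambda>m. A u a)"
          using A_eq[OF u vV] by auto
        then show ?thesis
          by (simp only: tendsto_const)
      qed
    qed
  qed
  then have "(\<lambda>m. (\<integral>a. ?A m a \<partial>M) ^ n) \<longlonglongrightarrow> (\<integral>a. A u a \<partial>M) ^ n"
    by (intro tendsto_intros)
  then show ?thesis
    by (rule LIMSEQ_le_const2) (use truncated_A_le_\<Psi>[OF _ u] in auto)
qed

section \<open>Comparison with the edge integral\<close>

lemma e_pos: "0 < e"
  using n_le_e n_pos by simp

definition target :: real where
  "target = (\<integral>a. (\<Prod>v\<in>V. F v a powr (1 / e)) * (\<integral>y. W (a, y) * (\<Prod>w\<in>RG. g w y powr (1 / e)) \<partial>N) \<partial>M)"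

text \<open>In each pair \<open>D U\<close> cancels, leaving \<open>g w\<close> the exponent
  \<open>n / (e * card \<Gamma> * card (NG w))\<close>. By \<open>card_covering\<close>,
  \<open>card (NG w) * card \<Gamma> / n\<close> automorphisms carry the neighborhood of
  \<open>w\<close> over \<open>u\<close>, so the total exponent is \<open>1 / e\<close>.\<close>

lemma prod_gU_containing:
  assumes u: "u \<in> V" and y: "y \<in> space N"
  shows "(\<Prod>U\<in>{U \<in> \<U>. u \<in> U}. gU U y powr (q U * n / (real e * real (card U)))) = (\<Prod>w\<in>RG. g w y powr (1 / e))"
proof -
  define c where "c X = real n / (real e * real (card \<Gamma>) * real (card X))" for X :: "'v set"
  have gnn: "0 \<le> g w y" if "w \<in> RG" for w
    using bnm_nonneg[OF g[OF that] y] .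
  have "(\<Prod>U\<in>{U \<in> \<U>. u \<in> U}. gU U y powr (q U * n / (real e * real (card U)))) =
      (\<Prod>U\<in>\<U>. if u \<in> U then gU U y powr (q U * n / (real e * real (card U))) else 1)"
    using finite_\<U> by (simp add: prod.inter_filter)
  also have "\<dots> = (\<Prod>U\<in>\<U>. \<Prod>p\<in>pairs U. if u \<in> snd p ` NG (fst p) then g (fst p) y powr c (NG (fst p)) else 1)"
  proof (rule prod.cong[OF refl])
    fix U assume U: "U \<in> \<U>"
    have p: "snd p ` NG (fst p) = U" "card (NG (fst p)) = card U" if "p \<in> pairs U" for p
      using that card_\<Gamma>_image by (auto simp: pairs_def)
    have "1 / D U * (q U * n / (real e * real (card U))) = c U"
      using \<U>_D(5)[OF U] by (simp add: q_def c_def)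
    then have "gU U y powr (q U * n / (real e * real (card U))) = (\<Prod>p\<in>pairs U. g (fst p) y powr c U)"
      unfolding gU_def by (simp add: prod_powr_distrib powr_powr)
    then show "(if u \<in> U then gU U y powr (q U * n / (real e * real (card U))) else 1) =
        (\<Prod>p\<in>pairs U. if u \<in> snd p ` NG (fst p) then g (fst p) y powr c (NG (fst p)) else 1)"
      using p by (auto simp: c_def intro!: prod.cong prod.neutral)
  qed
  also have "\<dots> = (\<Prod>w\<in>RG. \<Prod>\<tau>\<in>\<Gamma>. if u \<in> \<tau> ` NG w then g w y powr c (NG w) else 1)"
    by (simp add: prod_\<U>_pairs prod.cartesian_product case_prod_unfold)
  also have "\<dots> = (\<Prod>w\<in>RG. g w y powr (1 / e))"
  proof (rule prod.cong[OF refl])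
    fix w assume w: "w \<in> RG"
    define k where "k = card {\<tau> \<in> \<Gamma>. u \<in> \<tau> ` NG w}"
    have k: "n * k = card (NG w) * card \<Gamma>"
      unfolding k_def by (rule card_covering[OF NG_V[OF w] u])
    have cN: "0 < card (NG w)"
      using finite_NG[OF w] NG_nonempty[OF w] by (simp add: card_gt_0_iff)
    then have kpos: "0 < k"
      using k card_\<Gamma>_pos by (cases k) auto
    have "real k * c (NG w) = real (n * k) / (real e * real (card \<Gamma>) * real (card (NG w)))"
      by (simp add: c_def)
    also have "\<dots> = 1 / e"
      unfolding k using cN card_\<Gamma>_pos by simp
    finally have kc: "real k * c (NG w) = 1 / e" .
    have "(\<Prod>\<tau>\<in>\<Gamma>. if u \<in> \<tau> ` NG w then g w y powr c (NG w) else 1) = (g w y powr c (NG w)) ^ k"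
      using finite_\<Gamma> by (simp add: k_def flip: prod.inter_filter)
    also have "\<dots> = g w y powr (1 / e)"
      using kpos kc powr_power[of "g w y" "c (NG w)" k] by (cases "g w y = 0") auto
    finally show "(\<Prod>\<tau>\<in>\<Gamma>. if u \<in> \<tau> ` NG w then g w y powr c (NG w) else 1) = g w y powr (1 / e)" .
  qed
  finally show ?thesis .
qed

text \<open>Hoelder's inequality over the sets through \<open>u\<close> with weights
  \<open>q U * n / e\<close>: the powers of \<open>W\<close> recombine to \<open>W\<close>, and
  those of \<open>gU\<close> to the weight of the edge integral.\<close>

lemma \<kappa>_prod_ge:
  assumes u: "u \<in> V" and a: "a \<in> space M"
  shows "(\<integral>y. W (a, y) * (\<Prod>w\<in>RG. g w y powr (1 / e)) \<partial>N) \<le> (\<Prod>U\<in>{U \<in> \<U>. u \<in> U}. \<kappa> U a powr (q U * n / e))"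
proof -
  interpret N: prob_space N by (rule N)
  let ?I = "{U \<in> \<U>. u \<in> U}"
  have sum1: "(\<Sum>U\<in>?I. q U * n / e) = 1"
    using sum_q_containing[OF u] e_pos n_pos by (simp flip: sum_divide_distrib sum_distrib_right)
  have "(\<integral>y. W (a, y) * (\<Prod>w\<in>RG. g w y powr (1 / e)) \<partial>N) =
      (\<integral>y. (\<Prod>U\<in>?I. (W (a, y) * gU U y powr (1 / card U)) powr (q U * n / e)) \<partial>N)"
  proof (rule Bochner_Integration.integral_cong[OF refl])
    fix y assume y: "y \<in> space N"
    have W0: "0 \<le> W (a, y)"
      using bnm_nonneg[OF bnm_W_right[OF a] y] .
    \<comment> \<open>Needed when \<open>W (a, y) = 0\<close>: the product of zeros is 0 only over a
      nonempty index set.\<close>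
    have ne: "?I \<noteq> {}"
      using sum1 by (metis sum.empty zero_neq_one)
    have "(\<Prod>U\<in>?I. (W (a, y) * gU U y powr (1 / card U)) powr (q U * n / e)) =
        (\<Prod>U\<in>?I. W (a, y) powr (q U * n / e)) * (\<Prod>U\<in>?I. gU U y powr (q U * n / (real e * real (card U))))"
      unfolding prod.distrib[symmetric] by (intro prod.cong refl) (simp add: powr_mult powr_powr mult.commute)
    also have "(\<Prod>U\<in>?I. W (a, y) powr (q U * n / e)) = W (a, y)"
    proof (cases "W (a, y) = 0")
      case True
      then show ?thesis
        using ne finite_\<U> card_gt_0_iff[of ?I] by simp
    next
      case False
      then have "(\<Prod>U\<in>?I. W (a, y) powr (q U * n / e)) = W (a, y) powr (\<Sum>U\<in>?I. q U * n / e)"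
        by (rule powr_sum[symmetric])
      then show ?thesis
        using sum1 W0 by simp
    qed
    also have "(\<Prod>U\<in>?I. gU U y powr (q U * n / (real e * real (card U)))) = (\<Prod>w\<in>RG. g w y powr (1 / e))"
      by (rule prod_gU_containing[OF u y])
    finally show "W (a, y) * (\<Prod>w\<in>RG. g w y powr (1 / e)) =
        (\<Prod>U\<in>?I. (W (a, y) * gU U y powr (1 / card U)) powr (q U * n / e))" ..
  qed
  also have "\<dots> \<le> (\<Prod>U\<in>?I. \<kappa> U a powr (q U * n / e))"
    unfolding \<kappa>_def
    by (intro N.holder_prod sum1 bnm_mult bnm_W_right[OF a] bnm_powr bnm_gU)
       (use finite_\<U> in \<open>auto intro!: divide_nonneg_nonneg mult_nonneg_nonneg less_imp_le[OF \<U>_D(6)]\<close>)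
  finally show ?thesis .
qed

lemma bnm_target_right: "bnm M (\<lambda>a. \<integral>y. W (a, y) * (\<Prod>w\<in>RG. g w y powr (1 / e)) \<partial>N)"
proof -
  have "bnm (M \<Otimes>\<^sub>M N) (\<lambda>z. W z * (\<Prod>w\<in>RG. g w (snd z) powr (1 / e)))"
    by (intro bnm_mult W bnm_prod bnm_powr bnm_compose[OF g]) auto
  from bnm_integral[OF N this] show ?thesis by simp
qed

text \<open>The power \<open>e / n\<close> turns the exponents \<open>1 / e\<close> and
  \<open>q U * n / e\<close> into the \<open>1 / n\<close> and \<open>q U\<close> of
  \<open>A u\<close>. It is at least 1 because every left vertex of \<open>G\<close> lies on an
  edge, so Jensen's inequality applies.\<close>

lemma target_le_integral_A:
  assumes u: "u \<in> V"
  shows "target ^ e \<le> (\<integral>a. A u a \<partial>M) ^ n"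
proof -
  interpret M: prob_space M by (rule M)
  define h where "h a = (\<Prod>v\<in>V. F v a powr (1 / e)) * (\<integral>y. W (a, y) * (\<Prod>w\<in>RG. g w y powr (1 / e)) \<partial>N)" for a
  have bh: "bnm M h"
    unfolding h_def[abs_def] by (intro bnm_mult bnm_prod bnm_powr F bnm_target_right) auto
  have hA: "h a powr (e / n) \<le> A u a" if a: "a \<in> space M" for a
  proof -
    have Fnn: "0 \<le> F v a" if "v \<in> V" for v
      using bnm_nonneg[OF F[OF that] a] .
    have \<kappa>nn: "0 \<le> \<kappa> U a" for U
      using bnm_nonneg[OF bnm_\<kappa> a] .
    have "h a \<le> (\<Prod>v\<in>V. F v a powr (1 / e)) * (\<Prod>U\<in>{U \<in> \<U>. u \<in> U}. \<kappa> U a powr (q U * n / e))"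
      unfolding h_def by (intro mult_left_mono \<kappa>_prod_ge[OF u a] prod_nonneg) simp
    then have "h a powr (e / n) \<le>
        ((\<Prod>v\<in>V. F v a powr (1 / e)) * (\<Prod>U\<in>{U \<in> \<U>. u \<in> U}. \<kappa> U a powr (q U * n / e))) powr (e / n)"
      using bnm_nonneg[OF bh a] by (intro powr_mono2) auto
    also have "\<dots> = (\<Prod>v\<in>V. F v a powr (1 / e * (e / n))) *
        (\<Prod>U\<in>{U \<in> \<U>. u \<in> U}. \<kappa> U a powr (q U * n / e * (e / n)))"
      by (simp add: powr_mult prod_nonneg prod_powr_distrib powr_powr del: times_divide_eq_left times_divide_eq_right)
    also have "\<dots> = A u a"
      using e_pos n_pos by (simp add: A_def F0_def)
    finally show ?thesis .
  qed
  have "0 \<le> target"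
    unfolding target_def using M.bnm_integral_nonneg[OF bh] by (simp add: h_def)
  have "target powr (e / n) \<le> (\<integral>a. h a powr (e / n) \<partial>M)"
    unfolding target_def h_def[symmetric] using n_le_e n_pos by (intro M.integral_powr_ge bh) auto
  also have "\<dots> \<le> (\<integral>a. A u a \<partial>M)"
    by (intro M.bnm_integral_mono bnm_powr bh bnm_A hA) auto
  finally have "(target powr (e / n)) ^ n \<le> (\<integral>a. A u a \<partial>M) ^ n"
    by (intro power_mono) auto
  moreover have "(target powr (e / n)) ^ n = target ^ e"
    using \<open>0 \<le> target\<close> n_pos e_pos powr_power[of target "e / n" n]
    by (cases "target = 0") (auto simp: powr_realpow zero_power)
  ultimately show ?thesis by simp
qed

section \<open>Assembly of the inequality\<close>

lemma target_le_\<Phi>: "target ^ e \<le> \<Phi>"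
proof -
  obtain u where "u \<in> V"
    using V_nonempty by auto
  then show ?thesis
    using target_le_integral_A integral_A_le_\<Psi> \<Psi>_le_\<Phi> by (meson order.trans)
qed

lemma density_eq_\<Phi>:
  "(\<integral>(x, y). (\<Prod>v\<in>lverts G. F v (x v)) * (\<Prod>w\<in>rverts G. g w (y w)) *
       (\<Prod>(v, w)\<in>edges G. W (x v, y w)) \<partial>(assignments G M N)) = \<Phi>"
proof -
  let ?h = "\<lambda>w z. g w (snd z) * (\<Prod>v\<in>NG w. W (fst z v, snd z))"
  have "(\<integral>(x, y). (\<Prod>v\<in>lverts G. F v (x v)) * (\<Prod>w\<in>rverts G. g w (y w)) *
       (\<Prod>(v, w)\<in>edges G. W (x v, y w)) \<partial>(assignments G M N))
     = (\<integral>(x, y). (\<Prod>v\<in>V. F v (x v)) * (\<Prod>w\<in>RG. ?h w (x, y w)) \<partial>(PV \<Otimes>\<^sub>M (\<Pi>\<^sub>M w\<in>RG. N)))"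
    unfolding assignments_def lvG prod_edges_right[OF wfG] by (simp add: prod.distrib mult.assoc)
  also have "\<dots> = (\<integral>x. (\<Prod>v\<in>V. F v (x v)) * (\<Prod>w\<in>RG. \<integral>y. ?h w (x, y) \<partial>N) \<partial>PV)"
  proof (rule integral_bipartite[OF M N fin(1) finG(1)])
    show "bnm PV (\<lambda>x. \<Prod>v\<in>V. F v (x v))"
      by (intro bnm_prod bnm_PiM_component F)
    show "bnm (PV \<Otimes>\<^sub>M N) (?h w)" if "w \<in> RG" for w
      by (intro bnm_mult bnm_compose[OF g[OF that]] bnm_prod_component NG_V[OF that] W) auto
  qed
  finally show ?thesis
    by (simp add: \<Phi>_def)
qed

lemma edge_density_eq_target:
  "(\<integral>(x, y). (\<Prod>v\<in>lverts G. F v x powr (1 / real (card (edges G)))) *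
       (\<Prod>w\<in>rverts G. g w y powr (1 / real (card (edges G)))) * W (x, y) \<partial>(M \<Otimes>\<^sub>M N)) = target"
proof -
  interpret M: prob_space M by (rule M)
  interpret N: prob_space N by (rule N)
  interpret P: pair_prob_space M N ..
  let ?k = "\<lambda>(x, y). (\<Prod>v\<in>V. F v x powr (1 / e)) * (\<Prod>w\<in>RG. g w y powr (1 / e)) * W (x, y)"
  have "bnm (M \<Otimes>\<^sub>M N) (\<lambda>z. (\<Prod>v\<in>V. F v (fst z) powr (1 / e)) * (\<Prod>w\<in>RG. g w (snd z) powr (1 / e)) * W z)"
    by (intro bnm_mult bnm_prod bnm_powr bnm_compose[OF F] bnm_compose[OF g] W) auto
  then have "integrable (M \<Otimes>\<^sub>M N) ?k"
    unfolding case_prod_unfold prod.collapse by (rule P.bnm_integrable)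
  then have "(\<integral>z. ?k z \<partial>(M \<Otimes>\<^sub>M N)) = (\<integral>x. (\<integral>y. ?k (x, y) \<partial>N) \<partial>M)"
    by (rule P.integral_fst'[symmetric])
  also have "\<dots> = target"
    unfolding target_def by (simp add: mult.assoc mult.commute[of "W _"])
  finally show ?thesis
    unfolding lvG e_def[symmetric] .
qed

end

lemma (in dominating_bigraph) strong_sidorenko_dominating: "strong_sidorenko TYPE('x) TYPE('y) G"
  unfolding strong_sidorenko_def
proof (intro allI impI)
  fix M :: "'x measure" and N :: "'y measure" and W F g
  assume *: "bigraphon M N W \<and> (\<forall>v\<in>lverts G. bnm M (F v)) \<and> (\<forall>w\<in>rverts G. bnm N (g w))"
  interpret dominating_weights H f G M N W F g
    by (intro dominating_weights.intro dominating_weights_axioms.intro dominating_bigraph_axioms)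
      (use * in \<open>auto simp: bigraphon_def lvG\<close>)
  show "(\<integral>(x, y). (\<Prod>v\<in>lverts G. F v x powr (1 / real (card (edges G)))) *
       (\<Prod>w\<in>rverts G. g w y powr (1 / real (card (edges G)))) * W (x, y) \<partial>(M \<Otimes>\<^sub>M N)) ^ card (edges G)
     \<le> (\<integral>(x, y). (\<Prod>v\<in>lverts G. F v (x v)) * (\<Prod>w\<in>rverts G. g w (y w)) *
       (\<Prod>(v, w)\<in>edges G. W (x v, y w)) \<partial>(assignments G M N))"
    unfolding density_eq_\<Phi> edge_density_eq_target using target_le_\<Phi> by (simp add: e_def)
qed

theorem theorem3p7:
  fixes H :: "('v, 'c) colored_bigraph" and G :: "'v bigraph"
  assumes "wf_bigraph (underlying H)"
    and "non_trivial (underlying H)"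
    and "no_isolated_vertices (underlying H)"
    and "right_uniform H"
    and "color_edge_transitive H"
    and "left_weakly_holder TYPE(real) TYPE(real) H"
    and "wf_bigraph G"
    and "lverts G = lverts (underlying H)"
    and "no_isolated_vertices G"
    and "\<And>U. U \<subseteq> lverts G \<Longrightarrow> card U \<ge> 2 \<Longrightarrow>
           (\<Sum>\<sigma>\<in>aut H. nbhd_count G (\<sigma> ` U)) = 0 \<longleftrightarrow>
           (\<Sum>\<sigma>\<in>aut H. nbhd_count (underlying H) (\<sigma> ` U)) = 0"
    and "\<And>U. U \<subseteq> lverts G \<Longrightarrow> card U \<ge> 2 \<Longrightarrow>
           (\<Sum>\<sigma>\<in>aut H. nbhd_count G (\<sigma> ` U)) \<ge>
           (\<Sum>\<sigma>\<in>aut H. nbhd_count (underlying H) (\<sigma> ` U))"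
  shows "strong_sidorenko TYPE('x) TYPE('y) G \<and>
         strong_sidorenko TYPE('x) TYPE('y) (underlying H)"
proof -
  obtain f where f: "\<And>v w. (v, w) \<in> edges (underlying H) \<Longrightarrow> coloring H (v, w) = f w"
    using assms(4) by (auto simp: right_uniform_def)
  interpret holder_bigraph H f
    by unfold_locales (use assms f in auto)
  have "dominating_bigraph H f G"
    by unfold_locales (use assms in auto)
  \<comment> \<open>With \<open>G\<close> the underlying bigraph of \<open>H\<close>, both
    conditions compare a sum with itself.\<close>
  moreover have "dominating_bigraph H f (underlying H)"
    by unfold_locales (use assms in auto)
  ultimately show ?thesis
    using dominating_bigraph.strong_sidorenko_dominating by blast
qed

end
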